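(* Let $(\mu_n)_{n\in\mathbb N}$ be a sequence of positive definite measures on $\mathbb R^d$, and let $\mu$ be a measure on $\mathbb R^d$ such that (i) for all $f\in\mathcal S(\mathbb R^d)$, $\lim_{n\to\infty}\mu_n(e^{-2\pi it\cdot}f)=\mu(e^{-2\pi it\cdot}f)$ uniformly in $t\in\mathbb R^d$, and (ii) $\{\mu_n:n\in\mathbb N\}$ is vaguely bounded. Then $\mu$ is positive definite and $\lim_{n\to\infty}\widehat{\mu_n}=\widehat\mu$ in the product topology.
   Context: Measures on $\mathbb R^d$ are complex Radon measures. With $\widetilde f(x)=\overline{f(-x)}$, $\mu$ is positive definite if $\mu(f*\widetilde f)\ge0$ for all $f\in C_c(\mathbb R^d)$; such $\mu$ is tempered and has a Fourier transform $\widehat\mu$, the measure with $\check f\in L^2(\widehat\mu)$ and $\mu(f*\widetilde f)=\widehat\mu(|\check f|^2)$ for all $f\in C_c$, $\check f(y)=\int f(x)e^{2\pi ixy}dx$. $e^{-2\pi it\cdot}f$ is $x\mapsto e^{-2\pi itx}f(x)$, and for Schwartz $g$, $\mu(g)$ is the action as a tempered distribution. Vaguely bounded: $\{\mu_n(f)\}$ bounded for each $f\in C_c$. Product topology: $\nu_n\to\nu$ iff $\|(\nu_n-\nu)*g\|_\infty\to0$ for all $g\in C_c(\mathbb R^d)$. *)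

theory Defs
  imports "HOL-Analysis.Analysis"
begin

text \<open>A complex Radon measure on a Euclidean space is represented by a pair (M, h):
  M a Borel measure that is finite on compact sets (the variation measure) and
  h a Borel function of modulus one (the polar density), so that the measure is h dM.\<close>

type_synonym 'a cmeasure = "'a measure \<times> ('a \<Rightarrow> complex)"

definition radon :: "'a::euclidean_space cmeasure \<Rightarrow> bool" where
  "radon \<mu> \<longleftrightarrow> sets (fst \<mu>) = sets borel \<and>
     (\<forall>K. compact K \<longrightarrow> emeasure (fst \<mu>) K < \<infinity>) \<and>
     snd \<mu> \<in> borel_measurable (fst \<mu>) \<and> (\<forall>x. norm (snd \<mu> x) = 1)"

definition cm_integrable :: "'a::euclidean_space cmeasure \<Rightarrow> ('a \<Rightarrow> complex) \<Rightarrow> bool" where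
  "cm_integrable \<mu> g \<longleftrightarrow> integrable (fst \<mu>) (\<lambda>x. g x * snd \<mu> x)"

definition cm_int :: "'a::euclidean_space cmeasure \<Rightarrow> ('a \<Rightarrow> complex) \<Rightarrow> complex" where
  "cm_int \<mu> g = (LINT x | fst \<mu>. g x * snd \<mu> x)"

definition Cc :: "('a::euclidean_space \<Rightarrow> complex) \<Rightarrow> bool" where
  "Cc f \<longleftrightarrow> continuous_on UNIV f \<and> compact (closure {x. f x \<noteq> 0})"

definition conv :: "('a::euclidean_space \<Rightarrow> complex) \<Rightarrow> ('a \<Rightarrow> complex) \<Rightarrow> 'a \<Rightarrow> complex" where
  "conv f g x = (LINT y | lborel. f y * g (x - y))"

definition tilde :: "('a::euclidean_space \<Rightarrow> complex) \<Rightarrow> 'a \<Rightarrow> complex" where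
  "tilde f x = cnj (f (- x))"

definition icheck :: "('a::euclidean_space \<Rightarrow> complex) \<Rightarrow> 'a \<Rightarrow> complex" where
  "icheck f y = (LINT x | lborel. f x * exp (2 * of_real pi * \<i> * of_real (x \<bullet> y)))"

definition pos_def :: "'a::euclidean_space cmeasure \<Rightarrow> bool" where
  "pos_def \<mu> \<longleftrightarrow> (\<forall>f. Cc f \<longrightarrow>
      Im (cm_int \<mu> (conv f (tilde f))) = 0 \<and> Re (cm_int \<mu> (conv f (tilde f))) \<ge> 0)"

definition is_FT :: "'a::euclidean_space cmeasure \<Rightarrow> 'a cmeasure \<Rightarrow> bool" where
  "is_FT \<mu> \<nu> \<longleftrightarrow> radon \<nu> \<and> (\<forall>f. Cc f \<longrightarrow>
      cm_integrable \<nu> (\<lambda>y. of_real ((cmod (icheck f y))\<^sup>2)) \<and>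
      cm_int \<mu> (conv f (tilde f)) = cm_int \<nu> (\<lambda>y. of_real ((cmod (icheck f y))\<^sup>2)))"

definition pd :: "'a::euclidean_space \<Rightarrow> ('a \<Rightarrow> complex) \<Rightarrow> 'a \<Rightarrow> complex" where
  "pd i f x = vector_derivative (\<lambda>s::real. f (x + s *\<^sub>R i)) (at 0)"

fun Dp :: "'a::euclidean_space list \<Rightarrow> ('a \<Rightarrow> complex) \<Rightarrow> 'a \<Rightarrow> complex" where
  "Dp [] f = f"
| "Dp (i # is) f = pd i (Dp is f)"

definition schwartz :: "('a::euclidean_space \<Rightarrow> complex) \<Rightarrow> bool" where
  "schwartz f \<longleftrightarrow> (\<forall>is. set is \<subseteq> Basis \<longrightarrow>
      continuous_on UNIV (Dp is f) \<and>
      (\<forall>i\<in>Basis. \<forall>x. (\<lambda>s::real. Dp is f (x + s *\<^sub>R i)) differentiable (at 0)) \<and>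
      (\<forall>k::nat. bounded (range (\<lambda>x. ((1 + norm x) ^ k) *\<^sub>R Dp is f x))))"

definition sn :: "nat \<Rightarrow> 'a::euclidean_space list \<Rightarrow> ('a \<Rightarrow> complex) \<Rightarrow> real" where
  "sn k is f = (SUP x. (1 + norm x) ^ k * norm (Dp is f x))"

definition S_lim :: "(nat \<Rightarrow> 'a::euclidean_space \<Rightarrow> complex) \<Rightarrow> ('a \<Rightarrow> complex) \<Rightarrow> bool" where
  "S_lim \<phi> g \<longleftrightarrow> (\<forall>is k. set is \<subseteq> Basis \<longrightarrow>
      (\<lambda>j. sn k is (\<lambda>x. \<phi> j x - g x)) \<longlonglongrightarrow> 0)"

text \<open>mu is tempered: its restriction to smooth compactly supported functions is
  (sequentially) continuous for the Schwartz topology.\<close>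
definition tempered :: "'a::euclidean_space cmeasure \<Rightarrow> bool" where
  "tempered \<mu> \<longleftrightarrow> (\<forall>\<phi>. (\<forall>j. Cc (\<phi> j) \<and> schwartz (\<phi> j)) \<and> S_lim \<phi> (\<lambda>_. 0) \<longrightarrow>
      (\<lambda>j. cm_int \<mu> (\<phi> j)) \<longlonglongrightarrow> 0)"

text \<open>Action of a (tempered) measure on a Schwartz function: the continuous extension.\<close>
definition act :: "'a::euclidean_space cmeasure \<Rightarrow> ('a \<Rightarrow> complex) \<Rightarrow> complex" where
  "act \<mu> g = (THE c. \<forall>\<phi>. (\<forall>j. Cc (\<phi> j) \<and> schwartz (\<phi> j)) \<and> S_lim \<phi> g \<longrightarrow>
      (\<lambda>j. cm_int \<mu> (\<phi> j)) \<longlonglongrightarrow> c)"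

definition vaguely_bounded :: "(nat \<Rightarrow> 'a::euclidean_space cmeasure) \<Rightarrow> bool" where
  "vaguely_bounded \<mu>s \<longleftrightarrow> (\<forall>f. Cc f \<longrightarrow> bounded (range (\<lambda>n. cm_int (\<mu>s n) f)))"

definition mconv :: "'a::euclidean_space cmeasure \<Rightarrow> ('a \<Rightarrow> complex) \<Rightarrow> 'a \<Rightarrow> complex" where
  "mconv \<nu> g x = cm_int \<nu> (\<lambda>y. g (x - y))"

definition prod_conv :: "(nat \<Rightarrow> 'a::euclidean_space cmeasure) \<Rightarrow> 'a cmeasure \<Rightarrow> bool" where
  "prod_conv \<nu>s \<nu> \<longleftrightarrow> (\<forall>g. Cc g \<longrightarrow>
      uniform_limit UNIV (\<lambda>n. mconv (\<nu>s n) g) (mconv \<nu> g) sequentially)"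

end

theory Submission
  imports Defs "HOL-Probability.Sinc_Integral"
begin

text \<open>On test functions, i.e. smooth functions of compact support, the action of a tempered measure is
  integration.  So only two things about \<open>\<mu>\<^sub>n\<close> matter: that it is tempered, and the values of the integrals
  of \<open>e\<^sub>t \<phi>\<close>, where \<open>e\<^sub>t\<close> is the character \<open>x \<mapsto> exp (-2\<pi>itx)\<close> and \<open>\<phi>\<close> is a test function.

  Temperedness: by polarization and translation invariance of the form \<open>\<mu>(p * q~)\<close>, the convolution of a
  positive definite measure with \<open>p * q\<close> is bounded for \<open>p, q \<in> C\<^sub>c\<close>, and a parametrix, used twice, writes
  every test function as a finite sum of functions \<open>p * q * \<psi>\<close> with \<open>\<psi>\<close> a derivative of the test function.

  Positive definiteness passes to the limit on \<open>f * f~\<close> for \<open>f\<close> smooth, and then by mollification for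
  \<open>f \<in> C\<^sub>c\<close>.

  For the transforms, write \<open>f^\<close> for \<open>icheck f\<close>.  Polarization gives
  \<open>\<mu>(e\<^sub>t (p * h~)) = \<integral> p^(y - t) cnj (h^(y - t)) d\<nu>(y)\<close>.  Given \<open>g \<in> C\<^sub>c\<close>, choose a test function \<open>h\<close>
  such that \<open>h^\<close> has no zero on the support of \<open>g\<close>, and approximate \<open>g / |h^|\<^sup>2\<close> uniformly up to \<open>\<eta>\<close> by some
  \<open>q^\<close> with \<open>q \<in> C\<^sub>c\<close> (Fejer summation).  Then \<open>p = h * q\<close> satisfies \<open>|g - p^ cnj h^| \<le> \<eta> |h^|\<^sup>2\<close>, and since the
  transforms \<open>\<nu>\<^sub>n\<close> are positive measures, the error in \<open>\<nu>\<^sub>n * g\<close> is at most \<open>\<eta>\<close> times \<open>|\<mu>\<^sub>n(e\<^sub>t (h * h~))|\<close>,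
  which is bounded uniformly in \<open>n\<close> and \<open>t\<close> by the hypothesis itself.\<close>

subsection \<open>Continuous functions of compact support\<close>

text \<open>The transform \<nu> may have infinite mass, and \<open>is_FT\<close> controls it only
  through integrals of |f^|^2. A uniformly small error is useless against such a measure; it has to
  be small relative to some |h^|^2, hence the division by |h^|^2 before the approximation. Since h
  is a test function, so is h * q for every q in C_c, which brings p * h~ within reach of the
  hypothesis.

  \<open>is_FT\<close> also allows \<nu> to be complex, so that its polar density is 1 almost
  everywhere must be derived. For g \<ge> 0 in C_c, the same division writes sqrt g as h^ g1;
  approximating g1 by q^ makes g a dominated limit of |(h * q)^|^2, and the \<nu>-integrals of these
  functions are values of \<mu> on squares f * f~. Outer regularity then passes from C_c through
  open sets to Borel sets.

  The parametrix is used twice because the available bound concerns translates of a product p * q: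
  translating p leaves \<mu>(p * p~) unchanged. A bound with a single factor would amount to
  translation boundedness, which may fail.\<close>

lemma Cc_iff: "Cc f \<longleftrightarrow> continuous_on UNIV f \<and> (\<exists>R. \<forall>x. R < norm x \<longrightarrow> f x = 0)"
proof -
  have "compact (closure {x. f x \<noteq> 0}) \<longleftrightarrow> (\<exists>R. \<forall>x. R < norm x \<longrightarrow> f x = 0)"
  proof -
    have "compact (closure {x. f x \<noteq> 0}) \<longleftrightarrow> bounded {x. f x \<noteq> 0}"
      using bounded_closure[of "{x. f x \<noteq> 0}"] bounded_subset[OF _ closure_subset]
      by (auto simp: compact_eq_bounded_closed)
    also have "\<dots> \<longleftrightarrow> (\<exists>R. \<forall>x. R < norm x \<longrightarrow> f x = 0)"
      unfolding bounded_iff by (auto simp: not_less[symmetric])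
    finally show ?thesis .
  qed
  then show ?thesis by (simp add: Cc_def)
qed

lemma CcI:
  assumes "continuous_on UNIV f" "\<And>x. R < norm x \<Longrightarrow> f x = 0"
  shows "Cc f"
  using assms by (auto simp: Cc_iff)

lemma CcE:
  assumes "Cc f"
  obtains R B where "0 < R" "0 < B" "\<And>x. R < norm x \<Longrightarrow> f x = 0" "\<And>x. norm (f x) \<le> B"
    "continuous_on UNIV f"
proof -
  from assms obtain R where c: "continuous_on UNIV f" and R: "\<And>x. R < norm x \<Longrightarrow> f x = 0"
    by (auto simp: Cc_iff)
  have "compact (f ` cball 0 R)"
    by (intro compact_continuous_image continuous_on_subset[OF c]) auto
  then obtain B where "\<forall>x\<in>f ` cball 0 R. norm x \<le> B"
    using compact_imp_bounded[of "f ` cball 0 R"] unfolding bounded_iff by blast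
  then have B: "\<And>x. norm x \<le> R \<Longrightarrow> norm (f x) \<le> B"
    by simp
  show ?thesis
  proof (rule that[of "max 1 R" "max 1 B"])
    fix x show "norm (f x) \<le> max 1 B"
      using B[of x] R[of x] by (cases "norm x \<le> R") auto
  qed (use R c in auto)
qed

lemma Cc_continuous: "Cc f \<Longrightarrow> continuous_on UNIV f"
  by (simp add: Cc_def)

lemma Cc_borel: "Cc f \<Longrightarrow> f \<in> borel_measurable borel"
  by (intro borel_measurable_continuous_onI Cc_continuous)

lemma Cc_mult_right:
  assumes "Cc f" "continuous_on UNIV g" shows "Cc (\<lambda>x. f x * g x)"
  using assms by (auto simp: Cc_iff intro!: continuous_intros)

lemma Cc_mult_left:
  assumes "Cc f" "continuous_on UNIV g" shows "Cc (\<lambda>x. g x * f x)"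
  using assms by (auto simp: Cc_iff intro!: continuous_intros)

lemma Cc_add:
  assumes "Cc f" "Cc g" shows "Cc (\<lambda>x. f x + g x)"
proof -
  from assms obtain R S where "\<forall>x. R < norm x \<longrightarrow> f x = 0" "\<forall>x. S < norm x \<longrightarrow> g x = 0"
    by (auto simp: Cc_iff)
  then show ?thesis using assms
    by (auto simp: Cc_iff intro!: continuous_intros exI[of _ "max R S"])
qed

lemma Cc_scale: "Cc f \<Longrightarrow> Cc (\<lambda>x. c * f x)"
  by (rule Cc_mult_left) auto

lemma Cc_shift:
  fixes f :: "'a::euclidean_space \<Rightarrow> complex"
  assumes "Cc f" shows "Cc (\<lambda>x. f (x - a))"
proof -
  from assms obtain R where c: "continuous_on UNIV f" and R: "\<And>x. R < norm x \<Longrightarrow> f x = 0"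
    by (auto simp: Cc_iff)
  show ?thesis
  proof (rule CcI[of _ "R + norm a"])
    show "continuous_on UNIV (\<lambda>x. f (x - a))"
      by (intro continuous_on_compose2[OF c] continuous_intros) auto
    fix x :: 'a assume "R + norm a < norm x"
    then show "f (x - a) = 0" using norm_triangle_ineq2[of x a] by (intro R) linarith
  qed
qed

lemma Cc_reflect:
  fixes f :: "'a::euclidean_space \<Rightarrow> complex"
  assumes "Cc f" shows "Cc (\<lambda>x. f (- x))"
proof -
  from assms obtain R where c: "continuous_on UNIV f" and R: "\<And>x. R < norm x \<Longrightarrow> f x = 0"
    by (auto simp: Cc_iff)
  show ?thesis
    by (rule CcI[of _ R]) (auto intro!: R continuous_on_compose2[OF c] continuous_intros)
qed

lemma Cc_tilde: "Cc f \<Longrightarrow> Cc (tilde f)"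
  using Cc_reflect[of f] unfolding Cc_iff tilde_def by (auto intro!: continuous_intros)

lemma tilde_tilde [simp]: "tilde (tilde f) = f"
  by (simp add: tilde_def fun_eq_iff)

subsection \<open>Locally finite Borel measures\<close>

text \<open>The property shared by \<open>lborel\<close> and the variation measure of a Radon
  measure, so that integrability and Fubini are proved once for both.\<close>

definition locfin :: "'a::euclidean_space measure \<Rightarrow> bool" where
  "locfin M \<longleftrightarrow> sets M = sets borel \<and> (\<forall>K. compact K \<longrightarrow> emeasure M K < \<infinity>)"

lemma locfin_lborel: "locfin lborel"
  using emeasure_compact_finite by (auto simp: locfin_def)

lemma radon_locfin: "radon \<mu> \<Longrightarrow> locfin (fst \<mu>)"
  by (auto simp: radon_def locfin_def)

lemma radon_density_borel: "radon \<mu> \<Longrightarrow> snd \<mu> \<in> borel_measurable borel"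
  using measurable_cong_sets[of "fst \<mu>" borel borel borel] by (auto simp: radon_def)

lemma radon_density_norm: "radon \<mu> \<Longrightarrow> norm (snd \<mu> x) = 1"
  by (auto simp: radon_def)

lemma locfin_space: "locfin M \<Longrightarrow> space M = UNIV"
  using sets_eq_imp_space_eq[of M borel] by (simp add: locfin_def)

lemma locfin_measurable: "locfin M \<Longrightarrow> f \<in> measurable borel N \<Longrightarrow> f \<in> measurable M N"
  using measurable_cong_sets[of M borel N N] by (simp add: locfin_def)

lemma locfin_sigma_finite:
  fixes M :: "'a::euclidean_space measure"
  assumes "locfin M" shows "sigma_finite_measure M"
proof
  show "\<exists>A. countable A \<and> A \<subseteq> sets M \<and> \<Union>A = space M \<and> (\<forall>a\<in>A. emeasure M a \<noteq> \<infinity>)"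
  proof (intro exI conjI ballI)
    show "countable (range (\<lambda>n. cball (0::'a) (real n)))" by simp
    show "range (\<lambda>n. cball (0::'a) (real n)) \<subseteq> sets M"
      using assms by (auto simp: locfin_def)
    show "\<Union>(range (\<lambda>n. cball (0::'a) (real n))) = space M"
      using real_arch_simple by (auto simp: locfin_space[OF assms])
    fix a assume "a \<in> range (\<lambda>n. cball (0::'a) (real n))"
    then have "compact a" by auto
    then have "emeasure M a < \<infinity>" using assms by (auto simp: locfin_def)
    then show "emeasure M a \<noteq> \<infinity>" by simp
  qed
qed

lemma integrable_bounded_support:
  fixes f :: "'a::euclidean_space \<Rightarrow> 'b::{banach, second_countable_topology}"
  assumes M: "locfin M" and f: "f \<in> borel_measurable borel"
    and B: "\<And>x. norm (f x) \<le> B" and R: "\<And>x. R < norm x \<Longrightarrow> f x = 0"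
  shows "integrable M f"
proof (rule Bochner_Integration.integrable_bound)
  show "integrable M (\<lambda>x. B * indicator (cball 0 R) x)"
    using M by (intro integrable_mult_right) (auto simp: locfin_def)
  show "f \<in> borel_measurable M" by (rule locfin_measurable[OF M f])
  have "0 \<le> B" using norm_ge_zero[of "f 0"] B[of 0] by linarith
  then show "AE x in M. norm (f x) \<le> norm (B * indicator (cball 0 R) x)"
    using B R by (intro AE_I2) (auto simp: indicator_def not_le)
qed

lemma integrable_Cc:
  assumes "locfin M" "Cc f" shows "integrable M f"
proof -
  from assms(2) obtain R B where "\<And>x. R < norm x \<Longrightarrow> f x = 0" "\<And>x. norm (f x) \<le> B"
    by (metis CcE)
  then show ?thesis
    by (intro integrable_bounded_support[OF assms(1) Cc_borel[OF assms(2)]]) auto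
qed

lemma cm_integrable_Cc:
  assumes "radon \<mu>" "Cc f" shows "cm_integrable \<mu> f"
proof -
  from assms(2) obtain R B where RB: "\<And>x. R < norm x \<Longrightarrow> f x = 0" "\<And>x. norm (f x) \<le> B"
    by (metis CcE)
  note [measurable] = Cc_borel[OF assms(2)] radon_density_borel[OF assms(1)]
  show ?thesis unfolding cm_integrable_def
    by (rule integrable_bounded_support[OF radon_locfin[OF assms(1)], where B=B and R=R])
      (use RB radon_density_norm[OF assms(1)] in \<open>auto simp: norm_mult\<close>)
qed

text \<open>A bounded integrand vanishing off a product of two balls is dominated by a multiple of
  the indicator of that product, which has finite measure. No decay estimate is then needed for the
  convolution and transform identities.\<close>

lemma fubini_bounded_support:
  fixes F :: "'a::euclidean_space \<Rightarrow> 'b::euclidean_space \<Rightarrow> complex"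
  assumes M: "locfin M" and N: "locfin N"
    and F: "(\<lambda>(x, y). F x y) \<in> borel_measurable (borel \<Otimes>\<^sub>M borel)"
    and B: "\<And>x y. norm (F x y) \<le> B"
    and R: "\<And>x y. R < norm x \<Longrightarrow> F x y = 0" "\<And>x y. S < norm y \<Longrightarrow> F x y = 0"
  shows "(LINT x|M. LINT y|N. F x y) = (LINT y|N. LINT x|M. F x y)"
    and "integrable M (\<lambda>x. LINT y|N. F x y)"
proof -
  interpret M: sigma_finite_measure M by (rule locfin_sigma_finite[OF M])
  interpret N: sigma_finite_measure N by (rule locfin_sigma_finite[OF N])
  interpret pair_sigma_finite M N ..
  have s: "sets (M \<Otimes>\<^sub>M N) = sets (borel \<Otimes>\<^sub>M borel)"
    using M N by (intro sets_pair_measure_cong) (auto simp: locfin_def)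
  have "0 \<le> B" using norm_ge_zero[of "F 0 0"] B[of 0 0] by linarith
  have i: "integrable (M \<Otimes>\<^sub>M N) (case_prod F)"
  proof (rule Bochner_Integration.integrable_bound)
    have "emeasure (M \<Otimes>\<^sub>M N) (cball 0 R \<times> cball 0 S) = emeasure M (cball 0 R) * emeasure N (cball 0 S)"
      using M N by (intro N.emeasure_pair_measure_Times) (auto simp: locfin_def)
    also have "\<dots> < \<infinity>"
      using M N by (auto simp: locfin_def ennreal_mult_less_top)
    finally show "integrable (M \<Otimes>\<^sub>M N) (\<lambda>z. B * indicator (cball 0 R \<times> cball 0 S) z)"
      using M N by (intro integrable_mult_right integrable_real_indicator pair_measureI)
        (auto simp: locfin_def)
    show "case_prod F \<in> borel_measurable (M \<Otimes>\<^sub>M N)"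
      using F measurable_cong_sets[OF s refl] by auto
    show "AE z in M \<Otimes>\<^sub>M N. norm (case_prod F z) \<le> norm (B * indicator (cball 0 R \<times> cball 0 S) z)"
      using B R \<open>0 \<le> B\<close> by (intro AE_I2) (auto simp: indicator_def not_le split: prod.splits)
  qed
  show "(LINT x|M. LINT y|N. F x y) = (LINT y|N. LINT x|M. F x y)"
    using Fubini_integral[OF i] by simp
  show "integrable M (\<lambda>x. LINT y|N. F x y)"
    by (rule integrable_fst[OF i])
qed

section \<open>Affine changes of variables and continuity in a parameter\<close>

lemma lborel_integral_affine:
  fixes F :: "'a::euclidean_space \<Rightarrow> 'b::{banach, second_countable_topology}"
  assumes F[measurable]: "F \<in> borel_measurable borel" and c: "c \<noteq> 0"
  shows "(LINT x|lborel. F (t + c *\<^sub>R x)) = (1 / \<bar>c\<bar> ^ DIM('a)) *\<^sub>R (LINT x|lborel. F x)"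
proof -
  have *: "lborel = density (distr lborel borel (\<lambda>x. t + c *\<^sub>R x)) (\<lambda>_. ennreal (\<bar>c\<bar> ^ DIM('a)))"
    using lborel_affine[OF c, of t] by simp
  have "(LINT x|lborel. F x) = \<bar>c\<bar> ^ DIM('a) *\<^sub>R (LINT x|lborel. F (t + c *\<^sub>R x))"
    by (subst *, subst integral_density, simp, simp, simp, subst integral_distr) auto
  then show "(LINT x|lborel. F (t + c *\<^sub>R x)) = (1 / \<bar>c\<bar> ^ DIM('a)) *\<^sub>R (LINT x|lborel. F x)"
    using c by simp
qed

lemma lborel_integral_reflect:
  fixes F :: "'a::euclidean_space \<Rightarrow> 'b::{banach, second_countable_topology}"
  assumes "F \<in> borel_measurable borel"
  shows "(LINT y|lborel. F (x - y)) = (LINT y|lborel. F y)"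
  using lborel_integral_affine[OF assms, of "-1" x] by simp

lemma lborel_integral_shift:
  fixes F :: "'a::euclidean_space \<Rightarrow> 'b::{banach, second_countable_topology}"
  assumes "F \<in> borel_measurable borel"
  shows "(LINT y|lborel. F (y - x)) = (LINT y|lborel. F y)"
  using lborel_integral_affine[OF assms, of 1 "-x"] by simp

lemma continuous_on_integral_dominated:
  fixes F :: "'a::metric_space \<Rightarrow> 'b \<Rightarrow> 'c::{banach, second_countable_topology}"
  assumes "\<And>x. F x \<in> borel_measurable M" and c: "\<And>y. continuous_on UNIV (\<lambda>x. F x y)"
    and "\<And>x y. norm (F x y) \<le> w y" and "integrable M w"
  shows "continuous_on UNIV (\<lambda>x. LINT y|M. F x y)"
  unfolding continuous_on_sequentially
proof (intro allI ballI impI)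
  fix u :: "nat \<Rightarrow> 'a" and a assume u: "(\<forall>n. u n \<in> UNIV) \<and> u \<longlonglongrightarrow> a"
  have "(\<lambda>n. F (u n) y) \<longlonglongrightarrow> F a y" for y
    using c[of y] u unfolding continuous_on_sequentially by (auto simp: comp_def)
  then show "((\<lambda>x. LINT y|M. F x y) \<circ> u) \<longlonglongrightarrow> (LINT y|M. F a y)"
    unfolding comp_def using assms
    by (intro integral_dominated_convergence[where w=w]) auto
qed

subsection \<open>Convolution and Fourier transform on compactly supported functions\<close>

lemma conv_integrable:
  fixes p q :: "'a::euclidean_space \<Rightarrow> complex"
  assumes "Cc p" "continuous_on UNIV q" shows "integrable lborel (\<lambda>y. p y * q (x - y))"
proof -
  have "continuous_on UNIV (\<lambda>y. q (x - y))"
    by (intro continuous_on_compose2[OF assms(2)] continuous_intros) auto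
  then show ?thesis
    by (intro integrable_Cc[OF locfin_lborel] Cc_mult_right[OF assms(1)])
qed

lemma conv_commute:
  fixes p q :: "'a::euclidean_space \<Rightarrow> complex"
  assumes "Cc p" "Cc q" shows "conv p q = conv q p"
proof
  fix x :: 'a
  note [measurable] = Cc_borel[OF assms(1)] Cc_borel[OF assms(2)]
  have "conv p q x = (LINT y|lborel. (\<lambda>y. p y * q (x - y)) (x - y))"
    unfolding conv_def by (rule lborel_integral_reflect[symmetric]) measurable
  then show "conv p q x = conv q p x" by (simp add: conv_def mult.commute)
qed

lemma Cc_conv:
  fixes p q :: "'a::euclidean_space \<Rightarrow> complex"
  assumes p: "Cc p" and q: "Cc q" shows "Cc (conv p q)"
proof -
  obtain R B where R: "\<And>x. R < norm x \<Longrightarrow> p x = 0" using p by (metis CcE)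
  obtain S C where S: "\<And>x. S < norm x \<Longrightarrow> q x = 0" and C: "\<And>x. norm (q x) \<le> C" using q by (metis CcE)
  note [measurable] = Cc_borel[OF p] Cc_borel[OF q]
  show ?thesis
  proof (rule CcI)
    show "continuous_on UNIV (conv p q)" unfolding conv_def[abs_def]
    proof (rule continuous_on_integral_dominated[where w="\<lambda>y. norm (p y) * C"])
      show "continuous_on UNIV (\<lambda>x. p y * q (x - y))" for y
        by (intro continuous_intros continuous_on_compose2[OF Cc_continuous[OF q]]) auto
      show "norm (p y * q (x - y)) \<le> norm (p y) * C" for x y
        using C by (auto simp: norm_mult intro!: mult_left_mono)
      show "integrable lborel (\<lambda>y. norm (p y) * C)"
        using integrable_Cc[OF locfin_lborel p] by auto
    qed measurable
    fix x :: 'a assume x: "R + S < norm x"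
    have "p y * q (x - y) = 0" for y
      using R[of y] S[of "x - y"] x norm_triangle_ineq[of y "x - y"] by fastforce
    then show "conv p q x = 0" by (simp only: conv_def Bochner_Integration.integral_zero)
  qed
qed

lemma conv_assoc:
  fixes p q r :: "'a::euclidean_space \<Rightarrow> complex"
  assumes p: "Cc p" and q: "Cc q" and r: "Cc r"
  shows "conv (conv p q) r = conv p (conv q r)"
proof
  fix x
  obtain R B where R: "\<And>x. R < norm x \<Longrightarrow> p x = 0" and B: "\<And>x. norm (p x) \<le> B" "0 < B" using p by (metis CcE)
  obtain S C where S: "\<And>x. S < norm x \<Longrightarrow> q x = 0" and C: "\<And>x. norm (q x) \<le> C" "0 < C" using q by (metis CcE)
  obtain T D where D: "\<And>x. norm (r x) \<le> D" using r by (metis CcE)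
  note [measurable] = Cc_borel[OF p] Cc_borel[OF q] Cc_borel[OF r]
  have "conv (conv p q) r x = (LINT u|lborel. LINT y|lborel. p y * q (u - y) * r (x - u))"
    unfolding conv_def by simp
  also have "\<dots> = (LINT y|lborel. LINT u|lborel. p y * q (u - y) * r (x - u))"
  proof (rule fubini_bounded_support[OF locfin_lborel locfin_lborel])
    show "norm (p y * q (u - y) * r (x - u)) \<le> B * C * D" for u y
      using B C D by (auto simp: norm_mult intro!: mult_mono)
    show "R + S < norm u \<Longrightarrow> p y * q (u - y) * r (x - u) = 0" for u y
      using R[of y] S[of "u - y"] norm_triangle_ineq[of y "u - y"] by fastforce
  qed (use R in auto)
  also have "\<dots> = (LINT y|lborel. p y * (LINT u|lborel. q (u - y) * r ((x - y) - (u - y))))"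
    by (simp add: mult.assoc)
  also have "\<dots> = (LINT y|lborel. p y * conv q r (x - y))"
  proof (intro Bochner_Integration.integral_cong refl)
    fix y
    have "(\<lambda>z. q z * r (x - y - z)) \<in> borel_measurable borel" by measurable
    from lborel_integral_shift[OF this, of y]
    show "p y * (LINT u|lborel. q (u - y) * r ((x - y) - (u - y))) = p y * conv q r (x - y)"
      by (simp add: conv_def)
  qed
  finally show "conv (conv p q) r x = conv p (conv q r) x" by (simp add: conv_def)
qed

lemma conv_add_left:
  assumes "Cc p" "Cc p'" "Cc q"
  shows "conv (\<lambda>x. p x + p' x) q x = conv p q x + conv p' q x"
  unfolding conv_def ring_distribs
  by (intro Bochner_Integration.integral_add conv_integrable Cc_continuous assms)

lemma conv_add_right:
  assumes "Cc p" "Cc q" "Cc q'"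
  shows "conv p (\<lambda>x. q x + q' x) x = conv p q x + conv p q' x"
  unfolding conv_def ring_distribs
  by (intro Bochner_Integration.integral_add conv_integrable Cc_continuous assms)

lemma conv_scale_left: "conv (\<lambda>x. c * p x) q x = c * conv p q x"
  by (simp add: conv_def mult.assoc)

lemma conv_scale_right: "conv p (\<lambda>x. c * q x) x = c * conv p q x"
  by (simp add: conv_def mult.left_commute)

lemma tilde_add_scale: "tilde (\<lambda>x. p x + c * q x) = (\<lambda>x. tilde p x + cnj c * tilde q x)"
  by (simp add: tilde_def fun_eq_iff)

lemma conv_sesquilinear:
  assumes "Cc p" "Cc q"
  shows "conv (\<lambda>x. p x + c * q x) (tilde (\<lambda>x. p x + c * q x)) x =
     conv p (tilde p) x + cnj c * conv p (tilde q) x + c * conv q (tilde p) x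
     + (norm c)\<^sup>2 * conv q (tilde q) x"
proof -
  note * = assms Cc_tilde[OF assms(1)] Cc_tilde[OF assms(2)]
  have "of_real ((norm c)\<^sup>2) = c * cnj c" by (rule complex_norm_square)
  then show ?thesis
    by (simp add: tilde_add_scale conv_add_left conv_add_right conv_scale_left conv_scale_right *
        Cc_add Cc_scale algebra_simps)
qed

text \<open>The sign is that of the characters in the hypothesis, opposite to that in
  \<open>icheck\<close>; hence the argument \<open>- y\<close> when \<open>icheck\<close> is
  expressed by \<open>echar\<close>.\<close>

definition echar :: "'a::euclidean_space \<Rightarrow> 'a \<Rightarrow> complex" where
  "echar t x = exp (- 2 * of_real pi * \<i> * of_real (t \<bullet> x))"

lemma echar_cis: "echar t x = cis (- 2 * pi * (t \<bullet> x))"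
  by (simp add: echar_def cis_conv_exp mult_ac)

lemma norm_echar [simp]: "norm (echar t x) = 1"
  by (simp add: echar_cis)

lemma echar_0 [simp]: "echar 0 x = 1" "echar t 0 = 1"
  by (simp_all add: echar_def)

lemma cnj_echar: "cnj (echar t x) = echar (- t) x" "echar t (- x) = echar (- t) x"
  by (simp_all add: echar_cis cis_cnj)

lemma echar_add: "echar t (x + y) = echar t x * echar t y" "echar (s + t) x = echar s x * echar t x"
  by (simp_all add: echar_cis cis_mult inner_add_left inner_add_right algebra_simps)

lemma continuous_on_echar [continuous_intros]:
  "continuous_on A f \<Longrightarrow> continuous_on A g \<Longrightarrow> continuous_on A (\<lambda>x. echar (f x) (g x))"
  unfolding echar_def by (intro continuous_intros)

lemma measurable_echar [measurable (raw)]: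
  "f \<in> borel_measurable M \<Longrightarrow> g \<in> borel_measurable M \<Longrightarrow> (\<lambda>x. echar (f x) (g x)) \<in> borel_measurable M"
  unfolding echar_def by measurable

lemma icheck_echar: "icheck f y = (LINT x|lborel. f x * echar (- y) x)"
  by (simp add: icheck_def echar_def inner_commute)

text \<open>Multiplicativity takes \<open>echar t x\<close> out of the convolution integral, and
  \<open>tilde\<close> commutes with modulation because conjugation and reflection of a character
  cancel. With \<open>icheck_modulate\<close>, modulating \<mu> becomes translating \<nu>.\<close>

lemma conv_echar:
  "conv (\<lambda>x. echar t x * p x) (tilde (\<lambda>x. echar t x * q x)) = (\<lambda>x. echar t x * conv p (tilde q) x)"
proof
  fix x
  have "echar t y * echar t (x - y) = echar t x" for y
    using echar_add(1)[of t y "x - y"] by simp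
  then have eq: "echar t y * p y * (echar t (x - y) * tilde q (x - y)) = echar t x * (p y * tilde q (x - y))" for y
    by (metis mult.assoc mult.left_commute)
  have "conv (\<lambda>x. echar t x * p x) (\<lambda>x. echar t x * tilde q x) x = (LINT y|lborel. echar t x * (p y * tilde q (x - y)))"
    unfolding conv_def eq ..
  moreover have "tilde (\<lambda>x. echar t x * q x) = (\<lambda>x. echar t x * tilde q x)"
    by (simp add: tilde_def cnj_echar fun_eq_iff)
  ultimately show "conv (\<lambda>x. echar t x * p x) (tilde (\<lambda>x. echar t x * q x)) x = echar t x * conv p (tilde q) x"
    by (simp only: conv_def integral_mult_right_zero)
qed

lemma icheck_modulate: "icheck (\<lambda>x. echar t x * f x) y = icheck f (y - t)"
proof -
  have "echar t x * f x * echar (- y) x = f x * echar (- (y - t)) x" for x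
    using echar_add(2)[of t "-y" x] by simp
  then show ?thesis by (simp only: icheck_echar)
qed

lemma icheck_integrable:
  "Cc p \<Longrightarrow> integrable lborel (\<lambda>x. p x * echar y x)"
  by (intro integrable_Cc[OF locfin_lborel] Cc_mult_right continuous_intros)

lemma icheck_add_scale:
  assumes "Cc p" "Cc q"
  shows "icheck (\<lambda>x. p x + c * q x) y = icheck p y + c * icheck q y"
  using icheck_integrable[OF assms(1), of "-y"] icheck_integrable[OF assms(2), of "-y"]
  by (simp add: icheck_echar ring_distribs mult.assoc)

lemma icheck_conv:
  fixes p q :: "'a::euclidean_space \<Rightarrow> complex"
  assumes p: "Cc p" and q: "Cc q"
  shows "icheck (conv p q) z = icheck p z * icheck q z"
proof -
  obtain R B where R: "\<And>x. R < norm x \<Longrightarrow> p x = 0" and B: "\<And>x. norm (p x) \<le> B" "0 < B" using p by (metis CcE)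
  obtain S C where S: "\<And>x. S < norm x \<Longrightarrow> q x = 0" and C: "\<And>x. norm (q x) \<le> C" "0 < C" using q by (metis CcE)
  note [measurable] = Cc_borel[OF p] Cc_borel[OF q]
  have "icheck (conv p q) z = (LINT x|lborel. LINT y|lborel. p y * q (x - y) * echar (- z) x)"
    by (simp add: icheck_echar conv_def)
  also have "\<dots> = (LINT y|lborel. LINT x|lborel. p y * q (x - y) * echar (- z) x)"
  proof (rule fubini_bounded_support[OF locfin_lborel locfin_lborel])
    show "norm (p y * q (u - y) * echar (- z) u) \<le> B * C" for u y
      using B C by (auto simp: norm_mult intro!: mult_mono)
    show "R + S < norm u \<Longrightarrow> p y * q (u - y) * echar (- z) u = 0" for u y
      using R[of y] S[of "u - y"] norm_triangle_ineq[of y "u - y"] by fastforce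
  qed (use R in auto)
  also have "\<dots> = (LINT y|lborel. p y * echar (- z) y * (LINT x|lborel. q (x - y) * echar (- z) (x - y)))"
  proof (intro Bochner_Integration.integral_cong refl)
    fix y
    have "p y * q (x - y) * echar (- z) x = (p y * echar (- z) y) * (q (x - y) * echar (- z) (x - y))" for x
      using echar_add(1)[of "-z" y "x - y"] by simp
    then show "(LINT x|lborel. p y * q (x - y) * echar (- z) x) =
      p y * echar (- z) y * (LINT x|lborel. q (x - y) * echar (- z) (x - y))"
      by (simp only: integral_mult_right_zero)
  qed
  also have "\<dots> = (LINT y|lborel. p y * echar (- z) y * icheck q z)"
    by (subst lborel_integral_shift[of "\<lambda>x. q x * echar (- z) x"]) (auto simp: icheck_echar)
  finally show ?thesis by (simp add: icheck_echar)
qed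

subsection \<open>Test functions\<close>

abbreviation test :: "('a::euclidean_space \<Rightarrow> complex) \<Rightarrow> bool" where
  "test f \<equiv> Cc f \<and> schwartz f"

lemma Cc_bounded:
  assumes "Cc f" obtains B where "\<And>x. norm (f x) \<le> B"
  using assms by (metis CcE)

lemma bounded_weighted_Cc:
  fixes f :: "'a::euclidean_space \<Rightarrow> complex"
  assumes "Cc f" shows "bounded (range (\<lambda>x. ((1 + norm x) ^ k) *\<^sub>R f x))"
proof -
  have "Cc (\<lambda>x. f x * of_real ((1 + norm x) ^ k))"
    by (intro Cc_mult_right[OF assms] continuous_intros)
  then obtain B where B: "\<And>x. norm (f x * of_real ((1 + norm x) ^ k)) \<le> B" using Cc_bounded by blast
  show ?thesis unfolding bounded_iff
  proof (intro exI[of _ B] ballI)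
    fix y assume "y \<in> range (\<lambda>x. ((1 + norm x) ^ k) *\<^sub>R f x)"
    then obtain x where "y = ((1 + norm x) ^ k) *\<^sub>R f x" by blast
    with B[of x] show "norm y \<le> B"
      by (simp add: norm_mult mult.commute del: of_real_add of_real_power)
  qed
qed

text \<open>A coinduction principle: a class of \<open>Cc\<close> functions closed under coordinate
  derivatives contains all iterated derivatives of its members, and the weights in
  \<open>schwartz\<close> are bounded on compact supports. Each later use takes for \<open>Y\<close>
  all functions of one shape, so no higher derivative is ever computed.\<close>

lemma testI:
  fixes f :: "'a::euclidean_space \<Rightarrow> complex"
  assumes f: "f \<in> Y" and Cc: "\<And>f. f \<in> Y \<Longrightarrow> Cc f"
    and D: "\<And>f j. f \<in> Y \<Longrightarrow> j \<in> Basis \<Longrightarrow>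
      \<exists>g\<in>Y. \<forall>x. ((\<lambda>s::real. f (x + s *\<^sub>R j)) has_vector_derivative g x) (at 0)"
  shows "test f"
proof -
  have pd: "pd j f \<in> Y" if "f \<in> Y" "j \<in> Basis" for f j
  proof -
    from D[OF that] obtain g where g: "g \<in> Y" "\<forall>x. ((\<lambda>s::real. f (x + s *\<^sub>R j)) has_vector_derivative g x) (at 0)"
      by (elim bexE)
    have "pd j f = g"
      unfolding pd_def by (rule ext, rule vector_derivative_at, rule spec[OF g(2)])
    with g(1) show ?thesis by simp
  qed
  have Dp: "Dp is f \<in> Y" if "set is \<subseteq> Basis" for "is"
    using that by (induction "is") (auto simp: f pd)
  show ?thesis unfolding schwartz_def
  proof (intro conjI allI impI ballI)
    show "Cc f" by (rule Cc[OF f])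
    fix "is" :: "'a list" assume "is": "set is \<subseteq> Basis"
    show "continuous_on UNIV (Dp is f)" by (rule Cc_continuous[OF Cc[OF Dp[OF "is"]]])
    show "bounded (range (\<lambda>x. ((1 + norm x) ^ k) *\<^sub>R Dp is f x))" for k
      by (rule bounded_weighted_Cc[OF Cc[OF Dp[OF "is"]]])
    fix i x assume "i \<in> (Basis :: 'a set)"
    from D[OF Dp[OF "is"] this] obtain g where
      "\<forall>x. ((\<lambda>s::real. Dp is f (x + s *\<^sub>R i)) has_vector_derivative g x) (at 0)" by (elim bexE)
    then show "(\<lambda>s::real. Dp is f (x + s *\<^sub>R i)) differentiable (at 0)"
      using differentiableI_vector by blast
  qed
qed

lemma Dp_append: "Dp (is @ js) f = Dp is (Dp js f)"
  by (induction "is") auto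

lemma
  fixes f :: "'a::euclidean_space \<Rightarrow> complex"
  assumes f: "schwartz f" and "is": "set is \<subseteq> Basis"
  shows schwartz_continuous: "continuous_on UNIV (Dp is f)"
    and schwartz_differentiable: "i \<in> Basis \<Longrightarrow> (\<lambda>s::real. Dp is f (x + s *\<^sub>R i)) differentiable (at 0)"
    and schwartz_bounded: "bounded (range (\<lambda>x. ((1 + norm x) ^ k) *\<^sub>R Dp is f x))"
proof -
  note * = f[unfolded schwartz_def, THEN spec, THEN mp, OF "is"]
  show "continuous_on UNIV (Dp is f)" by (rule conjunct1[OF *])
  show "(\<lambda>s::real. Dp is f (x + s *\<^sub>R i)) differentiable (at 0)" if "i \<in> Basis"
    by (rule conjunct1[OF conjunct2[OF *], THEN bspec, THEN spec, OF that])
  show "bounded (range (\<lambda>x. ((1 + norm x) ^ k) *\<^sub>R Dp is f x))"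
    by (rule conjunct2[OF conjunct2[OF *], THEN spec])
qed

lemma
  fixes f :: "'a::euclidean_space \<Rightarrow> complex"
  assumes f: "test f" and j: "j \<in> Basis"
  shows test_pd: "test (pd j f)"
    and has_vector_derivative_pd: "((\<lambda>s::real. f (x + s *\<^sub>R j)) has_vector_derivative pd j f (x + s *\<^sub>R j)) (at s)"
proof -
  have D: "((\<lambda>s::real. f (x + s *\<^sub>R j)) has_vector_derivative pd j f x) (at 0)" for x
    using schwartz_differentiable[of f "[]" j x] f j by (simp add: pd_def vector_derivative_works)
  \<comment> \<open>\<open>schwartz\<close> provides derivatives only at parameter 0, but for every
    base point; moving the base point to \<open>x + s *\<^sub>R j\<close> gives the derivative at
    any s.\<close>
  have "((\<lambda>h. h - s) has_vector_derivative 1) (at s)"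
    by (auto intro!: derivative_eq_intros)
  then have "((\<lambda>h. f ((x + s *\<^sub>R j) + h *\<^sub>R j)) \<circ> (\<lambda>h. h - s) has_vector_derivative 1 *\<^sub>R pd j f (x + s *\<^sub>R j)) (at s)"
    using D[of "x + s *\<^sub>R j"] by (intro vector_diff_chain_at) simp_all
  moreover have "(\<lambda>h. f ((x + s *\<^sub>R j) + h *\<^sub>R j)) \<circ> (\<lambda>h. h - s) = (\<lambda>s. f (x + s *\<^sub>R j))"
    by (simp add: fun_eq_iff algebra_simps)
  ultimately show "((\<lambda>s::real. f (x + s *\<^sub>R j)) has_vector_derivative pd j f (x + s *\<^sub>R j)) (at s)"
    by simp
  have Dp: "Dp is (pd j f) = Dp (is @ [j]) f" for "is"
    by (simp add: Dp_append)
  have s: "schwartz (pd j f)"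
    unfolding schwartz_def Dp
  proof (intro allI impI conjI ballI)
    fix "is" :: "'a list" assume "set is \<subseteq> Basis"
    then have *: "set (is @ [j]) \<subseteq> Basis" using j by simp
    show "continuous_on UNIV (Dp (is @ [j]) f)" by (rule schwartz_continuous[OF conjunct2[OF f] *])
    show "(\<lambda>s. Dp (is @ [j]) f (x + s *\<^sub>R i)) differentiable at 0" if "i \<in> Basis" for i x
      by (rule schwartz_differentiable[OF conjunct2[OF f] * that])
    show "bounded (range (\<lambda>x. (1 + norm x) ^ k *\<^sub>R Dp (is @ [j]) f x))" for k
      by (rule schwartz_bounded[OF conjunct2[OF f] *])
  qed
  obtain R where R: "\<And>x. R < norm x \<Longrightarrow> f x = 0" using f by (metis CcE)
  have "Cc (pd j f)"
  proof (rule CcI)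
    have "continuous_on UNIV (Dp [j] f)"
      using f j by (intro schwartz_continuous) auto
    then show "continuous_on UNIV (pd j f)" by simp
    fix x :: 'a assume x: "R < norm x"
    have "((\<lambda>s::real. f (x + s *\<^sub>R j)) has_vector_derivative 0) (at 0)"
    proof (rule has_vector_derivative_transform_within_open[where f="\<lambda>_. 0"])
      show "open ((\<lambda>s::real. x + s *\<^sub>R j) -` {x. R < norm x})"
        by (intro open_vimage open_Collect_less continuous_intros)
    qed (use x R in auto)
    then show "pd j f x = 0" using D[of x] vector_derivative_unique_at by metis
  qed
  with s show "test (pd j f)" by simp
qed

lemma test_Dp: "test f \<Longrightarrow> set is \<subseteq> Basis \<Longrightarrow> test (Dp is f)"
  by (induction "is") (auto simp: test_pd)

lemma test_lincomb:
  fixes f g :: "'a::euclidean_space \<Rightarrow> complex"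
  assumes "test f" "test g" shows "test (\<lambda>x. a * f x + b * g x)"
proof (rule testI[where Y="{\<lambda>x. a * f x + b * g x | f g. test f \<and> test g}"])
  show "(\<lambda>x. a * f x + b * g x) \<in> {\<lambda>x. a * f x + b * g x | f g. test f \<and> test g}"
    using assms by blast
  show "Cc f" if "f \<in> {\<lambda>x. a * f x + b * g x | f g. test f \<and> test g}" for f
    using that by (auto intro!: Cc_add Cc_scale)
  fix h :: "'a \<Rightarrow> complex" and j assume h: "h \<in> {\<lambda>x. a * f x + b * g x | f g. test f \<and> test g}" and j: "j \<in> (Basis :: 'a set)"
  then obtain f g where fg: "h = (\<lambda>x. a * f x + b * g x)" "test f" "test g" by auto
  have "((\<lambda>s::real. h (x + s *\<^sub>R j)) has_vector_derivative (a * pd j f x + b * pd j g x)) (at 0)" for x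
    using has_vector_derivative_pd[OF fg(2) j, of x 0] has_vector_derivative_pd[OF fg(3) j, of x 0]
    unfolding fg(1) by (intro derivative_eq_intros) auto
  then show "\<exists>g\<in>{\<lambda>x. a * f x + b * g x | f g. test f \<and> test g}.
      \<forall>x. ((\<lambda>s::real. h (x + s *\<^sub>R j)) has_vector_derivative g x) (at 0)"
    using test_pd[OF fg(2) j] test_pd[OF fg(3) j] by (intro bexI[of _ "\<lambda>x. a * pd j f x + b * pd j g x"]) blast+
qed

lemma test_diff: "test f \<Longrightarrow> test g \<Longrightarrow> test (\<lambda>x. f x - g x)"
  using test_lincomb[of f g 1 "-1"] by simp

lemma test_echar:
  fixes f :: "'a::euclidean_space \<Rightarrow> complex"
  assumes "test f" shows "test (\<lambda>x. echar t x * f x)"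
proof (rule testI[where Y="{\<lambda>x. echar t x * f x | f. test f}"])
  show "(\<lambda>x. echar t x * f x) \<in> {\<lambda>x. echar t x * f x | f. test f}"
    using assms by blast
  show "Cc f" if "f \<in> {\<lambda>x. echar t x * f x | f. test f}" for f
    using that by (auto intro!: Cc_mult_left continuous_intros)
  fix h :: "'a \<Rightarrow> complex" and j assume h: "h \<in> {\<lambda>x. echar t x * f x | f. test f}" and j: "j \<in> (Basis :: 'a set)"
  then obtain f where f: "h = (\<lambda>x. echar t x * f x)" "test f" by auto
  let ?c = "- 2 * of_real pi * \<i> * of_real (t \<bullet> j)"
  \<comment> \<open>The product rule gives \<open>echar t\<close> times a test function, so the
    derivative stays in the class. The factor 1 gives \<open>?g\<close> the shape of
    \<open>test_lincomb\<close>.\<close>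
  let ?g = "\<lambda>x. ?c * f x + 1 * pd j f x"
  have "((\<lambda>s::real. h (x + s *\<^sub>R j)) has_vector_derivative (echar t x * ?g x)) (at 0)" for x
  proof -
    have e: "((\<lambda>s. exp (of_real s * ?c)) has_vector_derivative ?c) (at 0)"
      using exp_scaleR_has_vector_derivative_right[of ?c 0 UNIV] by (simp add: scaleR_conv_of_real)
    have "echar t (x + s *\<^sub>R j) = echar t x * exp (of_real s * ?c)" for s
      unfolding echar_add(1) by (simp add: echar_def mult_ac)
    then have *: "h (x + s *\<^sub>R j) = echar t x * (exp (of_real s * ?c) * f (x + s *\<^sub>R j))" for s
      by (simp add: f(1) mult_ac)
    show ?thesis unfolding *
      by (intro has_vector_derivative_mult_right
            has_vector_derivative_mult[OF e has_vector_derivative_pd[OF f(2) j, of x 0], THEN has_vector_derivative_eq_rhs]) simp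
  qed
  moreover have "test ?g" by (intro test_lincomb test_pd f j)
  ultimately show "\<exists>g\<in>{\<lambda>x. echar t x * f x | f. test f}.
      \<forall>x. ((\<lambda>s::real. h (x + s *\<^sub>R j)) has_vector_derivative g x) (at 0)"
    by (intro bexI[of _ "\<lambda>x. echar t x * ?g x"] allI CollectI exI[of _ ?g] conjI refl) auto
qed

text \<open>The mean value inequality, used once for the derivative and once for f. Uniformity of C
  in x is the point, since it allows differentiation under a convolution integral. The constant 3 B
  is crude: 2 B from the linearization error and B from its linear term.\<close>

lemma test_taylor:
  fixes f :: "'a::euclidean_space \<Rightarrow> complex"
  assumes f: "test f" and j: "j \<in> Basis"
  obtains C where "\<And>x s. norm (f (x + s *\<^sub>R j) - f x - s *\<^sub>R pd j f x) \<le> C * s\<^sup>2"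
proof -
  obtain B where B: "\<And>x. norm (pd j (pd j f) x) \<le> B"
    using test_pd[OF test_pd[OF f j] j] CcE by metis
  have L: "norm (pd j f (x + s *\<^sub>R j) - pd j f x) \<le> \<bar>s\<bar> * (3 * B)" for x s
  proof -
    have "norm (pd j f (x + s *\<^sub>R j) - pd j f (x + 0 *\<^sub>R j) - (s - 0) *\<^sub>R pd j (pd j f) (x + 0 *\<^sub>R j)) \<le> norm (s - 0) * (B + B)"
    proof (rule vector_differentiable_bound_linearization[where S=UNIV and f="\<lambda>s. pd j f (x + s *\<^sub>R j)"
          and f'="\<lambda>s. pd j (pd j f) (x + s *\<^sub>R j)"])
      show "norm (pd j (pd j f) (x + u *\<^sub>R j) - pd j (pd j f) (x + 0 *\<^sub>R j)) \<le> B + B" for u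
        by (rule norm_triangle_le_diff[OF add_mono[OF B B]])
    qed (auto intro: has_vector_derivative_pd[OF test_pd[OF f j] j])
    moreover have "norm (s *\<^sub>R pd j (pd j f) x) \<le> \<bar>s\<bar> * B" using B[of x] by (simp add: mult_left_mono)
    ultimately show ?thesis
      using norm_triangle_sub[of "pd j f (x + s *\<^sub>R j) - pd j f x" "s *\<^sub>R pd j (pd j f) x"] by simp
  qed
  have "norm (f (x + s *\<^sub>R j) - f x - s *\<^sub>R pd j f x) \<le> (3 * B) * s\<^sup>2" for x s
  proof -
    have "0 \<le> B" using B[of 0] norm_ge_zero order_trans by blast
    have "norm (f (x + s *\<^sub>R j) - f (x + 0 *\<^sub>R j) - (s - 0) *\<^sub>R pd j f (x + 0 *\<^sub>R j)) \<le> norm (s - 0) * (\<bar>s\<bar> * (3 * B))"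
    proof (rule vector_differentiable_bound_linearization[where S="closed_segment 0 s" and f="\<lambda>s. f (x + s *\<^sub>R j)"
          and f'="\<lambda>s. pd j f (x + s *\<^sub>R j)"])
      fix u assume "u \<in> closed_segment 0 s"
      then have "\<bar>u\<bar> \<le> \<bar>s\<bar>" by (auto simp: closed_segment_eq_real_ivl split: if_splits)
      then have "\<bar>u\<bar> * (3 * B) \<le> \<bar>s\<bar> * (3 * B)" using \<open>0 \<le> B\<close> by (intro mult_right_mono) auto
      then show "norm (pd j f (x + u *\<^sub>R j) - pd j f (x + 0 *\<^sub>R j)) \<le> \<bar>s\<bar> * (3 * B)"
        using L[of x u] by simp
      show "((\<lambda>s. f (x + s *\<^sub>R j)) has_vector_derivative pd j f (x + u *\<^sub>R j)) (at u within closed_segment 0 s)"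
        by (rule has_vector_derivative_at_within[OF has_vector_derivative_pd[OF f j]])
    qed auto
    moreover have "\<bar>s\<bar> * (\<bar>s\<bar> * (3 * B)) = (3 * B) * s\<^sup>2"
      by (simp add: power2_eq_square)
    ultimately show ?thesis by simp
  qed
  then show ?thesis by (rule that)
qed

text \<open>All derivatives fall on f, so p need only be continuous. By \<open>test_taylor\<close>
  the error of the difference quotient is at most C |s| times the L1 norm of p.\<close>

lemma test_conv:
  fixes f p :: "'a::euclidean_space \<Rightarrow> complex"
  assumes f: "test f" and p: "Cc p" shows "test (conv f p)"
proof (rule testI[where Y="{conv f p | f. test f}"])
  show "conv f p \<in> {conv f p | f. test f}" using f by blast
  show "Cc h" if "h \<in> {conv f p | f. test f}" for h using that p by (auto intro: Cc_conv)
  fix h :: "'a \<Rightarrow> complex" and j assume h: "h \<in> {conv f p | f. test f}" and j: "j \<in> (Basis :: 'a set)"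
  then obtain f where f: "h = conv f p" "test f" by auto
  obtain C where C: "\<And>x s. norm (f (x + s *\<^sub>R j) - f x - s *\<^sub>R pd j f x) \<le> C * s\<^sup>2"
    using test_taylor[OF f(2) j] by blast
  let ?P = "LINT y|lborel. norm (p y)"
  have i: "integrable lborel (\<lambda>y. norm (p y))" using integrable_Cc[OF locfin_lborel p] by auto
  have *: "norm (conv p f (x + s *\<^sub>R j) - conv p f x - s *\<^sub>R conv p (pd j f) x) \<le> ?P * (C * s\<^sup>2)" for x s
  proof -
    have pf: "integrable lborel (\<lambda>y. p y * f (x - y))" for x
      using f(2) by (intro conv_integrable p Cc_continuous) auto
    have pg: "integrable lborel (\<lambda>y. p y * pd j f (x - y))" for x
      using test_pd[OF f(2) j] by (intro conv_integrable p Cc_continuous) auto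
    have "conv p f (x + s *\<^sub>R j) - conv p f x - s *\<^sub>R conv p (pd j f) x =
      (LINT y|lborel. p y * f (x + s *\<^sub>R j - y) - p y * f (x - y) - s *\<^sub>R (p y * pd j f (x - y)))"
      unfolding conv_def using pf pg by simp
    also have "norm \<dots> \<le> (LINT y|lborel. norm (p y) * (C * s\<^sup>2))"
    proof (rule Bochner_Integration.integral_norm_bound_integral)
      fix y
      have "p y * f (x + s *\<^sub>R j - y) - p y * f (x - y) - s *\<^sub>R (p y * pd j f (x - y))
        = p y * (f ((x - y) + s *\<^sub>R j) - f (x - y) - s *\<^sub>R pd j f (x - y))"
        by (simp add: algebra_simps)
      then show "norm (p y * f (x + s *\<^sub>R j - y) - p y * f (x - y) - s *\<^sub>R (p y * pd j f (x - y))) \<le> norm (p y) * (C * s\<^sup>2)"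
        using C[of "x - y" s] by (simp add: norm_mult mult_left_mono)
    qed (use pf pg i in auto)
    finally show ?thesis by simp
  qed
  have "((\<lambda>s::real. h (x + s *\<^sub>R j)) has_vector_derivative conv (pd j f) p x) (at 0)" for x
    unfolding has_vector_derivative_def
  proof (rule has_derivativeI_sandwich[where e=1 and H="\<lambda>s. ?P * C * \<bar>s\<bar>"])
    fix s :: real assume "s \<noteq> 0"
    have c: "conv f p = conv p f" "conv (pd j f) p = conv p (pd j f)"
      using f(2) test_pd[OF f(2) j] p by (auto intro: conv_commute)
    have "norm (h (x + s *\<^sub>R j) - h (x + 0 *\<^sub>R j) - (s - 0) *\<^sub>R conv (pd j f) p x) \<le> ?P * C * \<bar>s\<bar> * \<bar>s\<bar>"
      using *[of x s] by (simp add: f(1) c power2_eq_square mult.assoc)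
    then show "norm (h (x + s *\<^sub>R j) - h (x + 0 *\<^sub>R j) - (s - 0) *\<^sub>R conv (pd j f) p x) / norm (s - 0) \<le> ?P * C * \<bar>s\<bar>"
      using \<open>s \<noteq> 0\<close> by (simp add: divide_le_eq)
  next
    show "((\<lambda>s. ?P * C * \<bar>s\<bar>) \<longlongrightarrow> 0) (at 0)" by (auto intro!: tendsto_eq_intros)
  qed (auto intro!: bounded_linear_scaleR_left)
  then show "\<exists>g\<in>{conv f p | f. test f}. \<forall>x. ((\<lambda>s::real. h (x + s *\<^sub>R j)) has_vector_derivative g x) (at 0)"
    using test_pd[OF f(2) j] by (intro bexI[of _ "conv (pd j f) p"]) blast+
qed

subsection \<open>Bump functions\<close>

text \<open>The classical flat function exp(-1/s), with a power of 1/s as parameter: the derivative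
  of one member is a combination of two others, so the span of the family is closed under
  differentiation.\<close>

definition flat :: "nat \<Rightarrow> real \<Rightarrow> real" where
  "flat k s = (if s \<le> 0 then 0 else exp (- inverse s) * inverse s ^ k)"

lemma flat_nonneg: "0 \<le> flat k s" and flat_pos: "0 < s \<Longrightarrow> 0 < flat k s"
  by (simp_all add: flat_def)

lemma flat_tendsto_0: "(flat k \<longlongrightarrow> 0) (at 0)"
proof (rule filterlim_split_at)
  have "\<forall>\<^sub>F s in at_left 0. flat k s = 0"
    by (auto simp: eventually_at_filter flat_def)
  then show "(flat k \<longlongrightarrow> 0) (at_left 0)" by (simp add: tendsto_eventually)
  have "((\<lambda>s. (inverse s) ^ k / exp (inverse s)) \<longlongrightarrow> 0) (at_right (0::real))"
    by (rule filterlim_compose[OF tendsto_power_div_exp_0 filterlim_inverse_at_top_right])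
  moreover have "\<forall>\<^sub>F s in at_right 0. (inverse s) ^ k / exp (inverse s) = flat k s"
    by (auto simp: eventually_at_filter flat_def exp_minus divide_inverse mult.commute)
  ultimately show "(flat k \<longlongrightarrow> 0) (at_right 0)"
    by (rule Lim_transform_eventually)
qed

lemma inverse_power_has_derivative:
  assumes "s \<noteq> 0"
  shows "((\<lambda>s::real. inverse s ^ k) has_real_derivative (- (k * inverse s ^ (k + 1)))) (at s)"
  using DERIV_power[OF DERIV_inverse[OF assms], of k] by (cases k) (auto simp: mult_ac)

lemma flat_has_derivative:
  "(flat k has_real_derivative (flat (k + 2) s - k * flat (k + 1) s)) (at s)"
proof -
  consider "s < 0" | "s = 0" | "0 < s" by linarith
  then show ?thesis
  proof cases
    case 1
    have "((\<lambda>_. 0) has_real_derivative 0) (at s)" by simp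
    then have "(flat k has_real_derivative 0) (at s)"
      by (rule has_field_derivative_transform_within_open[where S="{..<0}"]) (use 1 in \<open>auto simp: flat_def\<close>)
    then show ?thesis using 1 by (simp add: flat_def)
  next
    \<comment> \<open>At 0 the difference quotient of \<open>flat k\<close> is exactly
      \<open>flat (k + 1)\<close>, which tends to 0.\<close>
    case 2
    have "\<forall>\<^sub>F h in at 0. flat (k + 1) h = (flat k (0 + h) - flat k 0) / h"
      by (auto simp: eventually_at_filter flat_def divide_inverse)
    then have "((\<lambda>h. (flat k (0 + h) - flat k 0) / h) \<longlongrightarrow> 0) (at 0)"
      by (rule Lim_transform_eventually[OF flat_tendsto_0])
    then show ?thesis using 2 by (simp add: DERIV_def flat_def)
  next
    case 3
    have "((\<lambda>s. exp (- inverse s) * inverse s ^ k) has_real_derivative (flat (k + 2) s - k * flat (k + 1) s)) (at s)"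
    proof -
      have "((\<lambda>s. exp (- inverse s)) has_real_derivative exp (- inverse s) * (inverse s)\<^sup>2) (at s)"
        using 3 by (auto intro!: derivative_eq_intros simp: power2_eq_square)
      from DERIV_mult[OF this inverse_power_has_derivative[of s k]] 3 show ?thesis
        by (simp add: flat_def algebra_simps power2_eq_square)
    qed
    then show ?thesis
      by (rule has_field_derivative_transform_within_open[where S="{0<..}"]) (use 3 in \<open>auto simp: flat_def\<close>)
  qed
qed

text \<open>The span of the products that are flat at both ends of [-r, r]. Linear combinations are
  included because differentiating one product yields four; the resulting class is closed under
  derivatives, as \<open>testI\<close> requires.\<close>

inductive_set bumps :: "real \<Rightarrow> (real \<Rightarrow> real) set" for r where
  base: "(\<lambda>s. flat k (r + s) * flat l (r - s)) \<in> bumps r"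
| lincomb: "f \<in> bumps r \<Longrightarrow> g \<in> bumps r \<Longrightarrow> (\<lambda>s. a * f s + b * g s) \<in> bumps r"

lemma bumps_derivative:
  "f \<in> bumps r \<Longrightarrow> \<exists>g\<in>bumps r. \<forall>s. (f has_real_derivative g s) (at s)"
proof (induction rule: bumps.induct)
  case (base k l)
  let ?b = "\<lambda>k l s. flat k (r + s) * flat l (r - s)"
  \<comment> \<open>The two signs of the second bracket come from the inner derivative -1 of r - s.
    The factors 1 give the term the binary shape of the rule \<open>lincomb\<close>.\<close>
  let ?g = "\<lambda>s. 1 * (1 * ?b (k + 2) l s + (- real k) * ?b (k + 1) l s) + 1 * ((-1) * ?b k (l + 2) s + real l * ?b k (l + 1) s)"
  have "?g \<in> bumps r" by (intro bumps.intros)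
  moreover have "(?b k l has_real_derivative ?g s) (at s)" for s
    by (rule derivative_eq_intros DERIV_chain2[OF flat_has_derivative] refl)+ (simp add: algebra_simps)
  ultimately show ?case by (intro bexI[of _ ?g] allI)
next
  case (lincomb f g a b)
  then obtain f' g' where "f' \<in> bumps r" "g' \<in> bumps r"
    "\<forall>s. (f has_real_derivative f' s) (at s)" "\<forall>s. (g has_real_derivative g' s) (at s)" by blast
  then show ?case
    by (intro bexI[of _ "\<lambda>s. a * f' s + b * g' s"]) (auto intro!: derivative_eq_intros bumps.intros)
qed

lemma bumps_support: "f \<in> bumps r \<Longrightarrow> r < \<bar>s\<bar> \<Longrightarrow> f s = 0"
  by (induction rule: bumps.induct) (auto simp: flat_def)

lemma exists_coordinate_gt:
  fixes x :: "'a::euclidean_space"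
  assumes "real DIM('a) * r < norm x"
  shows "\<exists>b\<in>Basis. r < \<bar>x \<bullet> b\<bar>"
proof (rule ccontr)
  assume "\<not> ?thesis"
  then have "(\<Sum>b\<in>Basis. \<bar>x \<bullet> b\<bar>) \<le> (\<Sum>b\<in>(Basis::'a set). r)" by (intro sum_mono) auto
  then show False using norm_le_l1[of x] assms by simp
qed

text \<open>A derivative in direction j only replaces the j-th factor by its derivative, again a
  member of \<open>bumps r\<close>. The class therefore lets every factor be chosen
  separately.\<close>

lemma test_tensor_bumps:
  fixes f :: "'a::euclidean_space \<Rightarrow> real \<Rightarrow> real"
  assumes f: "\<And>b. b \<in> Basis \<Longrightarrow> f b \<in> bumps r"
  shows "test (\<lambda>x. of_real (\<Prod>b\<in>Basis. f b (x \<bullet> b)))"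
proof (rule testI[where Y="{\<lambda>x. of_real (\<Prod>b\<in>Basis. f b (x \<bullet> b)) | f. \<forall>b\<in>Basis. f b \<in> bumps r}"])
  let ?Y = "{\<lambda>x::'a. complex_of_real (\<Prod>b\<in>Basis. f b (x \<bullet> b)) | f. \<forall>b\<in>Basis. f b \<in> bumps r}"
  show "(\<lambda>x. of_real (\<Prod>b\<in>Basis. f b (x \<bullet> b))) \<in> ?Y"
    by (intro CollectI exI[of _ f] conjI refl) (use f in blast)
  fix h assume "h \<in> ?Y"
  then obtain f where h: "h = (\<lambda>x. of_real (\<Prod>b\<in>Basis. f b (x \<bullet> b)))" and f: "\<And>b. b \<in> Basis \<Longrightarrow> f b \<in> bumps r"
    by (elim CollectE exE conjE) metis
  show "Cc h" unfolding h
  proof (rule CcI)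
    have "continuous_on UNIV (f b)" if "b \<in> Basis" for b
      using bumps_derivative[OF f[OF that]] by (metis DERIV_continuous_on has_field_derivative_at_within)
    then have "continuous_on UNIV (\<lambda>x. f b (x \<bullet> b))" if "b \<in> Basis" for b
      by (rule continuous_on_compose2) (use that in \<open>auto intro: continuous_intros\<close>)
    then show "continuous_on UNIV (\<lambda>x. complex_of_real (\<Prod>b\<in>Basis. f b (x \<bullet> b)))"
      by (intro continuous_on_of_real continuous_on_prod)
    fix x :: 'a assume "real DIM('a) * r < norm x"
    then obtain b where "b \<in> Basis" "r < \<bar>x \<bullet> b\<bar>" using exists_coordinate_gt by blast
    then show "complex_of_real (\<Prod>b\<in>Basis. f b (x \<bullet> b)) = 0" using bumps_support[OF f] by auto
  qed
  fix j assume j: "j \<in> (Basis :: 'a set)"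
  obtain g where g: "g \<in> bumps r" "\<And>s. (f j has_real_derivative g s) (at s)"
    using bumps_derivative[OF f[OF j]] by blast
  \<comment> \<open>Used with \<open>u = f j\<close> to isolate the dependence on s, and with
    \<open>u = g\<close> at \<open>s = 0\<close> to read the derivative as a product again.\<close>
  have split: "(\<Prod>b\<in>Basis. (f(j := u)) b ((x + s *\<^sub>R j) \<bullet> b)) = u (x \<bullet> j + s) * (\<Prod>b\<in>Basis - {j}. f b (x \<bullet> b))" for u s x
  proof -
    have "(\<Prod>b\<in>Basis - {j}. (f(j := u)) b ((x + s *\<^sub>R j) \<bullet> b)) = (\<Prod>b\<in>Basis - {j}. f b (x \<bullet> b))"
      using j by (intro prod.cong) (auto simp: inner_add_left inner_Basis)
    then show ?thesis
      using j by (subst prod.remove[OF finite_Basis j]) (simp add: inner_add_left)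
  qed
  have "((\<lambda>s. h (x + s *\<^sub>R j)) has_vector_derivative of_real (\<Prod>b\<in>Basis. (f(j := g)) b (x \<bullet> b))) (at 0)" for x
  proof -
    have "((\<lambda>s. f j (x \<bullet> j + s) * (\<Prod>b\<in>Basis - {j}. f b (x \<bullet> b))) has_real_derivative
      (g (x \<bullet> j) * (\<Prod>b\<in>Basis - {j}. f b (x \<bullet> b)))) (at 0)"
      by (rule derivative_eq_intros DERIV_chain2[OF g(2)] refl)+ simp
    then show ?thesis
      using split[of "f j" x] split[of g x 0] unfolding h
      by (intro has_vector_derivative_of_real) (simp add: has_real_derivative_iff_has_vector_derivative)
  qed
  moreover have "\<forall>b\<in>Basis. (f(j := g)) b \<in> bumps r" using f g(1) by simp
  then have "(\<lambda>x. complex_of_real (\<Prod>b\<in>Basis. (f(j := g)) b (x \<bullet> b))) \<in> ?Y"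
    by (intro CollectI exI[of _ "f(j := g)"] conjI refl)
  ultimately show "\<exists>g\<in>?Y. \<forall>x. ((\<lambda>s. h (x + s *\<^sub>R j)) has_vector_derivative g x) (at 0)"
    by (intro bexI[where x="\<lambda>x. complex_of_real (\<Prod>b\<in>Basis. (f(j := g)) b (x \<bullet> b))"] allI)
qed

lemma lborel_integral_pos:
  fixes f :: "'a::euclidean_space \<Rightarrow> real"
  assumes i: "integrable lborel f" and c: "continuous_on UNIV f" and nn: "\<And>x. 0 \<le> f x" and a: "0 < f a"
  shows "0 < (LINT x|lborel. f x)"
proof -
  have "(LINT x|lborel. f x) \<noteq> 0"
  proof
    assume "(LINT x|lborel. f x) = 0"
    then have "AE x in lborel. f x = 0"
      using integral_nonneg_eq_0_iff_AE[OF i] nn by auto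
    moreover have o: "open {x. f x \<noteq> 0}" by (intro open_Collect_neq c continuous_intros)
    ultimately have "{x. f x \<noteq> 0} \<in> null_sets lborel"
      by (subst AE_iff_null_sets) auto
    then have "negligible {x. f x \<noteq> 0}" by (simp add: negligible_iff_null_sets null_sets_completionI)
    then have "{x. f x \<noteq> 0} = {}" using open_not_negligible[OF o] by blast
    then show False using a by auto
  qed
  moreover have "0 \<le> (LINT x|lborel. f x)" using nn by simp
  ultimately show ?thesis by linarith
qed

lemma bump_exists:
  assumes "0 < r"
  obtains h :: "'a::euclidean_space \<Rightarrow> real" where "test (\<lambda>x. of_real (h x))" "\<And>x. 0 \<le> h x"
    "\<And>x. r < norm x \<Longrightarrow> h x = 0" "0 < (LINT x|lborel. h x)"
proof -
  \<comment> \<open>A product of functions supported in [-\<rho>, \<rho>] vanishes outside the ball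
    of radius \<open>DIM('a) * \<rho>\<close>, which is made equal to r.\<close>
  define \<rho> where "\<rho> = r / DIM('a)"
  have \<rho>: "0 < \<rho>" "DIM('a) * \<rho> = r" using assms by (simp_all add: \<rho>_def)
  define g where "g = (\<lambda>s. flat 0 (\<rho> + s) * flat 0 (\<rho> - s))"
  have g: "g \<in> bumps \<rho>" unfolding g_def by (rule bumps.base)
  define h where "h = (\<lambda>x::'a. \<Prod>b\<in>Basis. g (x \<bullet> b))"
  have t: "test (\<lambda>x. of_real (h x))" unfolding h_def by (rule test_tensor_bumps[OF g])
  then have c: "Cc (\<lambda>x. complex_of_real (h x))" by simp
  show ?thesis
  proof (rule that[OF t])
    show nn: "0 \<le> h x" for x by (auto simp: h_def g_def intro!: prod_nonneg mult_nonneg_nonneg flat_nonneg)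
    show "r < norm x \<Longrightarrow> h x = 0" for x
      using exists_coordinate_gt[of \<rho> x] bumps_support[OF g] by (auto simp: h_def \<rho>(2))
    have "continuous_on UNIV h" using continuous_on_Re[OF Cc_continuous[OF c]] by simp
    moreover have "integrable lborel h"
      using integrable_Re[OF integrable_Cc[OF locfin_lborel c]] by simp
    moreover have "0 < h 0" using \<rho> by (auto simp: h_def g_def intro!: zero_less_power mult_pos_pos flat_pos)
    ultimately show "0 < (LINT x|lborel. h x)" using nn by (intro lborel_integral_pos)
  qed
qed

subsection \<open>Integrals of products of functions of one coordinate\<close>

lemma
  fixes f :: "'a::euclidean_space \<Rightarrow> real \<Rightarrow> 'b::{real_normed_field, banach, second_countable_topology}"
  assumes f: "\<And>b. b \<in> Basis \<Longrightarrow> integrable lborel (f b)"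
  shows integrable_prod_coordinates: "integrable lborel (\<lambda>x::'a. \<Prod>b\<in>Basis. f b (x \<bullet> b))"
    and integral_prod_coordinates:
      "(LINT x|(lborel :: 'a measure). (\<Prod>b\<in>Basis. f b (x \<bullet> b))) = (\<Prod>b\<in>Basis. (LINT s|lborel. f b s))"
proof -
  interpret product_sigma_finite "\<lambda>_::'a. lborel :: real measure" ..
  have [measurable]: "\<And>b. b \<in> Basis \<Longrightarrow> f b \<in> borel_measurable borel"
    using borel_measurable_integrable[OF f] by simp
  have m: "(\<lambda>x::'a. \<Prod>b\<in>Basis. f b (x \<bullet> b)) \<in> borel_measurable borel"
    by measurable
  have p: "(\<Prod>b\<in>Basis. f b ((\<Sum>b\<in>Basis. y b *\<^sub>R b) \<bullet> b)) = (\<Prod>b\<in>Basis. f b (y b))" for y :: "'a \<Rightarrow> real"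
    by (intro prod.cong) auto
  show "integrable lborel (\<lambda>x::'a. \<Prod>b\<in>Basis. f b (x \<bullet> b))"
    by (subst lborel_eq, subst integrable_distr_eq, simp, rule m)
      (use product_integrable_prod[OF finite_Basis f] in \<open>simp add: p\<close>)
  show "(LINT x|(lborel :: 'a measure). (\<Prod>b\<in>Basis. f b (x \<bullet> b))) = (\<Prod>b\<in>Basis. (LINT s|lborel. f b s))"
    by (subst lborel_eq, subst integral_distr, simp, rule m)
      (use product_integral_prod[OF finite_Basis f] in \<open>simp add: p\<close>)
qed

lemma integrable_inverse_1_plus_square_lborel: "integrable lborel (\<lambda>s::real. inverse (1 + s\<^sup>2))"
  using integrable_inverse_1_plus_square by (simp add: set_integrable_def einterval_def)

text \<open>The product of the weights 1 / (1 + x_b^2) is integrable coordinate by coordinate, and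
  each 1 + x_b^2 is at most (1 + |x|)^2; this is the origin of the exponent
  \<open>2 * DIM('a)\<close>. Convergence in the Schwartz seminorms thereby controls L1
  norms.\<close>

lemma L1_norm_le_sn:
  obtains K where "\<And>\<psi> :: 'a::euclidean_space \<Rightarrow> complex.
    Cc \<psi> \<Longrightarrow> (LINT x|lborel. norm (\<psi> x)) \<le> K * sn (2 * DIM('a)) [] \<psi>"
proof -
  define W where "W = (\<lambda>x::'a. \<Prod>b\<in>Basis. inverse (1 + (x \<bullet> b)\<^sup>2))"
  have W: "integrable lborel W" unfolding W_def
    by (rule integrable_prod_coordinates[OF integrable_inverse_1_plus_square_lborel])
  have "(LINT x|lborel. norm (\<psi> x)) \<le> (LINT x|lborel. W x) * sn (2 * DIM('a)) [] \<psi>" if \<psi>: "Cc \<psi>" for \<psi> :: "'a \<Rightarrow> complex"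
  proof -
    have "norm (\<psi> x) \<le> W x * sn (2 * DIM('a)) [] \<psi>" for x
    proof -
      have "(\<Prod>b\<in>Basis. 1 + (x \<bullet> b)\<^sup>2) \<le> (\<Prod>b\<in>(Basis :: 'a set). (1 + norm x)\<^sup>2)"
      proof (intro prod_mono conjI)
        fix b :: 'a assume "b \<in> Basis"
        then have "(x \<bullet> b)\<^sup>2 \<le> (norm x)\<^sup>2" using Basis_le_norm[of b x] by (simp add: abs_le_square_iff[symmetric])
        then show "1 + (x \<bullet> b)\<^sup>2 \<le> (1 + norm x)\<^sup>2" by (auto simp: power2_sum intro: add_increasing2)
      qed auto
      also have "\<dots> = (1 + norm x) ^ (2 * DIM('a))" by (simp add: power_mult)
      finally have "(\<Prod>b\<in>Basis. 1 + (x \<bullet> b)\<^sup>2) * norm (\<psi> x) \<le> (1 + norm x) ^ (2 * DIM('a)) * norm (\<psi> x)"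
        by (rule mult_right_mono) simp
      also have "\<dots> \<le> sn (2 * DIM('a)) [] \<psi>" unfolding sn_def Dp.simps
      proof (rule cSUP_upper)
        obtain B where "\<forall>y\<in>range (\<lambda>x. ((1 + norm x) ^ (2 * DIM('a))) *\<^sub>R \<psi> x). norm y \<le> B"
          using bounded_weighted_Cc[OF \<psi>, of "2 * DIM('a)"] unfolding bounded_iff by blast
        then show "bdd_above (range (\<lambda>x. (1 + norm x) ^ (2 * DIM('a)) * norm (\<psi> x)))"
          by (intro bdd_aboveI[of _ B]) auto
      qed simp
      finally have *: "(\<Prod>b\<in>Basis. 1 + (x \<bullet> b)\<^sup>2) * norm (\<psi> x) \<le> sn (2 * DIM('a)) [] \<psi>" .
      have "W x * (\<Prod>b\<in>Basis. 1 + (x \<bullet> b)\<^sup>2) = (\<Prod>b\<in>(Basis :: 'a set). 1)"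
        unfolding W_def prod.distrib[symmetric]
      proof (intro prod.cong refl)
        fix b :: 'a
        have "1 + (x \<bullet> b)\<^sup>2 \<noteq> 0" using zero_le_power2[of "x \<bullet> b"] by linarith
        then show "inverse (1 + (x \<bullet> b)\<^sup>2) * (1 + (x \<bullet> b)\<^sup>2) = 1" by simp
      qed
      then have "norm (\<psi> x) = W x * ((\<Prod>b\<in>Basis. 1 + (x \<bullet> b)\<^sup>2) * norm (\<psi> x))"
        by (metis mult.assoc mult_1 prod.neutral_const)
      moreover have "0 \<le> W x" unfolding W_def by (intro prod_nonneg) auto
      ultimately show ?thesis using mult_left_mono[OF *] by metis
    qed
    then have "(LINT x|lborel. norm (\<psi> x)) \<le> (LINT x|lborel. W x * sn (2 * DIM('a)) [] \<psi>)"
      using integrable_Cc[OF locfin_lborel \<psi>] W by (intro integral_mono) auto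
    then show ?thesis by simp
  qed
  then show ?thesis by (rule that)
qed

subsection \<open>The form associated with a positive definite measure\<close>

lemma cm_int_add:
  assumes "cm_integrable \<mu> f" "cm_integrable \<mu> g"
  shows "cm_int \<mu> (\<lambda>x. f x + g x) = cm_int \<mu> f + cm_int \<mu> g"
  using assms by (simp add: cm_int_def cm_integrable_def ring_distribs)

lemma cm_int_scale: "cm_int \<mu> (\<lambda>x. c * f x) = c * cm_int \<mu> f"
  by (simp add: cm_int_def mult.assoc)

lemma cm_int_diff:
  assumes "cm_integrable \<mu> f" "cm_integrable \<mu> g"
  shows "cm_int \<mu> (\<lambda>x. f x - g x) = cm_int \<mu> f - cm_int \<mu> g"
  using assms by (simp add: cm_int_def cm_integrable_def ring_distribs)

lemma cm_int_sesquilinear: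
  assumes \<mu>: "radon \<mu>" and p: "Cc p" and q: "Cc q"
  shows "cm_int \<mu> (conv (\<lambda>x. p x + c * q x) (tilde (\<lambda>x. p x + c * q x))) =
    cm_int \<mu> (conv p (tilde p)) + cnj c * cm_int \<mu> (conv p (tilde q))
    + c * cm_int \<mu> (conv q (tilde p)) + (norm c)\<^sup>2 * cm_int \<mu> (conv q (tilde q))"
proof -
  note i = cm_integrable_Cc[OF \<mu>] Cc_conv Cc_tilde p q Cc_scale Cc_add
  have "conv (\<lambda>x. p x + c * q x) (tilde (\<lambda>x. p x + c * q x)) = (\<lambda>x.
     conv p (tilde p) x + cnj c * conv p (tilde q) x + c * conv q (tilde p) x
     + of_real ((norm c)\<^sup>2) * conv q (tilde q) x)"
    using conv_sesquilinear[OF p q, of c] by (simp add: fun_eq_iff)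
  then show ?thesis
    by (simp add: cm_int_add i cm_int_scale)
qed

text \<open>The left side is the sum of z S(z) over the fourth roots of unity: the sums of z and of
  z^2 vanish, and that of z cnj z is 4. Scalar coefficients let it serve both for values of \<mu>
  and for integrands at a point.\<close>

lemma polarization:
  fixes a b c d :: complex
  defines "S \<equiv> \<lambda>z. a + cnj z * b + z * c + (norm z)\<^sup>2 * d"
  shows "S 1 - S (-1) + \<i> * S \<i> - \<i> * S (- \<i>) = 4 * b"
  by (simp add: S_def algebra_simps)

text \<open>A substitute for the Cauchy-Schwarz inequality: by the parallelogram law S(c) + S(-c) is
  twice the sum of the diagonal values, and both summands are nonnegative, so each is bounded by
  that; polarization averages four of them. The additive form suffices, as only independence of
  translations will matter.\<close>

lemma pos_def_form_bound:
  fixes p q :: "'a::euclidean_space \<Rightarrow> complex"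
  assumes \<mu>: "radon \<mu>" and pd: "pos_def \<mu>" and p: "Cc p" and q: "Cc q"
  shows "norm (cm_int \<mu> (conv p (tilde q))) \<le>
    2 * (Re (cm_int \<mu> (conv p (tilde p))) + Re (cm_int \<mu> (conv q (tilde q))))"
proof -
  define S where "S c = cm_int \<mu> (conv (\<lambda>x. p x + c * q x) (tilde (\<lambda>x. p x + c * q x)))" for c
  note S = cm_int_sesquilinear[OF \<mu> p q, folded S_def]
  let ?b = "2 * (Re (cm_int \<mu> (conv p (tilde p))) + Re (cm_int \<mu> (conv q (tilde q))))"
  have pos: "Im (S c) = 0" "0 \<le> Re (S c)" for c
    using pd Cc_add[OF p Cc_scale[OF q]] unfolding pos_def_def S_def by blast+
  have bound: "norm (S c) \<le> ?b" if "norm c = 1" for c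
  proof -
    have "S c + S (- c) = 2 * (cm_int \<mu> (conv p (tilde p)) + cm_int \<mu> (conv q (tilde q)))"
      using that by (simp add: S)
    from arg_cong[OF this, of Re] have "Re (S c) \<le> ?b" using pos(2)[of "- c"] by simp
    moreover have "norm (S c) = Re (S c)" using pos[of c] by (simp add: cmod_eq_Re)
    ultimately show ?thesis by simp
  qed
  have "4 * cm_int \<mu> (conv p (tilde q)) = S 1 - S (-1) + \<i> * S \<i> - \<i> * S (- \<i>)"
    unfolding S by (rule polarization[symmetric])
  then have "4 * norm (cm_int \<mu> (conv p (tilde q))) = norm (S 1 - S (-1) + \<i> * S \<i> - \<i> * S (- \<i>))"
    by (metis norm_mult norm_numeral)
  also have "\<dots> \<le> norm (S 1) + norm (S (-1)) + norm (S \<i>) + norm (S (- \<i>))"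
    using norm_triangle_ineq4[of "S 1 - S (-1) + \<i> * S \<i>" "\<i> * S (- \<i>)"]
      norm_triangle_ineq[of "S 1 - S (-1)" "\<i> * S \<i>"] norm_triangle_ineq4[of "S 1" "S (-1)"]
    by (simp add: norm_mult)
  also have "\<dots> \<le> 4 * ?b" using bound[of 1] bound[of "-1"] bound[of \<i>] bound[of "- \<i>"] by simp
  finally show ?thesis by simp
qed

lemma conv_shift_left:
  fixes p q :: "'a::euclidean_space \<Rightarrow> complex"
  assumes p: "Cc p" and q: "Cc q"
  shows "conv (\<lambda>x. p (x - a)) q x = conv p q (x - a)"
proof -
  note [measurable] = Cc_borel[OF p] Cc_borel[OF q]
  have "(LINT y|lborel. (\<lambda>y. p y * q (x - a - y)) (y - a)) = (LINT y|lborel. p y * q (x - a - y))"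
    by (rule lborel_integral_shift) measurable
  then show ?thesis by (simp add: conv_def)
qed

text \<open>\<open>tilde\<close> turns a shift by a into a shift by -a, and the two cancel in the
  convolution.\<close>

lemma conv_shift_tilde:
  fixes p :: "'a::euclidean_space \<Rightarrow> complex"
  assumes p: "Cc p"
  shows "conv (\<lambda>x. p (x - a)) (tilde (\<lambda>x. p (x - a))) = conv p (tilde p)"
proof
  fix x
  have t: "tilde (\<lambda>x. p (x - a)) = (\<lambda>x. tilde p (x - (- a)))"
    by (simp add: tilde_def fun_eq_iff)
  note c = p Cc_tilde[OF p] Cc_shift[OF Cc_tilde[OF p], of "- a"]
  have "conv (\<lambda>x. p (x - a)) (tilde (\<lambda>x. p (x - a))) x = conv p (\<lambda>x. tilde p (x - (- a))) (x - a)"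
    unfolding t by (rule conv_shift_left[OF c(1,3)])
  also have "\<dots> = conv (\<lambda>x. tilde p (x - (- a))) p (x - a)"
    by (simp only: conv_commute[OF c(1,3)])
  also have "\<dots> = conv p (tilde p) x"
    by (subst conv_shift_left[OF c(2,1)]) (simp add: conv_commute[OF c(1,2)])
  finally show "conv (\<lambda>x. p (x - a)) (tilde (\<lambda>x. p (x - a))) x = conv p (tilde p) x" .
qed

text \<open>A positive definite measure need not be translation bounded, but its convolution
  with \<open>p * q\<close> is a bounded function.\<close>

lemma pos_def_conv_bound:
  fixes p q :: "'a::euclidean_space \<Rightarrow> complex"
  assumes \<mu>: "radon \<mu>" and pd: "pos_def \<mu>" and p: "Cc p" and q: "Cc q"
  obtains C where "\<And>\<psi>. Cc \<psi> \<Longrightarrow> norm (cm_int \<mu> (conv (conv p q) \<psi>)) \<le> C * (LINT x|lborel. norm (\<psi> x))"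
proof -
  \<comment> \<open>This is the form bound for a translate of p and for \<open>tilde q\<close>,
    whose own \<open>tilde\<close> is q. Only p is translated, and its diagonal value does not
    change, so C serves for all translates of \<open>conv p q\<close>.\<close>
  define C where "C = 2 * (Re (cm_int \<mu> (conv p (tilde p))) + Re (cm_int \<mu> (conv (tilde q) q)))"
  have sh: "conv (\<lambda>x. p (x - y)) q = (\<lambda>x. conv p q (x - y))" for y
    by (simp add: fun_eq_iff conv_shift_left[OF p q])
  have *: "norm (cm_int \<mu> (\<lambda>x. conv p q (x - y))) \<le> C" for y
    using pos_def_form_bound[OF \<mu> pd Cc_shift[OF p, of y] Cc_tilde[OF q]]
    by (simp add: conv_shift_tilde p sh C_def)
  have "norm (cm_int \<mu> (conv (conv p q) \<psi>)) \<le> C * (LINT x|lborel. norm (\<psi> x))" if \<psi>: "Cc \<psi>" for \<psi>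
  proof -
    define k where "k = conv p q"
    have k: "Cc k" unfolding k_def by (rule Cc_conv[OF p q])
    obtain R A where R: "\<And>x. R < norm x \<Longrightarrow> k x = 0" and A: "\<And>x. norm (k x) \<le> A" "0 < A" using k by (metis CcE)
    obtain S B where S: "\<And>x. S < norm x \<Longrightarrow> \<psi> x = 0" and B: "\<And>x. norm (\<psi> x) \<le> B" "0 < B" using \<psi> by (metis CcE)
    note [measurable] = Cc_borel[OF k] Cc_borel[OF \<psi>] radon_density_borel[OF \<mu>]
    let ?F = "\<lambda>x y. \<psi> y * k (x - y) * snd \<mu> x"
    have F: "(LINT x|fst \<mu>. LINT y|lborel. ?F x y) = (LINT y|lborel. LINT x|fst \<mu>. ?F x y)"
    proof (rule fubini_bounded_support[OF radon_locfin[OF \<mu>] locfin_lborel])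
      show "norm (?F x y) \<le> B * A" for x y
        using A B by (auto simp: norm_mult radon_density_norm[OF \<mu>] intro!: mult_mono)
      show "R + S < norm x \<Longrightarrow> ?F x y = 0" for x y
        using R[of "x - y"] S[of y] norm_triangle_ineq[of y "x - y"] by fastforce
    qed (use S in auto)
    have "cm_int \<mu> (conv k \<psi>) = (LINT x|fst \<mu>. LINT y|lborel. ?F x y)"
      by (simp add: conv_commute[OF k \<psi>] cm_int_def conv_def)
    also have "\<dots> = (LINT y|lborel. \<psi> y * cm_int \<mu> (\<lambda>x. k (x - y)))"
      unfolding F cm_int_def by (simp add: mult.assoc)
    also have "norm \<dots> \<le> (LINT y|lborel. norm (\<psi> y * cm_int \<mu> (\<lambda>x. k (x - y))))"
      by (rule integral_norm_bound)
    also have "\<dots> \<le> (LINT y|lborel. C * norm (\<psi> y))"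
    proof (rule integral_mono')
      show "norm (\<psi> y * cm_int \<mu> (\<lambda>x. k (x - y))) \<le> C * norm (\<psi> y)" for y
        using mult_right_mono[OF *[of y], of "norm (\<psi> y)"] by (simp add: k_def norm_mult mult.commute)
    qed (use integrable_Cc[OF locfin_lborel \<psi>] order_trans[OF norm_ge_zero *] in auto)
    finally show ?thesis by (simp add: k_def)
  qed
  then show ?thesis by (rule that)
qed

subsection \<open>Temperedness of positive definite measures\<close>

text \<open>\<open>ker0\<close> is a parametrix for the second derivative on the line: its second derivative is the
  Dirac measure at 0 plus \<open>ker2\<close>.  The polynomial is chosen so that both functions are continuous.\<close>

definition ker0 :: "real \<Rightarrow> real" where
  "ker0 s = (if 0 \<le> s \<and> s \<le> 1 then s - 3 * s ^ 3 + 3 * s ^ 5 - s ^ 7 else 0)"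

definition ker2 :: "real \<Rightarrow> real" where
  "ker2 s = (if 0 \<le> s \<and> s \<le> 1 then - 18 * s + 60 * s ^ 3 - 42 * s ^ 5 else 0)"

lemma continuous_on_piecewise_01:
  fixes p :: "real \<Rightarrow> real"
  assumes "continuous_on UNIV p" "p 0 = 0" "p 1 = 0"
  shows "continuous_on UNIV (\<lambda>s. if 0 \<le> s \<and> s \<le> 1 then p s else 0)"
proof -
  have "(\<lambda>s. if 0 \<le> s \<and> s \<le> 1 then p s else 0) = (\<lambda>s. p (max 0 (min 1 s)))"
    using assms by (auto simp: fun_eq_iff max_def min_def)
  moreover have "continuous_on UNIV (\<lambda>s. p (max 0 (min 1 s)))"
    by (auto intro!: continuous_on_compose2[OF assms(1)] continuous_intros)
  ultimately show ?thesis by (simp only:)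
qed

lemma continuous_ker0: "continuous_on UNIV ker0"
  unfolding ker0_def[abs_def] by (rule continuous_on_piecewise_01) (auto intro!: continuous_intros)

lemma continuous_ker2: "continuous_on UNIV ker2"
  unfolding ker2_def[abs_def] by (rule continuous_on_piecewise_01) (auto intro!: continuous_intros)

text \<open>Integration by parts with k(s) = s (1 - s^2)^3 and antiderivative k v' - k' v. The
  triple zero at 1 removes the boundary term there; at 0, k = 0 and k' = 1 leave exactly
  v(0).\<close>

lemma parametrix_1D:
  fixes v v' v'' :: "real \<Rightarrow> complex"
  assumes "\<And>s. (v has_vector_derivative v' s) (at s)" "\<And>s. (v' has_vector_derivative v'' s) (at s)"
    and c: "continuous_on UNIV v''"
  shows "(LINT s|lborel. ker0 s *\<^sub>R v'' s - ker2 s *\<^sub>R v s) = v 0"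
proof -
  let ?G = "\<lambda>s::real. (s - 3 * s ^ 3 + 3 * s ^ 5 - s ^ 7) *\<^sub>R v' s - (1 - 9 * s\<^sup>2 + 15 * s ^ 4 - 7 * s ^ 6) *\<^sub>R v s"
  let ?g = "\<lambda>s::real. (s - 3 * s ^ 3 + 3 * s ^ 5 - s ^ 7) *\<^sub>R v'' s - (- 18 * s + 60 * s ^ 3 - 42 * s ^ 5) *\<^sub>R v s"
  have "(?G has_vector_derivative ?g s) (at s)" for s
  proof -
    have 1: "((\<lambda>s::real. s - 3 * s ^ 3 + 3 * s ^ 5 - s ^ 7) has_real_derivative (1 - 9 * s\<^sup>2 + 15 * s ^ 4 - 7 * s ^ 6)) (at s)"
      by (auto intro!: derivative_eq_intros)
    have 2: "((\<lambda>s::real. 1 - 9 * s\<^sup>2 + 15 * s ^ 4 - 7 * s ^ 6) has_real_derivative (- 18 * s + 60 * s ^ 3 - 42 * s ^ 5)) (at s)"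
      by (auto intro!: derivative_eq_intros)
    show ?thesis
      using has_vector_derivative_diff[OF has_vector_derivative_scaleR[OF 1 assms(2)[of s]]
        has_vector_derivative_scaleR[OF 2 assms(1)[of s]]] by (simp add: algebra_simps)
  qed
  then have d: "(?G has_vector_derivative ?g s) (at s within {0..1})" for s
    by (rule has_vector_derivative_at_within)
  have "continuous_on UNIV v"
    using assms(1) by (auto intro!: continuous_at_imp_continuous_on has_vector_derivative_continuous)
  then have "continuous_on {0..1} ?g"
    using c by (auto intro!: continuous_intros intro: continuous_on_subset)
  from integral_FTC_atLeastAtMost[OF _ d this]
  have "(LINT s|lborel. indicator {0..1} s *\<^sub>R ?g s) = ?G 1 - ?G 0" by simp
  also have "(\<lambda>s. indicator {0..1} s *\<^sub>R ?g s) = (\<lambda>s. ker0 s *\<^sub>R v'' s - ker2 s *\<^sub>R v s)"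
    by (auto simp: fun_eq_iff ker0_def ker2_def indicator_def)
  finally show ?thesis by simp
qed

text \<open>Convolution in the coordinates of S only, over a product of lines indexed by S. It
  interpolates between \<phi> itself, for empty S, and convolution with a tensor product of kernels,
  for S = \<open>Basis\<close>, so that coordinates can be treated one at a time.\<close>

definition partial_conv :: "'a::euclidean_space set \<Rightarrow> ('a \<Rightarrow> real \<Rightarrow> real) \<Rightarrow> ('a \<Rightarrow> complex) \<Rightarrow> 'a \<Rightarrow> complex" where
  "partial_conv S c \<phi> z =
    (LINT y|PiM S (\<lambda>_. lborel). (\<Prod>i\<in>S. c i (y i)) *\<^sub>R \<phi> (z - (\<Sum>i\<in>S. y i *\<^sub>R i)))"

lemma partial_conv_empty: "partial_conv {} c \<phi> z = \<phi> z"
  unfolding partial_conv_def PiM_empty by (subst lebesgue_integral_count_space_finite) auto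

lemma integrable_kers: "k \<in> {ker0, ker2} \<Longrightarrow> integrable lborel k"
proof -
  assume k: "k \<in> {ker0, ker2}"
  then have c: "continuous_on UNIV k" using continuous_ker0 continuous_ker2 by auto
  have "Cc (\<lambda>s. complex_of_real (k s))"
    using k c by (intro CcI[where R=1] continuous_on_of_real) (auto simp: ker0_def ker2_def)
  from integrable_Re[OF integrable_Cc[OF locfin_lborel this]] show ?thesis by simp
qed

lemma partial_conv_integrable:
  assumes S: "finite S" and c: "\<And>i. i \<in> S \<Longrightarrow> c i \<in> {ker0, ker2}" and \<phi>: "Cc \<phi>"
  shows "integrable (PiM S (\<lambda>_. lborel)) (\<lambda>y. (\<Prod>i\<in>S. c i (y i)) *\<^sub>R \<phi> (z - (\<Sum>i\<in>S. y i *\<^sub>R i)))"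
proof -
  interpret product_sigma_finite "\<lambda>_. lborel :: real measure" ..
  obtain B where B: "\<And>x. norm (\<phi> x) \<le> B" using \<phi> Cc_bounded by blast
  have "0 \<le> B" using B[of 0] norm_ge_zero order_trans by blast
  have i: "integrable lborel (c i)" if "i \<in> S" for i by (rule integrable_kers[OF c[OF that]])
  have p: "integrable (PiM S (\<lambda>_. lborel)) (\<lambda>y. \<Prod>i\<in>S. c i (y i))"
    by (rule product_integrable_prod[OF S i])
  note [measurable] = Cc_borel[OF \<phi>] borel_measurable_integrable[OF p]
  show ?thesis
  proof (rule Bochner_Integration.integrable_bound)
    show "integrable (PiM S (\<lambda>_. lborel)) (\<lambda>y. B * (\<Prod>i\<in>S. c i (y i)))"
      using p by simp
    show "AE y in PiM S (\<lambda>_. lborel). norm ((\<Prod>i\<in>S. c i (y i)) *\<^sub>R \<phi> (z - (\<Sum>i\<in>S. y i *\<^sub>R i))) \<le> norm (B * (\<Prod>i\<in>S. c i (y i)))"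
    proof (rule AE_I2)
      fix y :: "'a \<Rightarrow> real"
      show "norm ((\<Prod>i\<in>S. c i (y i)) *\<^sub>R \<phi> (z - (\<Sum>i\<in>S. y i *\<^sub>R i))) \<le> norm (B * (\<Prod>i\<in>S. c i (y i)))"
        using mult_left_mono[OF B[of "z - (\<Sum>i\<in>S. y i *\<^sub>R i)"], of "\<bar>\<Prod>i\<in>S. c i (y i)\<bar>"] \<open>0 \<le> B\<close>
        by (simp add: abs_mult mult.commute)
    qed
  qed measurable
qed

text \<open>In one more coordinate, \<phi> equals \<open>ker0\<close> convolved with its second
  derivative minus \<open>ker2\<close> convolved with \<phi>. Fubini on the enlarged product makes
  the new coordinate the inner integral, where \<open>parametrix_1D\<close> applies.\<close>

lemma partial_conv_step:
  fixes \<phi> :: "'a::euclidean_space \<Rightarrow> complex"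
  assumes S: "finite S" and i: "i \<notin> S" "i \<in> Basis" and c: "\<And>i. i \<in> S \<Longrightarrow> c i \<in> {ker0, ker2}" and \<phi>: "test \<phi>"
  shows "partial_conv S c \<phi> z = partial_conv (insert i S) (c(i := ker0)) (Dp [i, i] \<phi>) z
    - partial_conv (insert i S) (c(i := ker2)) \<phi> z"
proof -
  interpret product_sigma_finite "\<lambda>_::'a. lborel :: real measure" ..
  let ?\<psi> = "Dp [i, i] \<phi>"
  have \<psi>: "test ?\<psi>" using i(2) by (intro test_Dp[OF \<phi>]) auto
  let ?P = "\<lambda>S. PiM S (\<lambda>_. lborel :: real measure)"
  let ?f = "\<lambda>k \<phi> y. (\<Prod>j\<in>insert i S. (c(i := k)) j (y j)) *\<^sub>R \<phi> (z - (\<Sum>j\<in>insert i S. y j *\<^sub>R j)) :: complex"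
  have k0: "\<And>j. j \<in> insert i S \<Longrightarrow> (c(i := ker0)) j \<in> {ker0, ker2}"
    and k2: "\<And>j. j \<in> insert i S \<Longrightarrow> (c(i := ker2)) j \<in> {ker0, ker2}"
    using c by auto
  have int: "integrable (?P (insert i S)) (?f ker0 ?\<psi>)" "integrable (?P (insert i S)) (?f ker2 \<phi>)"
    by (rule partial_conv_integrable[where c="c(i := ker0)", OF _ k0 conjunct1[OF \<psi>]]; simp add: S)
      (rule partial_conv_integrable[where c="c(i := ker2)", OF _ k2 conjunct1[OF \<phi>]]; simp add: S)
  have "partial_conv (insert i S) (c(i := ker0)) ?\<psi> z - partial_conv (insert i S) (c(i := ker2)) \<phi> z
      = (LINT y|?P (insert i S). ?f ker0 ?\<psi> y - ?f ker2 \<phi> y)"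
    unfolding partial_conv_def by (rule Bochner_Integration.integral_diff[OF int, symmetric])
  also have "\<dots> = (LINT x|?P S. LINT s|lborel. ?f ker0 ?\<psi> (x(i := s)) - ?f ker2 \<phi> (x(i := s)))"
    by (rule product_integral_insert[OF S i(1) Bochner_Integration.integrable_diff[OF int]])
  also have "\<dots> = partial_conv S c \<phi> z" unfolding partial_conv_def
  proof (intro Bochner_Integration.integral_cong refl)
    fix x :: "'a \<Rightarrow> real"
    let ?w = "z - (\<Sum>j\<in>S. x j *\<^sub>R j)" and ?C = "\<Prod>j\<in>S. c j (x j)"
    have f: "?f k \<phi> (x(i := s)) = ?C *\<^sub>R (k s *\<^sub>R \<phi> (?w - s *\<^sub>R i))" for k \<phi> s
    proof -
      have "(\<Prod>j\<in>S. (c(i := k)) j ((x(i := s)) j)) = ?C" "(\<Sum>j\<in>S. (x(i := s)) j *\<^sub>R j) = (\<Sum>j\<in>S. x j *\<^sub>R j)"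
        using i(1) by (auto intro!: prod.cong sum.cong)
      then show ?thesis using S i(1) by (simp add: algebra_simps)
    qed
    have ii: "test (pd i \<phi>)" by (rule test_pd[OF \<phi> i(2)])
    \<comment> \<open>The parameter runs backwards, as in a convolution; each derivative brings a
      sign, and the two signs cancel in the second derivative.\<close>
    have neg: "((\<lambda>s. u (?w - s *\<^sub>R i)) has_vector_derivative - pd i u (?w - s *\<^sub>R i)) (at s)" if "test u" for u s
    proof -
      have "((\<lambda>s::real. - s) has_vector_derivative -1) (at s)" by (auto intro!: derivative_eq_intros)
      from vector_diff_chain_at[OF this has_vector_derivative_pd[OF that i(2), of ?w "- s"]]
      show ?thesis by (simp add: comp_def)
    qed
    have "(LINT s|lborel. ker0 s *\<^sub>R ?\<psi> (?w - s *\<^sub>R i) - ker2 s *\<^sub>R \<phi> (?w - s *\<^sub>R i)) = \<phi> (?w - 0 *\<^sub>R i)"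
    proof (rule parametrix_1D[where v'="\<lambda>s. - pd i \<phi> (?w - s *\<^sub>R i)"])
      show "((\<lambda>s. \<phi> (?w - s *\<^sub>R i)) has_vector_derivative - pd i \<phi> (?w - s *\<^sub>R i)) (at s)" for s
        by (rule neg[OF \<phi>])
      show "((\<lambda>s. - pd i \<phi> (?w - s *\<^sub>R i)) has_vector_derivative ?\<psi> (?w - s *\<^sub>R i)) (at s)" for s
        using has_vector_derivative_minus[OF neg[OF ii, of s]] by simp
      show "continuous_on UNIV (\<lambda>s. ?\<psi> (?w - s *\<^sub>R i))"
        by (rule continuous_on_compose2[OF Cc_continuous[OF conjunct1[OF \<psi>]]]) (auto intro!: continuous_intros)
    qed
    then show "(LINT s|lborel. ?f ker0 ?\<psi> (x(i := s)) - ?f ker2 \<phi> (x(i := s))) = ?C *\<^sub>R \<phi> ?w"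
      unfolding f scaleR_diff_right[symmetric] by (simp del: Dp.simps)
  qed
  finally show ?thesis by simp
qed

lemma partial_conv_Basis:
  fixes \<phi> :: "'a::euclidean_space \<Rightarrow> complex"
  assumes c: "\<And>i. i \<in> Basis \<Longrightarrow> c i \<in> {ker0, ker2}" and \<phi>: "Cc \<phi>"
  shows "partial_conv Basis c \<phi> z = conv (\<lambda>x. of_real (\<Prod>i\<in>Basis. c i (x \<bullet> i))) \<phi> z"
proof -
  have [measurable]: "\<And>i. i \<in> Basis \<Longrightarrow> c i \<in> borel_measurable borel"
    using borel_measurable_integrable[OF integrable_kers[OF c]] by simp
  note [measurable] = Cc_borel[OF \<phi>]
  have p: "(\<Prod>b\<in>Basis. c b ((\<Sum>b\<in>Basis. y b *\<^sub>R b) \<bullet> b)) = (\<Prod>b\<in>Basis. c b (y b))" for y :: "'a \<Rightarrow> real"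
    by (intro prod.cong) auto
  have "(LINT x|lborel. (\<Prod>i\<in>Basis. c i (x \<bullet> i)) *\<^sub>R \<phi> (z - x)) = partial_conv Basis c \<phi> z"
    unfolding partial_conv_def
    by (subst lborel_eq, subst integral_distr) (simp_all add: p)
  then show ?thesis by (simp add: conv_def scaleR_conv_of_real)
qed

lemma Cc_tensor_kers:
  assumes c: "\<And>i. i \<in> Basis \<Longrightarrow> c i \<in> {ker0, ker2}"
  shows "Cc (\<lambda>x::'a::euclidean_space. complex_of_real (\<Prod>i\<in>Basis. c i (x \<bullet> i)))"
proof (rule CcI)
  have "continuous_on UNIV (\<lambda>x::'a. c b (x \<bullet> b))" if "b \<in> Basis" for b
    by (rule continuous_on_compose2[where s=UNIV])
      (use c[OF that] continuous_ker0 continuous_ker2 in \<open>auto intro!: continuous_intros\<close>)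
  then show "continuous_on UNIV (\<lambda>x::'a. complex_of_real (\<Prod>i\<in>Basis. c i (x \<bullet> i)))"
    by (intro continuous_on_of_real continuous_on_prod)
  fix x :: 'a assume "real DIM('a) * 1 < norm x"
  then obtain b where b: "b \<in> Basis" "1 < \<bar>x \<bullet> b\<bar>" using exists_coordinate_gt by blast
  then have "c b (x \<bullet> b) = 0" using c[OF b(1)] by (auto simp: ker0_def ker2_def)
  then show "complex_of_real (\<Prod>i\<in>Basis. c i (x \<bullet> i)) = 0" using b(1) by auto
qed

text \<open>Induction on the set U of untreated coordinates; each step splits a term in two. The
  list of kernels and derivatives is chosen before \<phi> and z, so that one finite expansion serves
  a whole sequence of test functions.\<close>

lemma partial_conv_expansion:
  fixes c :: "'a::euclidean_space \<Rightarrow> real \<Rightarrow> real"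
  assumes "finite U" "S \<inter> U = {}" "S \<union> U = Basis" "\<And>i. i \<in> S \<Longrightarrow> c i \<in> {ker0, ker2}"
  shows "\<exists>R. (\<forall>(E, is)\<in>set R. Cc E \<and> set is \<subseteq> Basis) \<and>
    (\<forall>\<phi> z. test \<phi> \<longrightarrow> partial_conv S c \<phi> z = (\<Sum>(E, is)\<leftarrow>R. conv E (Dp is \<phi>) z))"
  using assms
proof (induction U arbitrary: S c rule: finite_induct)
  case empty
  then have S: "S = Basis" by simp
  show ?case
    using empty(3) by (intro exI[of _ "[(\<lambda>x. of_real (\<Prod>i\<in>Basis. c i (x \<bullet> i)), [])]"])
      (auto simp: S partial_conv_Basis Cc_tensor_kers simp del: of_real_prod)
next
  case (insert i U)
  have i: "i \<in> Basis" "i \<notin> S" and S: "finite S"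
    using insert.prems(1,2) finite_subset[OF _ finite_Basis, of S] by auto
  have "insert i S \<inter> U = {}" "insert i S \<union> U = Basis" using insert by auto
  note IH = insert.IH[OF this]
  have k0: "\<And>j. j \<in> insert i S \<Longrightarrow> (c(i := ker0)) j \<in> {ker0, ker2}"
    and k2: "\<And>j. j \<in> insert i S \<Longrightarrow> (c(i := ker2)) j \<in> {ker0, ker2}"
    using insert.prems(3) by auto
  obtain R0 where *: "(\<forall>(E, is)\<in>set R0. Cc E \<and> set is \<subseteq> Basis) \<and>
    (\<forall>\<phi> z. test \<phi> \<longrightarrow> partial_conv (insert i S) (c(i := ker0)) \<phi> z = (\<Sum>(E, is)\<leftarrow>R0. conv E (Dp is \<phi>) z))"
    by (rule exE[OF IH[of "c(i := ker0)"]]) (erule k0, erule that)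
  note R0 = conjunct1[OF *] conjunct2[OF *, rule_format]
  obtain R2 where *: "(\<forall>(E, is)\<in>set R2. Cc E \<and> set is \<subseteq> Basis) \<and>
    (\<forall>\<phi> z. test \<phi> \<longrightarrow> partial_conv (insert i S) (c(i := ker2)) \<phi> z = (\<Sum>(E, is)\<leftarrow>R2. conv E (Dp is \<phi>) z))"
    by (rule exE[OF IH[of "c(i := ker2)"]]) (erule k2, erule that)
  note R2 = conjunct1[OF *] conjunct2[OF *, rule_format]
  \<comment> \<open>The second derivative is taken before those listed in \<open>is\<close>, and
    \<open>Dp\<close> applies the end of its list first; hence \<open>[i, i]\<close> is appended.
    The factor -1 is the minus sign in front of \<open>ker2\<close>.\<close>
  let ?R = "map (\<lambda>(E, is). (E, is @ [i, i])) R0 @ map (\<lambda>(E, is). ((\<lambda>x. (-1) * E x), is)) R2"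
  show ?case
  proof (intro exI[of _ ?R] conjI allI impI)
    show "\<forall>(E, is)\<in>set ?R. Cc E \<and> set is \<subseteq> Basis"
      using R0(1) R2(1) i(1) by (simp add: case_prod_unfold Cc_scale[of _ "-1", simplified] ball_Un)
    fix \<phi> :: "'a \<Rightarrow> complex" and z assume \<phi>: "test \<phi>"
    have t: "test (Dp [i, i] \<phi>)" using i(1) by (intro test_Dp[OF \<phi>]) auto
    have neg: "(\<Sum>(E, is)\<leftarrow>map (\<lambda>(E, is). ((\<lambda>x. (-1) * E x), is)) R. conv E (Dp is \<phi>) z) =
        - (\<Sum>(E, is)\<leftarrow>R. conv E (Dp is \<phi>) z)" for R
      by (induction R) (auto simp: conv_scale_left[of "-1", simplified])
    have "partial_conv S c \<phi> z = partial_conv (insert i S) (c(i := ker0)) (Dp [i, i] \<phi>) z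
      - partial_conv (insert i S) (c(i := ker2)) \<phi> z"
      by (rule partial_conv_step[OF S i(2,1) insert.prems(3) \<phi>])
    also have "\<dots> = (\<Sum>(E, is)\<leftarrow>R0. conv E (Dp is (Dp [i, i] \<phi>)) z) - (\<Sum>(E, is)\<leftarrow>R2. conv E (Dp is \<phi>) z)"
      by (simp only: R0(2)[OF t] R2(2)[OF \<phi>])
    also have "(\<Sum>(E, is)\<leftarrow>R0. conv E (Dp is (Dp [i, i] \<phi>)) z) =
        (\<Sum>(E, is)\<leftarrow>map (\<lambda>(E, is). (E, is @ [i, i])) R0. conv E (Dp is \<phi>) z)"
      by (simp add: comp_def case_prod_unfold Dp_append del: Dp.simps)
    finally show "partial_conv S c \<phi> z = (\<Sum>(E, is)\<leftarrow>?R. conv E (Dp is \<phi>) z)"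
      using neg by simp
  qed
qed

lemma parametrix:
  obtains R :: "(('a::euclidean_space \<Rightarrow> complex) \<times> 'a list) list" where
    "\<And>E is. (E, is) \<in> set R \<Longrightarrow> Cc E \<and> set is \<subseteq> Basis"
    "\<And>\<phi>. test \<phi> \<Longrightarrow> \<phi> = (\<lambda>z. \<Sum>(E, is)\<leftarrow>R. conv E (Dp is \<phi>) z)"
proof -
  \<comment> \<open>The choice \<open>\<lambda>_. ker0\<close> is a dummy: over the empty set of
    coordinates no kernel occurs.\<close>
  obtain R :: "(('a \<Rightarrow> complex) \<times> 'a list) list" where *: "(\<forall>(E, is)\<in>set R. Cc E \<and> set is \<subseteq> Basis) \<and>
    (\<forall>\<phi> z. test \<phi> \<longrightarrow> partial_conv {} (\<lambda>_. ker0) \<phi> z = (\<Sum>(E, is)\<leftarrow>R. conv E (Dp is \<phi>) z))"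
    by (rule exE[OF partial_conv_expansion[of "Basis :: 'a set" "{}" "\<lambda>_. ker0"]]) (simp, simp, simp, simp, erule that)
  show ?thesis
  proof (rule that[of R])
    show "Cc E \<and> set is \<subseteq> Basis" if "(E, is) \<in> set R" for E "is"
      using bspec[OF conjunct1[OF *] that] by simp
    show "\<phi> = (\<lambda>z. \<Sum>(E, is)\<leftarrow>R. conv E (Dp is \<phi>) z)" if "test \<phi>" for \<phi>
      by (rule ext) (use conjunct2[OF *, rule_format, OF that] in \<open>simp only: partial_conv_empty\<close>)
  qed
qed

text \<open>The functional is abstract so that the reduction can be iterated, first for \<mu> and
  then for \<mu> composed with convolution by a kernel. Signs and scalars already sit in the
  kernels, so additivity of L suffices.\<close>

lemma tendsto_0_by_parametrix:
  fixes L :: "('a::euclidean_space \<Rightarrow> complex) \<Rightarrow> complex"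
  assumes add: "\<And>f g. Cc f \<Longrightarrow> Cc g \<Longrightarrow> L (\<lambda>x. f x + g x) = L f + L g" and zero: "L (\<lambda>_. 0) = 0"
    and \<phi>: "\<And>j. test (\<phi> j)"
    and lim: "\<And>E is. Cc E \<Longrightarrow> set is \<subseteq> Basis \<Longrightarrow> (\<lambda>j. L (conv E (Dp is (\<phi> j)))) \<longlonglongrightarrow> 0"
  shows "(\<lambda>j. L (\<phi> j)) \<longlonglongrightarrow> 0"
proof -
  obtain R :: "(('a \<Rightarrow> complex) \<times> 'a list) list" where R: "\<And>E is. (E, is) \<in> set R \<Longrightarrow> Cc E \<and> set is \<subseteq> Basis"
    and eq: "\<And>\<phi>. test \<phi> \<Longrightarrow> \<phi> = (\<lambda>z. \<Sum>(E, is)\<leftarrow>R. conv E (Dp is \<phi>) z)" by (rule parametrix) (rule that)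
  \<comment> \<open>Membership of the partial sums in \<open>Cc\<close> is carried along because
    additivity of L is assumed only there.\<close>
  have "(\<forall>j. Cc (\<lambda>z. \<Sum>(E, is)\<leftarrow>R. conv E (Dp is (\<phi> j)) z)) \<and>
      (\<lambda>j. L (\<lambda>z. \<Sum>(E, is)\<leftarrow>R. conv E (Dp is (\<phi> j)) z)) \<longlonglongrightarrow> 0"
    using R
  proof (induction R)
    case Nil
    show ?case by (simp add: zero CcI)
  next
    case (Cons r R)
    obtain E "is" where r: "r = (E, is)" by (cases r)
    have E: "Cc E" "set is \<subseteq> Basis" using Cons.prems[of E "is"] r by auto
    have c: "Cc (conv E (Dp is (\<phi> j)))" for j
      using test_Dp[OF \<phi> E(2)] by (intro Cc_conv E) auto
    have IH: "\<And>j. Cc (\<lambda>z. \<Sum>(E, is)\<leftarrow>R. conv E (Dp is (\<phi> j)) z)"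
        "(\<lambda>j. L (\<lambda>z. \<Sum>(E, is)\<leftarrow>R. conv E (Dp is (\<phi> j)) z)) \<longlonglongrightarrow> 0"
      using Cons by (auto simp: list.set_intros)
    have "L (\<lambda>z. \<Sum>(E, is)\<leftarrow>r # R. conv E (Dp is (\<phi> j)) z) =
        L (conv E (Dp is (\<phi> j))) + L (\<lambda>z. \<Sum>(E, is)\<leftarrow>R. conv E (Dp is (\<phi> j)) z)" for j
      using add[OF c IH(1)] by (simp add: r)
    then show ?case
      using tendsto_add[OF lim[OF E] IH(2)] Cc_add[OF c IH(1)] by (simp add: r)
  qed
  then show ?thesis using eq[OF \<phi>] by simp
qed

theorem pos_def_tempered:
  fixes \<mu> :: "'a::euclidean_space cmeasure"
  assumes \<mu>: "radon \<mu>" and pd: "pos_def \<mu>"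
  shows "tempered \<mu>"
  unfolding tempered_def
proof (intro allI impI)
  fix \<phi> :: "nat \<Rightarrow> 'a \<Rightarrow> complex"
  assume \<phi>: "(\<forall>j. test (\<phi> j)) \<and> S_lim \<phi> (\<lambda>_. 0)"
  note i = cm_integrable_Cc[OF \<mu>]
  obtain K where K: "\<And>\<psi> :: 'a \<Rightarrow> complex. Cc \<psi> \<Longrightarrow> (LINT x|lborel. norm (\<psi> x)) \<le> K * sn (2 * DIM('a)) [] \<psi>"
    by (rule L1_norm_le_sn) (rule that)
  show "(\<lambda>j. cm_int \<mu> (\<phi> j)) \<longlonglongrightarrow> 0"
  proof (rule tendsto_0_by_parametrix[where L="cm_int \<mu>"])
    show "cm_int \<mu> (\<lambda>x. f x + g x) = cm_int \<mu> f + cm_int \<mu> g" if "Cc f" "Cc g" for f g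
      using that by (intro cm_int_add i)
    show "cm_int \<mu> (\<lambda>_. 0) = 0" by (simp add: cm_int_def)
    show "test (\<phi> j)" for j using \<phi> by blast
    fix E :: "'a \<Rightarrow> complex" and "is" :: "'a list" assume E: "Cc E" and "is": "set is \<subseteq> Basis"
    show "(\<lambda>j. cm_int \<mu> (conv E (Dp is (\<phi> j)))) \<longlonglongrightarrow> 0"
    \<comment> \<open>The second application supplies the kernel \<open>E'\<close>; associativity
      then groups the two kernels into the product \<open>conv E E'\<close> that the translation
      bound requires.\<close>
    proof (rule tendsto_0_by_parametrix[where L="\<lambda>f. cm_int \<mu> (conv E f)"])
      fix f g :: "'a \<Rightarrow> complex" assume fg: "Cc f" "Cc g"
      have "conv E (\<lambda>x. f x + g x) = (\<lambda>x. conv E f x + conv E g x)"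
        by (simp add: fun_eq_iff conv_add_right E fg)
      then show "cm_int \<mu> (conv E (\<lambda>x. f x + g x)) = cm_int \<mu> (conv E f) + cm_int \<mu> (conv E g)"
        using E fg by (simp add: cm_int_add i Cc_conv)
    next
      show "cm_int \<mu> (conv E (\<lambda>_. 0)) = 0" by (simp add: cm_int_def conv_def)
      show t: "test (Dp is (\<phi> j))" for j by (rule test_Dp[OF conjunct1[OF \<phi>, rule_format] "is"])
      fix E' :: "'a \<Rightarrow> complex" and is' :: "'a list" assume E': "Cc E'" and is': "set is' \<subseteq> Basis"
      obtain C where C: "\<And>\<psi>. Cc \<psi> \<Longrightarrow> norm (cm_int \<mu> (conv (conv E E') \<psi>)) \<le> C * (LINT x|lborel. norm (\<psi> x))"
        by (rule pos_def_conv_bound[OF \<mu> pd E E']) (rule that)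
      \<comment> \<open>The subtraction of 0 keeps the form in which \<open>S_lim\<close> states
        convergence to the zero function.\<close>
      let ?s = "\<lambda>j. sn (2 * DIM('a)) (is' @ is) (\<lambda>x. \<phi> j x - 0)"
      show "(\<lambda>j. cm_int \<mu> (conv E (conv E' (Dp is' (Dp is (\<phi> j)))))) \<longlonglongrightarrow> 0"
      proof (rule Lim_null_comparison[OF always_eventually])
        show "\<forall>j. norm (cm_int \<mu> (conv E (conv E' (Dp is' (Dp is (\<phi> j)))))) \<le> \<bar>C\<bar> * (\<bar>K\<bar> * \<bar>?s j\<bar>)"
        proof
          fix j
          let ?\<psi> = "Dp is' (Dp is (\<phi> j))"
          have \<psi>: "Cc ?\<psi>" using test_Dp[OF t is'] by blast
          have "norm (cm_int \<mu> (conv E (conv E' ?\<psi>))) \<le> C * (LINT x|lborel. norm (?\<psi> x))"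
            using C[OF \<psi>] by (simp add: conv_assoc E E' \<psi>)
          also have "\<dots> \<le> \<bar>C\<bar> * (LINT x|lborel. norm (?\<psi> x))"
            by (intro mult_right_mono) auto
          also have "\<dots> \<le> \<bar>C\<bar> * \<bar>K * sn (2 * DIM('a)) [] ?\<psi>\<bar>"
            by (intro mult_left_mono order_trans[OF K[OF \<psi>]] abs_ge_self abs_ge_zero)
          also have "sn (2 * DIM('a)) [] ?\<psi> = sn (2 * DIM('a)) (is' @ is) (\<lambda>x. \<phi> j x - 0)"
            by (simp add: sn_def Dp_append)
          finally show "norm (cm_int \<mu> (conv E (conv E' ?\<psi>))) \<le> \<bar>C\<bar> * (\<bar>K\<bar> * \<bar>?s j\<bar>)"
            by (simp only: abs_mult)
        qed
        have "?s \<longlonglongrightarrow> 0"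
          by (rule conjunct2[OF \<phi>, unfolded S_lim_def, rule_format]) (use "is" is' in simp)
        then show "(\<lambda>j. \<bar>C\<bar> * (\<bar>K\<bar> * \<bar>?s j\<bar>)) \<longlonglongrightarrow> 0"
          by (intro tendsto_mult_right_zero tendsto_rabs_zero)
      qed
    qed
  qed
qed

subsection \<open>The action on test functions, and limits of positive definite measures\<close>

lemma Dp_zero: "Dp is (\<lambda>_. 0) = (\<lambda>_::'a::euclidean_space. 0)"
  by (induction "is") (simp_all add: pd_def)

text \<open>Temperedness speaks only of null sequences, so it is applied to the differences \<phi>_j
  - f. The constant sequence f is admissible, which forces uniqueness of the value described by
  \<open>act\<close>.\<close>

lemma act_test:
  fixes \<mu> :: "'a::euclidean_space cmeasure"
  assumes \<mu>: "radon \<mu>" and t: "tempered \<mu>" and f: "test f"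
  shows "act \<mu> f = cm_int \<mu> f"
  unfolding act_def
proof (rule the_equality)
  show "\<forall>\<phi>. (\<forall>j. test (\<phi> j)) \<and> S_lim \<phi> f \<longrightarrow> (\<lambda>j. cm_int \<mu> (\<phi> j)) \<longlonglongrightarrow> cm_int \<mu> f"
  proof (intro allI impI)
    fix \<phi> :: "nat \<Rightarrow> 'a \<Rightarrow> complex" assume \<phi>: "(\<forall>j. test (\<phi> j)) \<and> S_lim \<phi> f"
    have test: "test (\<phi> j)" for j by (rule conjunct1[OF \<phi>, rule_format])
    let ?\<psi> = "\<lambda>j x. \<phi> j x - f x"
    have "\<forall>j. test (?\<psi> j)"
      by (rule allI, rule test_diff[OF test f])
    moreover have "S_lim ?\<psi> (\<lambda>_. 0)"
      using conjunct2[OF \<phi>] by (simp add: S_lim_def)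
    ultimately have "(\<lambda>j. cm_int \<mu> (?\<psi> j)) \<longlonglongrightarrow> 0"
      by (intro t[unfolded tempered_def, rule_format] conjI allI) blast+
    moreover have "cm_int \<mu> (?\<psi> j) = cm_int \<mu> (\<phi> j) - cm_int \<mu> f" for j
      by (intro cm_int_diff cm_integrable_Cc[OF \<mu>] conjunct1[OF test] conjunct1[OF f])
    ultimately show "(\<lambda>j. cm_int \<mu> (\<phi> j)) \<longlonglongrightarrow> cm_int \<mu> f"
      by (simp add: LIM_zero_iff)
  qed
next
  fix c assume c: "\<forall>\<phi>. (\<forall>j. test (\<phi> j)) \<and> S_lim \<phi> f \<longrightarrow> (\<lambda>j. cm_int \<mu> (\<phi> j)) \<longlonglongrightarrow> c"
  have "S_lim (\<lambda>_. f) f" by (simp add: S_lim_def sn_def Dp_zero)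
  then have "(\<lambda>j. cm_int \<mu> f) \<longlonglongrightarrow> c"
    using c[rule_format, of "\<lambda>_. f"] f by simp
  then show "c = cm_int \<mu> f" by (simp add: LIMSEQ_const_iff)
qed

section \<open>Mollification and limits of positive definite measures\<close>

lemma norm_conv_le:
  assumes B: "\<And>x. norm (q x) \<le> B" and p: "Cc p" and q: "Cc q"
  shows "norm (conv p q x) \<le> B * (LINT y|lborel. norm (p y))"
proof -
  have "norm (conv p q x) \<le> (LINT y|lborel. norm (p y * q (x - y)))"
    unfolding conv_def by (rule integral_norm_bound)
  also have "\<dots> \<le> (LINT y|lborel. B * norm (p y))"
  proof (rule integral_mono)
    show "integrable lborel (\<lambda>y. norm (p y * q (x - y)))"
      by (intro integrable_norm conv_integrable p Cc_continuous[OF q])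
    show "integrable lborel (\<lambda>y. B * norm (p y))"
      using integrable_Cc[OF locfin_lborel p] by simp
    show "norm (p y * q (x - y)) \<le> B * norm (p y)" for y
      using mult_right_mono[OF B[of "x - y"] norm_ge_zero[of "p y"]] by (simp add: norm_mult mult.commute)
  qed
  finally show ?thesis by simp
qed

text \<open>Convolution with normalized bumps supported in balls of radius 1 / (k + 1). Pointwise
  convergence with a common bound and a common support is exactly what dominated convergence will
  need.\<close>

lemma mollify:
  fixes f :: "'a::euclidean_space \<Rightarrow> complex"
  assumes f: "Cc f"
  obtains F :: "nat \<Rightarrow> 'a \<Rightarrow> complex" and R B where "\<And>k. test (F k)" "\<And>x. (\<lambda>k. F k x) \<longlonglongrightarrow> f x"
    "\<And>k x. norm (F k x) \<le> B" "\<And>k x. R < norm x \<Longrightarrow> F k x = 0"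
proof -
  obtain R B where R: "\<And>x. R < norm x \<Longrightarrow> f x = 0" and B: "\<And>x. norm (f x) \<le> B" "0 < B" using f by (metis CcE)
  have "\<exists>h :: 'a \<Rightarrow> real. test (\<lambda>x. complex_of_real (h x)) \<and> (\<forall>x. 0 \<le> h x) \<and> (\<forall>x. 1 / real (Suc k) < norm x \<longrightarrow> h x = 0) \<and> 0 < (LINT x|lborel. h x)" for k
    by (rule bump_exists[of "1 / real (Suc k)"]) auto
  then obtain h :: "nat \<Rightarrow> 'a \<Rightarrow> real" where h: "\<And>k. test (\<lambda>x. complex_of_real (h k x))" "\<And>k x. 0 \<le> h k x"
    "\<And>k x. 1 / real (Suc k) < norm x \<Longrightarrow> h k x = 0" "\<And>k. 0 < (LINT x|lborel. h k x)" by metis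
  define c where "c k = (LINT x|lborel. h k x)" for k
  define H where "H k x = complex_of_real (1 / c k) * complex_of_real (h k x)" for k x
  have H: "test (H k)" for k
    using test_lincomb[OF h(1) h(1), of "complex_of_real (1 / c k)" k 0 k] unfolding H_def by simp
  then have Hc: "Cc (H k)" for k by blast
  have Hn: "norm (H k x) = h k x / c k" for k x
    using h(2)[of k x] h(4)[of k] by (simp add: H_def norm_mult c_def norm_divide)
  have hi: "integrable lborel (h k)" for k
    using integrable_Re[OF integrable_Cc[OF locfin_lborel conjunct1[OF h(1)[of k]]]] by simp
  have H1: "(LINT x|lborel. norm (H k x)) = 1" "(LINT x|lborel. H k x) = 1" for k
    using h(4)[of k] hi[of k] by (simp_all only: Hn) (simp_all add: c_def H_def)
  show ?thesis
  proof (rule that)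
    show "test (conv (H k) f)" for k by (rule test_conv[OF H f])
    show "norm (conv (H k) f x) \<le> B" for k x
      using norm_conv_le[OF B(1) Hc f, of k x] by (simp add: H1)
    show "conv (H k) f x = 0" if x: "R + 1 < norm x" for k x
    proof -
      have "H k y * f (x - y) = 0" for y
      proof (cases "1 / real (Suc k) < norm y")
        case False
        have "1 / real (Suc k) \<le> 1" by simp
        moreover have "norm x \<le> norm y + norm (x - y)" using norm_triangle_ineq[of y "x - y"] by simp
        ultimately have "R < norm (x - y)" using False x by linarith
        then show ?thesis by (simp add: R)
      qed (simp add: H_def h(3))
      then show ?thesis by (simp only: conv_def Bochner_Integration.integral_zero)
    qed
    show "(\<lambda>k. conv (H k) f x) \<longlonglongrightarrow> f x" for x
    proof (rule LIMSEQ_I)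
      fix e :: real assume "0 < e"
      have "isCont f x" using Cc_continuous[OF f] by (simp add: continuous_on_eq_continuous_at)
      then obtain d where d: "0 < d" "\<And>z. norm (z - x) < d \<Longrightarrow> norm (f z - f x) < e / 2"
        using \<open>0 < e\<close> unfolding continuous_at_eps_delta dist_norm by (metis half_gt_zero)
      obtain K where K: "1 / real (Suc K) < d" using d(1) nat_approx_posE by blast
      have "norm (conv (H k) f x - f x) < e" if "K \<le> k" for k
      proof -
        have i1: "integrable lborel (\<lambda>y. H k y * f (x - y))" by (rule conv_integrable[OF Hc Cc_continuous[OF f]])
        have i2: "integrable lborel (\<lambda>y. H k y * f x)" using integrable_Cc[OF locfin_lborel Hc] by simp
        have "conv (H k) f x - f x = (LINT y|lborel. H k y * f (x - y)) - (LINT y|lborel. H k y * f x)"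
          by (simp add: conv_def H1)
        also have "\<dots> = (LINT y|lborel. H k y * f (x - y) - H k y * f x)"
          by (rule Bochner_Integration.integral_diff[OF i1 i2, symmetric])
        also have "norm \<dots> \<le> (LINT y|lborel. e / 2 * norm (H k y))"
        proof (rule Bochner_Integration.integral_norm_bound_integral)
          show "integrable lborel (\<lambda>y. H k y * f (x - y) - H k y * f x)" using i1 i2 by simp
          show "integrable lborel (\<lambda>y. e / 2 * norm (H k y))" using integrable_Cc[OF locfin_lborel Hc[of k]] by simp
          fix y
          show "norm (H k y * f (x - y) - H k y * f x) \<le> e / 2 * norm (H k y)"
          proof (cases "1 / real (Suc k) < norm y")
            case True
            then show ?thesis by (simp add: H_def h(3))
          next
            case False
            have "1 / real (Suc k) \<le> 1 / real (Suc K)" using that by (simp add: field_simps)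
            then have "norm (f (x - y) - f x) \<le> e / 2" using d(2)[of "x - y"] False K by simp
            then have "norm (H k y) * norm (f (x - y) - f x) \<le> norm (H k y) * (e / 2)" by (rule mult_left_mono) simp
            then show ?thesis by (simp add: norm_mult[symmetric] right_diff_distrib mult.commute)
          qed
        qed
        also have "\<dots> = e / 2" by (simp add: H1)
        finally show ?thesis using \<open>0 < e\<close> by simp
      qed
      then show "\<exists>K. \<forall>k\<ge>K. norm (conv (H k) f x - f x) < e" by blast
    qed
  qed
qed

text \<open>Dominated convergence twice: inside the convolution, with B^2 on the ball of radius R as
  majorant, and then against \<mu>, where the convolutions live on the ball of radius 2 R.\<close>

lemma cm_int_conv_tilde_limit:
  fixes F :: "nat \<Rightarrow> 'a::euclidean_space \<Rightarrow> complex"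
  assumes \<mu>: "radon \<mu>" and F: "\<And>k. Cc (F k)" and f: "Cc f" and lim: "\<And>x. (\<lambda>k. F k x) \<longlonglongrightarrow> f x"
    and B: "\<And>k x. norm (F k x) \<le> B" and R: "\<And>k x. R < norm x \<Longrightarrow> F k x = 0"
  shows "(\<lambda>k. cm_int \<mu> (conv (F k) (tilde (F k)))) \<longlonglongrightarrow> cm_int \<mu> (conv f (tilde f))"
proof -
  have B0: "0 \<le> B" using B[of 0 0] norm_ge_zero order_trans by blast
  have Bt: "norm (tilde (F k) x) \<le> B" for k x using B by (simp add: tilde_def)
  let ?w = "\<lambda>y::'a. B * B * indicator (cball 0 R) y"
  have w: "integrable M ?w" if "locfin M" for M
    by (rule integrable_bounded_support[OF that, where B="B * B" and R=R]) (use B0 in \<open>auto simp: indicator_def\<close>)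
  note [measurable] = Cc_borel[OF F] Cc_borel[OF Cc_tilde[OF F]] Cc_borel[OF f] Cc_borel[OF Cc_tilde[OF f]]
  have c: "(\<lambda>k. conv (F k) (tilde (F k)) x) \<longlonglongrightarrow> conv f (tilde f) x" for x
    unfolding conv_def
  proof (rule integral_dominated_convergence[where w="?w"])
    show "AE y in lborel. (\<lambda>k. F k y * tilde (F k) (x - y)) \<longlonglongrightarrow> f y * tilde f (x - y)"
      unfolding tilde_def by (intro AE_I2 tendsto_intros lim)
    show "AE y in lborel. norm (F k y * tilde (F k) (x - y)) \<le> ?w y" for k
    proof (rule AE_I2)
      fix y
      show "norm (F k y * tilde (F k) (x - y)) \<le> ?w y"
        using mult_mono[OF B Bt B0 norm_ge_zero, of k y k "x - y"] R[of y k]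
        by (cases "norm y \<le> R") (auto simp: norm_mult)
    qed
  qed (use w[OF locfin_lborel] in measurable)
  define V where "V = (LINT y|lborel. ?w y)"
  have cb: "norm (conv (F k) (tilde (F k)) x) \<le> V" for k x
  proof -
    have "norm (conv (F k) (tilde (F k)) x) \<le> (LINT y|lborel. norm (F k y * tilde (F k) (x - y)))"
      unfolding conv_def by (rule integral_norm_bound)
    also have "\<dots> \<le> V" unfolding V_def
    proof (rule integral_mono[OF _ w[OF locfin_lborel]])
      show "integrable lborel (\<lambda>y. norm (F k y * tilde (F k) (x - y)))"
        by (intro integrable_norm conv_integrable F Cc_continuous Cc_tilde)
      fix y
      show "norm (F k y * tilde (F k) (x - y)) \<le> ?w y"
        using mult_mono[OF B Bt B0 norm_ge_zero, of k y k "x - y"] R[of y k]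
        by (cases "norm y \<le> R") (auto simp: norm_mult)
    qed
    finally show ?thesis .
  qed
  have c0: "conv (F k) (tilde (F k)) x = 0" if "R + R < norm x" for k x
  proof -
    have "F k y * tilde (F k) (x - y) = 0" for y
      using R[of y k] R[of "- (x - y)" k] that norm_triangle_ineq[of y "x - y"]
      by (cases "R < norm y") (auto simp: tilde_def norm_minus_commute)
    then show ?thesis by (simp only: conv_def Bochner_Integration.integral_zero)
  qed
  have V: "0 \<le> V" using cb[of 0 0] norm_ge_zero order_trans by blast
  note [measurable] = Cc_borel[OF Cc_conv[OF F Cc_tilde[OF F]]] Cc_borel[OF Cc_conv[OF f Cc_tilde[OF f]]] radon_density_borel[OF \<mu>]
  show ?thesis unfolding cm_int_def
  proof (rule integral_dominated_convergence[where w="\<lambda>x. V * indicator (cball 0 (R + R)) x"])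
    show "integrable (fst \<mu>) (\<lambda>x. V * indicator (cball 0 (R + R)) x)"
      by (rule integrable_bounded_support[OF radon_locfin[OF \<mu>], where B=V and R="R + R"])
        (use V in \<open>auto simp: indicator_def\<close>)
    show "AE x in fst \<mu>. (\<lambda>k. conv (F k) (tilde (F k)) x * snd \<mu> x) \<longlonglongrightarrow> conv f (tilde f) x * snd \<mu> x"
      by (intro AE_I2 tendsto_intros c)
    show "AE x in fst \<mu>. norm (conv (F k) (tilde (F k)) x * snd \<mu> x) \<le> V * indicator (cball 0 (R + R)) x" for k
      using cb[of k] c0[of _ k] by (intro AE_I2) (auto simp: norm_mult radon_density_norm[OF \<mu>] indicator_def)
    show "(\<lambda>x. conv f (tilde f) x * snd \<mu> x) \<in> borel_measurable (fst \<mu>)"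
      by (rule locfin_measurable[OF radon_locfin[OF \<mu>]]) measurable
    show "(\<lambda>x. conv (F k) (tilde (F k)) x * snd \<mu> x) \<in> borel_measurable (fst \<mu>)" for k
      by (rule locfin_measurable[OF radon_locfin[OF \<mu>]]) measurable
  qed
qed

lemma nonneg_complex_limit:
  fixes z :: "nat \<Rightarrow> complex"
  assumes "z \<longlonglongrightarrow> l" "\<And>n. Im (z n) = 0 \<and> 0 \<le> Re (z n)"
  shows "Im l = 0 \<and> 0 \<le> Re l"
proof
  show "Im l = 0" using tendsto_Im[OF assms(1)] assms(2) by (simp add: LIMSEQ_const_iff)
  show "0 \<le> Re l" by (rule LIMSEQ_le_const[OF tendsto_Re[OF assms(1)]]) (use assms(2) in auto)
qed

lemma pos_def_limit:
  fixes \<mu>s :: "nat \<Rightarrow> 'a::euclidean_space cmeasure"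
  assumes \<mu>: "radon \<mu>" and pd: "\<And>n. pos_def (\<mu>s n)"
    and lim: "\<And>f. test f \<Longrightarrow> (\<lambda>n. cm_int (\<mu>s n) f) \<longlonglongrightarrow> cm_int \<mu> f"
  shows "pos_def \<mu>"
  unfolding pos_def_def
proof (intro allI impI)
  fix f :: "'a \<Rightarrow> complex" assume f: "Cc f"
  obtain F :: "nat \<Rightarrow> 'a \<Rightarrow> complex" and R B where F: "\<And>k. test (F k)" "\<And>x. (\<lambda>k. F k x) \<longlonglongrightarrow> f x"
    "\<And>k x. norm (F k x) \<le> B" "\<And>k x. R < norm x \<Longrightarrow> F k x = 0"
    using mollify[OF f] by metis
  have Fc: "Cc (F k)" for k using F(1) by blast
  have pos: "Im (cm_int \<mu> (conv (F k) (tilde (F k)))) = 0 \<and> 0 \<le> Re (cm_int \<mu> (conv (F k) (tilde (F k))))" for k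
    by (rule nonneg_complex_limit[OF lim[OF test_conv[OF F(1) Cc_tilde[OF Fc]]]])
      (use pd Fc in \<open>simp add: pos_def_def\<close>)
  show "Im (cm_int \<mu> (conv f (tilde f))) = 0 \<and> 0 \<le> Re (cm_int \<mu> (conv f (tilde f)))"
    by (rule nonneg_complex_limit[OF cm_int_conv_tilde_limit[where F=F and f=f, OF \<mu> Fc f F(2-4)] pos])
qed

subsection \<open>Polarization of the Fourier transform\<close>

lemma cm_integrable_add: "cm_integrable \<mu> f \<Longrightarrow> cm_integrable \<mu> g \<Longrightarrow> cm_integrable \<mu> (\<lambda>x. f x + g x)"
  and cm_integrable_diff: "cm_integrable \<mu> f \<Longrightarrow> cm_integrable \<mu> g \<Longrightarrow> cm_integrable \<mu> (\<lambda>x. f x - g x)"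
  and cm_integrable_scale: "cm_integrable \<mu> f \<Longrightarrow> cm_integrable \<mu> (\<lambda>x. c * f x)"
  by (simp_all add: cm_integrable_def ring_distribs mult.assoc)

text \<open>\<open>is_FT\<close> knows only the diagonal p = q. Polarization is applied to the
  integrand at each point y and to the integrals; integrability of the mixed product follows from
  that of its four squares.\<close>

lemma
  fixes p q :: "'a::euclidean_space \<Rightarrow> complex"
  assumes FT: "is_FT \<mu> \<nu>" and \<mu>: "radon \<mu>" and p: "Cc p" and q: "Cc q"
  shows FT_integrable: "cm_integrable \<nu> (\<lambda>y. icheck p y * cnj (icheck q y))"
    and FT_polarized: "cm_int \<mu> (conv p (tilde q)) = cm_int \<nu> (\<lambda>y. icheck p y * cnj (icheck q y))"
proof -
  let ?f = "\<lambda>c x. p x + c * q x"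
  define T where "T c y = complex_of_real ((cmod (icheck (?f c) y))\<^sup>2)" for c y
  define S where "S c = cm_int \<mu> (conv (?f c) (tilde (?f c)))" for c
  have f: "Cc (?f c)" for c by (intro Cc_add Cc_scale p q)
  have T: "cm_integrable \<nu> (T c)" and ST: "S c = cm_int \<nu> (T c)" for c
    using FT f[of c] unfolding is_FT_def S_def T_def by blast+
  have Teq: "T c y = icheck p y * cnj (icheck p y) + cnj c * (icheck p y * cnj (icheck q y))
     + c * (icheck q y * cnj (icheck p y)) + (norm c)\<^sup>2 * (icheck q y * cnj (icheck q y))" for c y
  proof -
    have "of_real ((norm c)\<^sup>2) = c * cnj c" by (rule complex_norm_square)
    then show ?thesis
      unfolding T_def icheck_add_scale[OF p q] complex_norm_square by (simp add: algebra_simps)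
  qed
  have eq: "icheck p y * cnj (icheck q y) = 1 / 4 * (T 1 y - T (-1) y + \<i> * T \<i> y - \<i> * T (- \<i>) y)" for y
    unfolding Teq polarization by simp
  show "cm_integrable \<nu> (\<lambda>y. icheck p y * cnj (icheck q y))"
    unfolding eq by (intro cm_integrable_add cm_integrable_diff cm_integrable_scale T)
  have "4 * cm_int \<mu> (conv p (tilde q)) = S 1 - S (-1) + \<i> * S \<i> - \<i> * S (- \<i>)"
    unfolding S_def cm_int_sesquilinear[OF \<mu> p q] by (rule polarization[symmetric])
  also have "\<dots> = cm_int \<nu> (\<lambda>y. T 1 y - T (-1) y + \<i> * T \<i> y - \<i> * T (- \<i>) y)"
    by (simp add: ST cm_int_add cm_int_diff cm_int_scale cm_integrable_add cm_integrable_diff cm_integrable_scale T)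
  finally show "cm_int \<mu> (conv p (tilde q)) = cm_int \<nu> (\<lambda>y. icheck p y * cnj (icheck q y))"
    unfolding eq cm_int_scale by (simp add: mult.commute)
qed

subsection \<open>Uniform approximation by Fourier transforms\<close>

lemma continuous_on_icheck:
  fixes p :: "'a::euclidean_space \<Rightarrow> complex"
  assumes p: "Cc p" shows "continuous_on UNIV (icheck p)"
proof -
  note [measurable] = Cc_borel[OF p]
  have "continuous_on UNIV (\<lambda>y. LINT x|lborel. p x * echar (- y) x)"
    by (rule continuous_on_integral_dominated[where w="\<lambda>x. norm (p x)"])
      (use integrable_Cc[OF locfin_lborel p] in \<open>auto simp: norm_mult intro!: continuous_intros\<close>)
  then show ?thesis by (simp add: icheck_echar[abs_def])
qed

text \<open>Its transform is the Fejer kernel (sin(pi v) / (pi v))^2, whose quadratic decay makes it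
  integrable.\<close>

definition tent :: "real \<Rightarrow> real" where
  "tent s = max 0 (1 - \<bar>s\<bar>)"

lemma Cc_tent: "Cc (\<lambda>s. complex_of_real (tent s))"
proof (rule CcI[where R=1])
  show "continuous_on UNIV (\<lambda>s. complex_of_real (tent s))"
    unfolding tent_def by (intro continuous_intros)
qed (simp add: tent_def)

lemma tent_bounds: "0 \<le> tent s" "tent s \<le> 1" "1 < \<bar>s\<bar> \<Longrightarrow> tent s = 0"
  by (auto simp: tent_def)

text \<open>Explicit antiderivatives on [-1, 0] and [0, 1]; they divide by c = 2 pi i v, so v = 0 is
  excluded. The boundary terms in 1 / c cancel between the halves.\<close>

lemma icheck_tent:
  assumes v: "v \<noteq> 0"
  shows "icheck (\<lambda>s. complex_of_real (tent s)) v = of_real ((1 - cos (2 * pi * v)) / (2 * pi\<^sup>2 * v\<^sup>2))"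
proof -
  define a where "a = 2 * pi * v"
  define c where "c = \<i> * complex_of_real a"
  have a: "a \<noteq> 0" and c: "c \<noteq> 0" using v by (auto simp: a_def c_def)
  let ?e = "\<lambda>s::real. exp (s *\<^sub>R c)"
  have e: "complex_of_real (tent s) * echar (- v) s = tent s *\<^sub>R ?e s" for s
    by (simp add: echar_def c_def a_def scaleR_conv_of_real mult_ac)
  have De: "(?e has_vector_derivative (?e s * c)) (at s within A)" for s A
    by (rule exp_scaleR_has_vector_derivative_right)
  have right: "(LINT s|lborel. indicator {0..1} s *\<^sub>R ((1 - s) *\<^sub>R ?e s)) =
      ((1 - 1) *\<^sub>R ?e 1 / c + ?e 1 / c\<^sup>2) - ((1 - 0) *\<^sub>R ?e 0 / c + ?e 0 / c\<^sup>2)"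
  proof (rule integral_FTC_atLeastAtMost)
    fix s :: real
    have "((\<lambda>s. (1 - s) *\<^sub>R ?e s) has_vector_derivative ((1 - s) *\<^sub>R (?e s * c) + (- 1) *\<^sub>R ?e s)) (at s within {0..1})"
      by (rule has_vector_derivative_scaleR[OF _ De]) (auto intro!: derivative_eq_intros)
    from has_vector_derivative_add[OF has_vector_derivative_divide[OF this, of c] has_vector_derivative_divide[OF De, of "c\<^sup>2"]]
    show "((\<lambda>s. (1 - s) *\<^sub>R ?e s / c + ?e s / c\<^sup>2) has_vector_derivative ((1 - s) *\<^sub>R ?e s)) (at s within {0..1})"
      by (rule has_vector_derivative_eq_rhs) (use c in \<open>simp add: field_simps power2_eq_square scaleR_conv_of_real\<close>)
  qed (auto intro!: continuous_intros)
  have left: "(LINT s|lborel. indicator {-1..0} s *\<^sub>R ((1 + s) *\<^sub>R ?e s)) =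
      ((1 + 0) *\<^sub>R ?e 0 / c - ?e 0 / c\<^sup>2) - ((1 + (-1)) *\<^sub>R ?e (-1) / c - ?e (-1) / c\<^sup>2)"
  proof (rule integral_FTC_atLeastAtMost)
    fix s :: real
    have "((\<lambda>s. (1 + s) *\<^sub>R ?e s) has_vector_derivative ((1 + s) *\<^sub>R (?e s * c) + 1 *\<^sub>R ?e s)) (at s within {-1..0})"
      by (rule has_vector_derivative_scaleR[OF _ De]) (auto intro!: derivative_eq_intros)
    from has_vector_derivative_diff[OF has_vector_derivative_divide[OF this, of c] has_vector_derivative_divide[OF De, of "c\<^sup>2"]]
    show "((\<lambda>s. (1 + s) *\<^sub>R ?e s / c - ?e s / c\<^sup>2) has_vector_derivative ((1 + s) *\<^sub>R ?e s)) (at s within {-1..0})"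
      by (rule has_vector_derivative_eq_rhs) (use c in \<open>simp add: field_simps power2_eq_square scaleR_conv_of_real\<close>)
  qed (auto intro!: continuous_intros)
  have i1: "integrable lborel (\<lambda>s. indicator {0..1} s *\<^sub>R ((1 - s) *\<^sub>R ?e s))"
    and i2: "integrable lborel (\<lambda>s. indicator {-1..0} s *\<^sub>R ((1 + s) *\<^sub>R ?e s))"
    by (intro borel_integrable_compact continuous_intros; simp)+
  have "icheck (\<lambda>s. complex_of_real (tent s)) v = (LINT s|lborel. tent s *\<^sub>R ?e s)"
    by (simp add: icheck_echar e)
  also have "\<dots> = (LINT s|lborel. indicator {0..1} s *\<^sub>R ((1 - s) *\<^sub>R ?e s) + indicator {-1..0} s *\<^sub>R ((1 + s) *\<^sub>R ?e s))"
  proof (rule integral_cong_AE)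
    \<comment> \<open>The closed intervals overlap at 0, where the right side counts the value
      twice; hence equality only almost everywhere.\<close>
    show "AE s in lborel. tent s *\<^sub>R ?e s =
        indicator {0..1} s *\<^sub>R ((1 - s) *\<^sub>R ?e s) + indicator {-1..0} s *\<^sub>R ((1 + s) *\<^sub>R ?e s)"
      using AE_lborel_singleton[of "0::real"]
      by eventually_elim (auto simp: tent_def indicator_def max_def)
    show "(\<lambda>s. tent s *\<^sub>R ?e s) \<in> borel_measurable lborel" unfolding tent_def by measurable
  qed (use i1 i2 in auto)
  also have "\<dots> = - (1 / c) - 1 / c\<^sup>2 + exp c / c\<^sup>2 + (1 / c - 1 / c\<^sup>2 + exp (- c) / c\<^sup>2)"
    unfolding Bochner_Integration.integral_add[OF i1 i2] right left by simp
  also have "\<dots> = (exp c + exp (- c) - 2) / c\<^sup>2" using c by (simp add: field_simps)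
  also have "exp c + exp (- c) = 2 * of_real (cos a)"
    by (simp add: c_def exp_Euler cos_of_real sin_of_real exp_minus_Euler flip: of_real_minus)
  also have "c\<^sup>2 = - of_real (a\<^sup>2)" by (simp add: c_def power_mult_distrib)
  finally have "icheck (\<lambda>s. complex_of_real (tent s)) v = of_real ((2 * cos a - 2) / (- a\<^sup>2))"
    by simp
  also have "(2 * cos a - 2) / (- a\<^sup>2) = (1 - cos (2 * pi * v)) / (2 * pi\<^sup>2 * v\<^sup>2)"
    using v by (simp add: a_def power_mult_distrib field_simps)
  finally show ?thesis .
qed

text \<open>The trivial bound A near 0 and the quadratic decay elsewhere combine to (A + 1) / (1 +
  v^2). The transform is real, nonnegative, continuous and not identically zero, so its integral is
  nonzero; the exact value would need Fourier inversion.\<close>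

lemma
  shows icheck_tent_integrable: "integrable lborel (icheck (\<lambda>s. complex_of_real (tent s)))"
    and icheck_tent_integral: "(LINT v|lborel. icheck (\<lambda>s. complex_of_real (tent s)) v) \<noteq> 0"
proof -
  let ?W = "icheck (\<lambda>s. complex_of_real (tent s))"
  have c: "continuous_on UNIV ?W" by (rule continuous_on_icheck[OF Cc_tent])
  define A where "A = (LINT s|lborel. tent s)"
  have W0: "?W 0 = of_real A" by (simp add: icheck_echar A_def)
  have A: "0 \<le> A" unfolding A_def by (rule Bochner_Integration.integral_nonneg) (simp add: tent_bounds)
  have nn: "0 \<le> Re (?W v)" for v
    by (cases "v = 0") (auto simp: W0 A icheck_tent)
  have im: "?W v = of_real (Re (?W v))" for v
    by (cases "v = 0") (simp_all add: W0 icheck_tent)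
  have le_A: "norm (?W v) \<le> A" for v
  proof -
    have "norm (?W v) \<le> (LINT s|lborel. norm (complex_of_real (tent s) * echar (- v) s))"
      unfolding icheck_echar by (rule integral_norm_bound)
    then show ?thesis by (simp add: norm_mult tent_bounds A_def)
  qed
  have "norm (?W v) * v\<^sup>2 \<le> 1" for v
  proof (cases "v = 0")
    case False
    have "1 \<le> pi\<^sup>2" using pi_gt3 by (intro one_le_power) simp
    have "norm (?W v) * v\<^sup>2 = (1 - cos (2 * pi * v)) / (2 * pi\<^sup>2)"
      using False by (simp add: icheck_tent norm_divide norm_mult norm_power abs_mult del: of_real_divide of_real_diff) 
    also have "\<dots> \<le> 2 / (2 * pi\<^sup>2)" by (intro divide_right_mono) auto
    also have "\<dots> \<le> 1" using \<open>1 \<le> pi\<^sup>2\<close> by simp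
    finally show ?thesis .
  qed simp
  then have *: "norm (?W v) * (1 + v\<^sup>2) \<le> A + 1" for v using le_A[of v] add_mono by (fastforce simp: ring_distribs)
  have "norm (?W v) \<le> (A + 1) * inverse (1 + v\<^sup>2)" for v
  proof -
    have "0 < 1 + v\<^sup>2" by (simp add: add_pos_nonneg)
    then show ?thesis using *[of v] by (simp add: field_simps)
  qed
  then show i: "integrable lborel ?W"
    using A by (intro Bochner_Integration.integrable_bound[OF integrable_mult_right[OF integrable_inverse_1_plus_square_lborel, of "A + 1"]])
      (auto intro!: borel_measurable_continuous_onI c)
  have "0 < (LINT v|lborel. Re (?W v))"
  proof (rule lborel_integral_pos)
    \<comment> \<open>At v = 1/2 the cosine equals -1, and the value is 4 / pi^2.\<close>
    show "0 < Re (?W (1 / 2))" by (simp add: icheck_tent)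
  qed (use i c nn in \<open>auto intro!: continuous_intros\<close>)
  then show "(LINT v|lborel. ?W v) \<noteq> 0"
    using integral_Re[OF i] by auto
qed

lemma echar_prod: "echar x y = (\<Prod>b\<in>Basis. echar (x \<bullet> b) (y \<bullet> b))"
  unfolding echar_def euclidean_inner[of x y]
  by (simp add: sum_distrib_left exp_sum)

text \<open>A tensor product of tents has the product of one-dimensional Fejer kernels as its
  transform. Dividing by the nonzero integral replaces its evaluation.\<close>

lemma summability_kernel:
  obtains w :: "'a::euclidean_space \<Rightarrow> complex" where "Cc w" "integrable lborel (icheck w)"
    "(LINT y|lborel. icheck w y) = 1"
proof -
  define w where "w x = (\<Prod>b\<in>Basis. complex_of_real (tent (x \<bullet> b)))" for x :: 'a
  let ?W = "icheck (\<lambda>s. complex_of_real (tent s))"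
  have w: "Cc w"
  proof (rule CcI)
    show "continuous_on UNIV w" unfolding w_def[abs_def] tent_def
      by (intro continuous_intros)
    fix x :: 'a assume "real DIM('a) * 1 < norm x"
    then obtain b where "b \<in> Basis" "1 < \<bar>x \<bullet> b\<bar>" using exists_coordinate_gt by blast
    then show "w x = 0" unfolding w_def using tent_bounds(3) by (auto intro!: prod_zero bexI[of _ b])
  qed
  have W: "icheck w y = (\<Prod>b\<in>Basis. ?W (y \<bullet> b))" for y :: 'a
  proof -
    have "icheck w y = (LINT x|lborel. (\<Prod>b\<in>Basis. complex_of_real (tent (x \<bullet> b)) * echar (- (y \<bullet> b)) (x \<bullet> b)))"
      unfolding icheck_echar w_def echar_prod[of "- y"] prod.distrib by simp
    also have "\<dots> = (\<Prod>b\<in>Basis. (LINT s|lborel. complex_of_real (tent s) * echar (- (y \<bullet> b)) s))"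
      by (rule integral_prod_coordinates[where f="\<lambda>b s. complex_of_real (tent s) * echar (- (y \<bullet> b)) s"]) (rule icheck_integrable[OF Cc_tent])
    finally show ?thesis by (simp add: icheck_echar)
  qed
  have i: "integrable lborel (icheck w)"
    unfolding W[abs_def] by (rule integrable_prod_coordinates[OF icheck_tent_integrable])
  have n0: "(LINT y|lborel. icheck w y) \<noteq> 0"
    unfolding W integral_prod_coordinates[OF icheck_tent_integrable] using icheck_tent_integral by simp
  define k where "k = 1 / (LINT y|lborel. icheck w y)"
  have k: "icheck (\<lambda>x. k * w x) = (\<lambda>y. k * icheck w y)"
    by (simp add: icheck_echar mult.assoc fun_eq_iff)
  show ?thesis
  proof (rule that[of "\<lambda>x. k * w x"])
    show "Cc (\<lambda>x. k * w x)" by (rule Cc_scale[OF w])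
    show "integrable lborel (icheck (\<lambda>x. k * w x))" unfolding k using i by simp
    show "(LINT y|lborel. icheck (\<lambda>x. k * w x) y) = 1" unfolding k using n0 by (simp add: k_def)
  qed
qed

lemma Cc_uniformly_continuous:
  fixes f :: "'a::euclidean_space \<Rightarrow> complex"
  assumes f: "Cc f" and e: "0 < e"
  obtains d where "0 < d" "\<And>x y. norm (x - y) < d \<Longrightarrow> norm (f x - f y) < e"
proof -
  obtain R where R: "\<And>x. R < norm x \<Longrightarrow> f x = 0" using f by (metis CcE)
  have "uniformly_continuous_on (cball 0 (R + 1)) f"
    by (intro compact_uniformly_continuous continuous_on_subset[OF Cc_continuous[OF f]]) auto
  then obtain d where d: "0 < d" "\<And>x y. norm x \<le> R + 1 \<Longrightarrow> norm y \<le> R + 1 \<Longrightarrow> norm (x - y) < d \<Longrightarrow> norm (f x - f y) < e"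
    unfolding uniformly_continuous_on_def using e by (auto simp: dist_norm norm_minus_commute)
  show ?thesis
  proof (rule that[of "min d 1"])
    show "0 < min d 1" using d(1) by simp
    fix x y :: 'a assume xy: "norm (x - y) < min d 1"
    show "norm (f x - f y) < e"
    proof (cases "norm x \<le> R + 1 \<and> norm y \<le> R + 1")
      case True
      then show ?thesis using d(2) xy by simp
    next
      case False
      moreover have "norm x \<le> norm y + norm (x - y)" "norm y \<le> norm x + norm (x - y)"
        using norm_triangle_ineq[of y "x - y"] norm_triangle_ineq[of x "y - x"] by (simp_all add: norm_minus_commute)
      ultimately have "R < norm x" "R < norm y" using xy by linarith+
      then show ?thesis using R e by simp
    qed
  qed
qed


section \<open>Fejer summation\<close>

lemma icheck_dilate:
  fixes w :: "'a::euclidean_space \<Rightarrow> complex"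
  assumes w: "Cc w" and r: "0 < r"
  shows "icheck (\<lambda>x. w (r *\<^sub>R x)) y = (1 / r ^ DIM('a)) *\<^sub>R icheck w ((1 / r) *\<^sub>R y)"
proof -
  note [measurable] = Cc_borel[OF w]
  have "echar (- y) x = echar (- ((1 / r) *\<^sub>R y)) (r *\<^sub>R x)" for x
    using r by (simp add: echar_def)
  then have "icheck (\<lambda>x. w (r *\<^sub>R x)) y =
      (LINT x|lborel. (\<lambda>x. w x * echar (- ((1 / r) *\<^sub>R y)) x) (0 + r *\<^sub>R x))"
    by (simp add: icheck_echar)
  also have "\<dots> = (1 / \<bar>r\<bar> ^ DIM('a)) *\<^sub>R icheck w ((1 / r) *\<^sub>R y)"
    unfolding icheck_echar by (rule lborel_integral_affine) (use r in auto)
  finally show ?thesis using r by simp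
qed

text \<open>The function q is the transform of g with the opposite sign, cut off by w(r x) to have
  compact support. Transforming back averages g at scale r against \<open>icheck w\<close>, which
  recovers g as r tends to 0.\<close>

lemma
  fixes g w :: "'a::euclidean_space \<Rightarrow> complex"
  assumes g: "Cc g" and w: "Cc w" and r: "0 < r"
  defines "q \<equiv> \<lambda>x. (LINT y|lborel. g y * echar x y) * w (r *\<^sub>R x)"
  shows Cc_summation: "Cc q"
    and icheck_summation: "icheck q z = (LINT v|lborel. g (z - r *\<^sub>R v) * icheck w v)"
proof -
  note [measurable] = Cc_borel[OF g] Cc_borel[OF w]
  have wr: "Cc (\<lambda>x. w (r *\<^sub>R x))"
  proof -
    obtain S where S: "\<And>x. S < norm x \<Longrightarrow> w x = 0" using w by (metis CcE)
    show ?thesis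
    proof (rule CcI[where R="S / r"])
      show "continuous_on UNIV (\<lambda>x. w (r *\<^sub>R x))"
        by (rule continuous_on_compose2[OF Cc_continuous[OF w]]) (auto intro!: continuous_intros)
      show "w (r *\<^sub>R x) = 0" if "S / r < norm x" for x
        using that r by (intro S) (simp add: field_simps)
    qed
  qed
  note [measurable] = Cc_borel[OF wr]
  have "continuous_on UNIV (\<lambda>x. LINT y|lborel. g y * echar x y)"
    by (rule continuous_on_integral_dominated[where w="\<lambda>y. norm (g y)"])
      (use integrable_Cc[OF locfin_lborel g] in \<open>auto simp: norm_mult intro!: continuous_intros\<close>)
  then show q: "Cc q" unfolding q_def by (rule Cc_mult_left[OF wr])
  obtain R B where R: "\<And>x. R < norm x \<Longrightarrow> g x = 0" and B: "\<And>x. norm (g x) \<le> B" "0 < B" using g by (metis CcE)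
  obtain S C where S: "\<And>x. S < norm x \<Longrightarrow> w (r *\<^sub>R x) = 0" and C: "\<And>x. norm (w (r *\<^sub>R x)) \<le> C" "0 < C"
    using CcE[OF wr] by metis
  let ?F = "\<lambda>x y. g y * echar x y * w (r *\<^sub>R x) * echar (- z) x"
  have "icheck q z = (LINT x|lborel. LINT y|lborel. ?F x y)"
    by (simp add: icheck_echar q_def)
  also have "\<dots> = (LINT y|lborel. LINT x|lborel. ?F x y)"
  proof (rule fubini_bounded_support[OF locfin_lborel locfin_lborel])
    show "norm (?F x y) \<le> B * C" for x y
      using B C by (auto simp: norm_mult intro!: mult_mono)
  qed (use R S in auto)
  also have "\<dots> = (LINT y|lborel. g y * icheck (\<lambda>x. w (r *\<^sub>R x)) (z - y))"
  proof (intro Bochner_Integration.integral_cong refl)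
    fix y
    have "echar x y * echar (- z) x = echar (- (z - y)) x" for x
      using echar_add(2)[of y "- z" x] by (simp add: echar_def inner_commute)
    then have "?F x y = g y * (w (r *\<^sub>R x) * echar (- (z - y)) x)" for x
      by (metis mult.assoc mult.commute)
    then show "(LINT x|lborel. ?F x y) = g y * icheck (\<lambda>x. w (r *\<^sub>R x)) (z - y)"
      unfolding icheck_echar by (simp only: integral_mult_right_zero)
  qed
  also have "\<dots> = (LINT y|lborel. (1 / r ^ DIM('a)) *\<^sub>R (g y * icheck w ((1 / r) *\<^sub>R (z - y))))"
    unfolding icheck_dilate[OF w r] by simp
  \<comment> \<open>Prepares the substitution y = z - r v, an affine map with factor -r.\<close>
  also have "\<dots> = (1 / \<bar>- r\<bar> ^ DIM('a)) *\<^sub>R (LINT y|lborel. g y * icheck w ((1 / r) *\<^sub>R (z - y)))"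
    using r by simp
  also have "\<dots> = (LINT v|lborel. (\<lambda>y. g y * icheck w ((1 / r) *\<^sub>R (z - y))) (z + (- r) *\<^sub>R v))"
  proof (rule lborel_integral_affine[symmetric])
    have [measurable]: "icheck w \<in> borel_measurable borel"
      by (intro borel_measurable_continuous_onI continuous_on_icheck w)
    show "(\<lambda>y. g y * icheck w ((1 / r) *\<^sub>R (z - y))) \<in> borel_measurable borel" by measurable
  qed (use r in simp)
  finally show "icheck q z = (LINT v|lborel. g (z - r *\<^sub>R v) * icheck w v)"
    using r by simp
qed

text \<open>The averages over \<open>icheck w\<close> form an approximate identity. Uniform
  continuity of g bounds the contribution of small v by e / 2; for large v the oscillation is at
  most 2 B and the kernel has mass at most e / (4 B).\<close>

theorem icheck_dense:
  fixes g :: "'a::euclidean_space \<Rightarrow> complex"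
  assumes g: "Cc g" and e: "0 < e"
  obtains q where "Cc q" "\<And>z. norm (icheck q z - g z) \<le> e"
proof -
  obtain w :: "'a \<Rightarrow> complex" where w: "Cc w" and i: "integrable lborel (icheck w)" and w1: "(LINT y|lborel. icheck w y) = 1"
    by (rule summability_kernel)
  obtain B where B: "\<And>x. norm (g x) \<le> B" "0 < B" using g by (metis CcE)
  let ?W = "\<lambda>v. norm (icheck w v)"
  have iW: "integrable lborel ?W" using i by simp
  note [measurable] = Cc_borel[OF g] borel_measurable_integrable[OF i, simplified]
  \<comment> \<open>The summand 1 makes A positive without a lower bound on the mass of the
    kernel.\<close>
  define A where "A = (LINT v|lborel. ?W v) + 1"
  have A: "0 < A" "(LINT v|lborel. ?W v) \<le> A"
    unfolding A_def by (auto intro: add_nonneg_pos Bochner_Integration.integral_nonneg)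
  obtain d where d: "0 < d" "\<And>x y. norm (x - y) < d \<Longrightarrow> norm (g x - g y) < e / (2 * A)"
    using Cc_uniformly_continuous[OF g, of "e / (2 * A)"] e A by (auto simp: divide_pos_pos)
  \<comment> \<open>The tail of the kernel beyond n d. With r = 1 / n, a vector v of norm below n d
    moves the argument of g by less than d.\<close>
  let ?T = "\<lambda>n v. indicator {v. real n * d \<le> norm v} v * ?W v"
  have "(\<lambda>n. LINT v|lborel. ?T n v) \<longlonglongrightarrow> (LINT v|(lborel :: 'a measure). (0 :: real))"
  proof (rule integral_dominated_convergence[where w="?W"])
    show "AE v in lborel. (\<lambda>n. ?T n v) \<longlonglongrightarrow> 0"
    proof (rule AE_I2)
      fix v :: 'a
      obtain N where N: "norm v < real N * d" using d(1) reals_Archimedean3 by blast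
      have "?T n v = 0" if "N \<le> n" for n
      proof -
        have "real N * d \<le> real n * d" using that d(1) by (intro mult_right_mono) auto
        then show ?thesis using N by (auto simp: indicator_def)
      qed
      then show "(\<lambda>n. ?T n v) \<longlonglongrightarrow> 0"
        by (intro tendsto_eventually eventually_sequentiallyI[of N])
    qed
  qed (use iW in \<open>auto simp: indicator_def\<close>)
  then have "\<forall>\<^sub>F n in sequentially. (LINT v|lborel. ?T n v) < e / (4 * B)"
    using e B by (intro order_tendstoD(2)) auto
  then obtain N where N: "\<And>n. N \<le> n \<Longrightarrow> (LINT v|lborel. ?T n v) < e / (4 * B)"
    unfolding eventually_sequentially by blast
  define n where "n = Suc N"
  have n: "0 < n" "(LINT v|lborel. ?T n v) \<le> e / (4 * B)" using N[of n] by (auto simp: n_def)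
  define r where "r = 1 / real n"
  have r: "0 < r" using n by (simp add: r_def)
  define q where "q x = (LINT y|lborel. g y * echar x y) * w (r *\<^sub>R x)" for x
  have q: "Cc q" "\<And>z. icheck q z = (LINT v|lborel. g (z - r *\<^sub>R v) * icheck w v)"
    using Cc_summation[OF g w r] icheck_summation[OF g w r] unfolding q_def[abs_def] by auto
  have iT: "integrable lborel (?T n)"
    by (rule Bochner_Integration.integrable_bound[OF iW]) (auto simp: indicator_def)
  have "norm (icheck q z - g z) \<le> e" for z
  proof -
    have i1: "integrable lborel (\<lambda>v. g (z - r *\<^sub>R v) * icheck w v)"
      by (rule Bochner_Integration.integrable_bound[OF integrable_mult_right[OF iW, of B]])
        (use B in \<open>auto simp: norm_mult intro!: mult_right_mono AE_I2\<close>)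
    have i2: "integrable lborel (\<lambda>v. g z * icheck w v)" using i by simp
    have "icheck q z - g z = (LINT v|lborel. g (z - r *\<^sub>R v) * icheck w v) - (LINT v|lborel. g z * icheck w v)"
      by (simp add: q w1)
    also have "\<dots> = (LINT v|lborel. g (z - r *\<^sub>R v) * icheck w v - g z * icheck w v)"
      by (rule Bochner_Integration.integral_diff[OF i1 i2, symmetric])
    also have "norm \<dots> \<le> (LINT v|lborel. e / (2 * A) * ?W v + 2 * B * ?T n v)"
    proof (rule Bochner_Integration.integral_norm_bound_integral)
      fix v :: 'a
      have "norm (g (z - r *\<^sub>R v) - g z) \<le> e / (2 * A) + 2 * B * indicator {v. real n * d \<le> norm v} v"
      proof (cases "real n * d \<le> norm v")
        case True
        have "norm (g (z - r *\<^sub>R v) - g z) \<le> B + B" by (rule norm_triangle_le_diff[OF add_mono[OF B(1) B(1)]])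
        then show ?thesis using True e A by (simp add: add_increasing)
      next
        case False
        then have "norm ((z - r *\<^sub>R v) - z) < d" using n(1) by (simp add: r_def field_simps)
        from d(2)[OF this] show ?thesis using False by simp
      qed
      then have "norm (g (z - r *\<^sub>R v) - g z) * ?W v \<le> (e / (2 * A) + 2 * B * indicator {v. real n * d \<le> norm v} v) * ?W v"
        by (rule mult_right_mono) simp
      then show "norm (g (z - r *\<^sub>R v) * icheck w v - g z * icheck w v) \<le> e / (2 * A) * ?W v + 2 * B * ?T n v"
        by (simp add: norm_mult[symmetric] ring_distribs mult.assoc)
    qed (use i1 i2 iW iT in auto)
    also have "\<dots> = e / (2 * A) * (LINT v|lborel. ?W v) + 2 * B * (LINT v|lborel. ?T n v)"
      using iW iT by simp
    also have "\<dots> \<le> e / (2 * A) * A + 2 * B * (e / (4 * B))"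
      using A B e n(2) by (intro add_mono mult_left_mono) auto
    also have "\<dots> = e" using A B by simp
    finally show ?thesis .
  qed
  with q(1) show ?thesis by (rule that)
qed

subsection \<open>Positivity of the Fourier transform\<close>

lemma exists_test_icheck_nonzero:
  obtains h :: "'a::euclidean_space \<Rightarrow> complex" where "test h" "\<And>y. norm y \<le> R \<Longrightarrow> icheck h y \<noteq> 0"
proof -
  \<comment> \<open>For norm y \<le> R and norm x \<le> r the phase 2 pi |y x| is at most pi / 3,
    where the cosine is at least 1/2. A bump supported there has a transform with positive real
    part.\<close>
  define r where "r = 1 / (6 * (\<bar>R\<bar> + 1))"
  have r: "0 < r" by (simp add: r_def add_nonneg_pos)
  obtain h :: "'a \<Rightarrow> real" where h: "test (\<lambda>x. of_real (h x))" "\<And>x. 0 \<le> h x"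
    "\<And>x. r < norm x \<Longrightarrow> h x = 0" "0 < (LINT x|lborel. h x)" using bump_exists[OF r] by metis
  let ?h = "\<lambda>x. complex_of_real (h x)"
  have c: "Cc ?h" using h(1) by blast
  show ?thesis
  proof (rule that[OF h(1)])
    fix y :: 'a assume y: "norm y \<le> R"
    have i: "integrable lborel (\<lambda>x. ?h x * echar (- y) x)" by (rule icheck_integrable[OF c])
    have "(LINT x|lborel. 1 / 2 * h x) \<le> (LINT x|lborel. Re (?h x * echar (- y) x))"
    proof (rule integral_mono)
      show "integrable lborel (\<lambda>x. 1 / 2 * h x)"
        using integrable_Re[OF integrable_Cc[OF locfin_lborel c]] by simp
      show "integrable lborel (\<lambda>x. Re (?h x * echar (- y) x))" by (rule integrable_Re[OF i])
      fix x :: 'a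
      show "1 / 2 * h x \<le> Re (?h x * echar (- y) x)"
      proof (cases "r < norm x")
        case False
        have "\<bar>y \<bullet> x\<bar> \<le> norm y * norm x" by (rule Cauchy_Schwarz_ineq2)
        also have "\<dots> \<le> (\<bar>R\<bar> + 1) * r" using y False by (intro mult_mono) auto
        also have "\<dots> = 1 / 6" by (simp add: r_def field_simps add_nonneg_pos less_imp_neq[THEN not_sym])
        finally have "2 * pi * \<bar>y \<bullet> x\<bar> \<le> 2 * pi * (1 / 6)" by (intro mult_left_mono) auto
        then have "cos (pi / 3) \<le> cos (2 * pi * \<bar>y \<bullet> x\<bar>)"
          by (intro cos_monotone_0_pi_le) auto
        also have "cos (2 * pi * \<bar>y \<bullet> x\<bar>) = cos (2 * pi * (y \<bullet> x))"
          by (cases "0 \<le> y \<bullet> x") (simp_all add: abs_if)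
        finally have "h x * (1 / 2) \<le> h x * cos (2 * pi * (y \<bullet> x))"
          using h(2) by (intro mult_left_mono) (auto simp: cos_60)
        then show ?thesis by (simp add: echar_cis)
      qed (simp add: h(3))
    qed
    also have "\<dots> = Re (icheck ?h y)" unfolding icheck_echar by (rule integral_Re[OF i])
    finally have "0 < Re (icheck ?h y)" using h(4) by simp
    then show "icheck ?h y \<noteq> 0" by auto
  qed
qed

text \<open>Outside the ball k may vanish, so continuity of the quotient is not evident. Replacing
  |k|^2 in the denominator by its maximum with the minimum c of |k|^2 over the ball gives a function
  that is continuous everywhere; it agrees with the quotient because u is 0 outside.\<close>

lemma Cc_divide:
  fixes u k :: "'a::euclidean_space \<Rightarrow> complex"
  assumes u: "Cc u" and R: "0 < R" "\<And>x. R < norm x \<Longrightarrow> u x = 0"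
    and k: "continuous_on UNIV k" "\<And>x. norm x \<le> R \<Longrightarrow> k x \<noteq> 0"
  shows "Cc (\<lambda>x. u x / k x)"
proof -
  have "\<exists>x\<in>cball 0 R. \<forall>y\<in>cball 0 R. (norm (k x))\<^sup>2 \<le> (norm (k y))\<^sup>2"
    using R(1) by (intro continuous_attains_inf continuous_intros continuous_on_subset[OF k(1)]) auto
  then obtain x0 where x0: "norm x0 \<le> R" "\<And>y. norm y \<le> R \<Longrightarrow> (norm (k x0))\<^sup>2 \<le> (norm (k y))\<^sup>2" by auto
  define c where "c = (norm (k x0))\<^sup>2"
  have c: "0 < c" using k(2)[OF x0(1)] by (simp add: c_def)
  have "u x / k x = u x * (cnj (k x) / of_real (max c ((norm (k x))\<^sup>2)))" for x
  proof (cases "norm x \<le> R")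
    case True
    have "complex_of_real ((norm (k x))\<^sup>2) = k x * cnj (k x)" by (rule complex_norm_square)
    then show ?thesis using x0(2)[OF True] k(2)[OF True] by (simp add: c_def max_def)
  qed (simp add: R(2))
  moreover have "max c ((norm (k x))\<^sup>2) \<noteq> 0" for x using c by (auto simp: max_def)
  then have "Cc (\<lambda>x. u x * (cnj (k x) / of_real (max c ((norm (k x))\<^sup>2))))"
    by (intro Cc_mult_right[OF u] continuous_intros k(1)) (auto simp only: of_real_eq_0_iff)
  ultimately show ?thesis by simp
qed

lemma FT_square_integrable:
  assumes FT: "is_FT \<mu> \<nu>" and h: "Cc h"
  shows "integrable (fst \<nu>) (\<lambda>y. (cmod (icheck h y))\<^sup>2)"
proof -
  have \<nu>: "radon \<nu>" and "cm_integrable \<nu> (\<lambda>y. of_real ((cmod (icheck h y))\<^sup>2))"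
    using FT h unfolding is_FT_def by blast+
  from integrable_norm[OF this(2)[unfolded cm_integrable_def]] show ?thesis
    by (simp add: norm_mult norm_power radon_density_norm[OF \<nu>])
qed

text \<open>With sqrt g = k g1 and the transforms of q_m tending to g1 uniformly, g is the limit of
  |(h * q_m)^|^2, and the \<nu>-integrals of these are values of \<mu> on squares. The factor k
  supplies the \<nu>-integrable majorant (B + 1)^2 |k|^2.\<close>

lemma FT_nonneg_Cc:
  fixes g :: "'a::euclidean_space \<Rightarrow> real"
  assumes FT: "is_FT \<mu> \<nu>" and pd: "pos_def \<mu>"
    and g: "Cc (\<lambda>x. complex_of_real (g x))" and nn: "\<And>x. 0 \<le> g x"
  shows "Im (cm_int \<nu> (\<lambda>x. of_real (g x))) = 0 \<and> 0 \<le> Re (cm_int \<nu> (\<lambda>x. of_real (g x)))"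
proof -
  have \<nu>: "radon \<nu>" using FT by (simp add: is_FT_def)
  define u where "u x = complex_of_real (sqrt (g x))" for x
  have gc: "continuous_on UNIV g" using continuous_on_Re[OF Cc_continuous[OF g]] by simp
  obtain R where R: "0 < R" "\<And>x. R < norm x \<Longrightarrow> g x = 0" using CcE[OF g] by (metis of_real_eq_0_iff)
  have u: "Cc u" unfolding u_def[abs_def]
    by (rule CcI[where R=R]) (auto simp: R intro!: continuous_intros gc)
  obtain h :: "'a \<Rightarrow> complex" where h: "test h" "\<And>y. norm y \<le> R \<Longrightarrow> icheck h y \<noteq> 0"
    using exists_test_icheck_nonzero by metis
  then have hc: "Cc h" by blast
  define k where "k = icheck h"
  have k: "continuous_on UNIV k" unfolding k_def by (rule continuous_on_icheck[OF hc])
  define g1 where "g1 x = u x / k x" for x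
  have g1: "Cc g1" unfolding g1_def[abs_def]
    by (rule Cc_divide[OF u R(1) _ k]) (auto simp: u_def R(2) k_def h(2))
  have kg1: "k x * g1 x = u x" for x
    using h(2)[of x] R(2)[of x] by (cases "norm x \<le> R") (auto simp: g1_def k_def u_def)
  obtain B where B: "\<And>x. norm (g1 x) \<le> B" "0 < B" using g1 by (metis CcE)
  have "\<exists>q. Cc q \<and> (\<forall>z. norm (icheck q z - g1 z) \<le> 1 / real (Suc m))" for m
    using icheck_dense[OF g1, of "1 / real (Suc m)"] by (metis divide_pos_pos of_nat_0_less_iff zero_less_Suc zero_less_one)
  then obtain q where q: "\<And>m. Cc (q m)" "\<And>m z. norm (icheck (q m) z - g1 z) \<le> 1 / real (Suc m)" by metis
  define s where "s m y = complex_of_real ((cmod (icheck (conv h (q m)) y))\<^sup>2)" for m y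
  have s: "s m y = of_real ((cmod (k y * icheck (q m) y))\<^sup>2)" for m y
    by (simp add: s_def icheck_conv hc q k_def)
  have pos: "Im (cm_int \<nu> (s m)) = 0 \<and> 0 \<le> Re (cm_int \<nu> (s m))" for m
  proof -
    have f: "Cc (conv h (q m))" by (rule Cc_conv[OF hc q(1)])
    then have "cm_int \<mu> (conv (conv h (q m)) (tilde (conv h (q m)))) = cm_int \<nu> (s m)"
      using FT unfolding is_FT_def s_def by blast
    then show ?thesis using pd f unfolding pos_def_def by metis
  qed
  have bound: "norm (icheck (q m) y) \<le> B + 1" for m y
  proof -
    have "1 / real (Suc m) \<le> 1" by simp
    then show ?thesis using norm_triangle_sub[of "icheck (q m) y" "g1 y"] q(2)[of m y] B(1)[of y] by linarith
  qed
  have [measurable]: "k \<in> borel_measurable borel" "\<And>m. icheck (q m) \<in> borel_measurable borel" "g \<in> borel_measurable borel"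
    by (intro borel_measurable_continuous_onI k gc continuous_on_icheck q)+
  note [measurable] = radon_density_borel[OF \<nu>]
  have "(\<lambda>m. cm_int \<nu> (s m)) \<longlonglongrightarrow> cm_int \<nu> (\<lambda>x. of_real (g x))"
    unfolding cm_int_def
  proof (rule integral_dominated_convergence[where w="\<lambda>y. (B + 1)\<^sup>2 * (cmod (k y))\<^sup>2"])
    show "integrable (fst \<nu>) (\<lambda>y. (B + 1)\<^sup>2 * (cmod (k y))\<^sup>2)"
      using FT_square_integrable[OF FT hc] by (simp add: k_def)
    show "AE y in fst \<nu>. (\<lambda>m. s m y * snd \<nu> y) \<longlonglongrightarrow> of_real (g y) * snd \<nu> y"
    proof (rule AE_I2)
      fix y
      have "(\<lambda>m. icheck (q m) y - g1 y) \<longlonglongrightarrow> 0"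
        by (rule Lim_null_comparison[OF always_eventually LIMSEQ_inverse_real_of_nat])
          (use q(2) in \<open>simp add: inverse_eq_divide\<close>)
      then have "(\<lambda>m. icheck (q m) y) \<longlonglongrightarrow> g1 y" by (simp add: LIM_zero_iff)
      then have "(\<lambda>m. s m y * snd \<nu> y) \<longlonglongrightarrow> of_real ((cmod (k y * g1 y))\<^sup>2) * snd \<nu> y"
        unfolding s by (intro tendsto_intros)
      then show "(\<lambda>m. s m y * snd \<nu> y) \<longlonglongrightarrow> of_real (g y) * snd \<nu> y"
        using nn[of y] by (simp add: kg1 u_def)
    qed
    show "AE y in fst \<nu>. norm (s m y * snd \<nu> y) \<le> (B + 1)\<^sup>2 * (cmod (k y))\<^sup>2" for m
    proof (rule AE_I2)
      fix y
      have "(cmod (k y) * norm (icheck (q m) y))\<^sup>2 \<le> (cmod (k y) * (B + 1))\<^sup>2"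
        by (intro power_mono mult_left_mono bound) auto
      then show "norm (s m y * snd \<nu> y) \<le> (B + 1)\<^sup>2 * (cmod (k y))\<^sup>2"
        unfolding s norm_mult radon_density_norm[OF \<nu>] norm_of_real abs_power2
        by (simp add: norm_mult power_mult_distrib mult.commute)
    qed
    show "(\<lambda>y. of_real (g y) * snd \<nu> y) \<in> borel_measurable (fst \<nu>)"
      by (rule locfin_measurable[OF radon_locfin[OF \<nu>]]) measurable
    show "(\<lambda>y. s m y * snd \<nu> y) \<in> borel_measurable (fst \<nu>)" for m
      unfolding s by (rule locfin_measurable[OF radon_locfin[OF \<nu>]]) measurable
  qed
  then show ?thesis by (rule nonneg_complex_limit[OF _ pos])
qed

text \<open>The functions min(1, n d), with d the distance to the complement of U, lie in C_c and
  tend to the indicator of U under the majorant 1 on a ball.\<close>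

lemma FT_nonneg_open:
  fixes U :: "'a::euclidean_space set"
  assumes FT: "is_FT \<mu> \<nu>" and pd: "pos_def \<mu>" and U: "open U" "U \<subseteq> ball 0 R"
  shows "Im (cm_int \<nu> (indicator U)) = 0 \<and> 0 \<le> Re (cm_int \<nu> (indicator U))"
proof -
  have \<nu>: "radon \<nu>" using FT by (simp add: is_FT_def)
  note [measurable] = radon_density_borel[OF \<nu>] borel_open[OF U(1)]
  \<comment> \<open>The distance to the empty set is 0 by convention, which would spoil the
    approximating functions; boundedness of U excludes this case.\<close>
  have ne: "- U \<noteq> {}"
  proof
    assume "- U = {}"
    then have "bounded (UNIV :: 'a set)" using U(2) bounded_subset[OF bounded_ball] by (metis Compl_empty_eq double_compl)
    then show False using not_bounded_UNIV by blast
  qed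
  define d where "d x = infdist x (- U)" for x
  have d: "0 \<le> d x" "d x = 0 \<longleftrightarrow> x \<notin> U" for x
    using in_closed_iff_infdist_zero[of "- U" x] U(1) ne by (auto simp: d_def infdist_nonneg closed_Compl)
  define g where "g n x = min 1 (real n * d x)" for n x
  have g: "0 \<le> g n x" "g n x \<le> 1" "x \<notin> U \<Longrightarrow> g n x = 0" for n x
    using d[of x] by (auto simp: g_def)
  have gc: "continuous_on UNIV (g n)" for n
    unfolding g_def[abs_def] d_def by (intro continuous_intros)
  have Cg: "Cc (\<lambda>x. complex_of_real (g n x))" for n
  proof (rule CcI[where R=R])
    show "continuous_on UNIV (\<lambda>x. complex_of_real (g n x))" by (intro continuous_on_of_real gc)
    fix x :: 'a assume "R < norm x"
    then have "x \<notin> U" using U(2) by auto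
    then show "complex_of_real (g n x) = 0" by (simp add: g(3))
  qed
  have [measurable]: "\<And>n. g n \<in> borel_measurable borel"
    by (intro borel_measurable_continuous_onI gc)
  have "(\<lambda>n. cm_int \<nu> (\<lambda>x. of_real (g n x))) \<longlonglongrightarrow> cm_int \<nu> (indicator U)"
    unfolding cm_int_def
  proof (rule integral_dominated_convergence[where w="indicator (cball 0 R)"])
    show "integrable (fst \<nu>) (indicator (cball 0 R) :: 'a \<Rightarrow> real)"
      using radon_locfin[OF \<nu>] by (intro integrable_real_indicator) (auto simp: locfin_def)
    show "AE x in fst \<nu>. (\<lambda>n. of_real (g n x) * snd \<nu> x) \<longlonglongrightarrow> indicator U x * snd \<nu> x"
    proof (rule AE_I2)
      fix x
      have "(\<lambda>n. g n x) \<longlonglongrightarrow> indicator U x"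
      proof (cases "x \<in> U")
        case True
        then have "0 < d x" using d[of x] by auto
        then obtain N where N: "1 < real N * d x" using reals_Archimedean3 by blast
        have "g n x = 1" if "N \<le> n" for n
        proof -
          have "real N * d x \<le> real n * d x" using that d(1) by (intro mult_right_mono) auto
          then show ?thesis using N by (simp add: g_def)
        qed
        then show ?thesis using True by (intro tendsto_eventually eventually_sequentiallyI[of N]) auto
      qed (simp add: g(3))
      then have "(\<lambda>n. complex_of_real (g n x) * snd \<nu> x) \<longlonglongrightarrow> of_real (indicator U x) * snd \<nu> x"
        by (intro tendsto_intros)
      then show "(\<lambda>n. of_real (g n x) * snd \<nu> x) \<longlonglongrightarrow> indicator U x * snd \<nu> x"
        by (simp add: of_real_indicator)
    qed
    show "AE x in fst \<nu>. norm (of_real (g n x) * snd \<nu> x) \<le> indicator (cball 0 R) x" for n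
    proof (rule AE_I2)
      fix x
      show "norm (of_real (g n x) * snd \<nu> x) \<le> indicator (cball 0 R) x"
        using g(1,2)[of n x] g(3)[of x n] U(2) by (cases "x \<in> U") (auto simp: norm_mult radon_density_norm[OF \<nu>] indicator_def)
    qed
    show "(\<lambda>x. indicator U x * snd \<nu> x) \<in> borel_measurable (fst \<nu>)"
      by (rule locfin_measurable[OF radon_locfin[OF \<nu>]]) measurable
    show "(\<lambda>x. of_real (g n x) * snd \<nu> x) \<in> borel_measurable (fst \<nu>)" for n
      by (rule locfin_measurable[OF radon_locfin[OF \<nu>]]) measurable
  qed
  then show ?thesis
    by (rule nonneg_complex_limit) (use FT_nonneg_Cc[OF FT pd Cg g(1)] in blast)
qed

text \<open>Outer regularity of the variation measure makes open supersets V_n of A with measure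
  tending to that of A, and the density has modulus one, so the complex integrals over V_n converge
  as well.\<close>

lemma FT_nonneg_borel:
  fixes A :: "'a::euclidean_space set"
  assumes FT: "is_FT \<mu> \<nu>" and pd: "pos_def \<mu>" and A: "A \<in> sets borel" "A \<subseteq> ball 0 R"
  shows "Im (cm_int \<nu> (indicator A)) = 0 \<and> 0 \<le> Re (cm_int \<nu> (indicator A))"
proof -
  have \<nu>: "radon \<nu>" using FT by (simp add: is_FT_def)
  define M where "M = fst \<nu>"
  have M: "locfin M" unfolding M_def by (rule radon_locfin[OF \<nu>])
  have sM: "sets M = sets borel" using M by (simp add: locfin_def)
  note [measurable] = radon_density_borel[OF \<nu>] A(1)
  have fin: "emeasure M B \<noteq> \<infinity>" if "B \<in> sets borel" "B \<subseteq> ball 0 R" for B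
  proof -
    have "emeasure M B \<le> emeasure M (cball 0 R)" using that sM by (intro emeasure_mono) auto
    also have "\<dots> < \<infinity>" using M by (auto simp: locfin_def)
    finally show ?thesis by simp
  qed
  \<comment> \<open>The regularity theorem is applied to a finite measure, so M is first restricted
    to the ball; intersecting the open sets with that open ball keeps them open and of finite
    M-measure.\<close>
  define N where "N = density M (indicator (ball 0 R))"
  have N: "emeasure N B = emeasure M (ball 0 R \<inter> B)" if "B \<in> sets borel" for B
  proof -
    have [measurable]: "indicator (ball 0 R) \<in> borel_measurable M" by (rule locfin_measurable[OF M]) (auto intro!: borel_measurable_indicator)
    show ?thesis unfolding N_def using that sM
      by (subst emeasure_density) (auto simp: indicator_inter_arith[symmetric])
  qed
  have sN: "sets N = sets borel" by (simp add: N_def sM)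
  have spN: "space N = UNIV" using sets_eq_imp_space_eq[OF sN] by simp
  have Nfin: "emeasure N (space N) \<noteq> \<infinity>" unfolding spN using N[of UNIV] fin[of "ball 0 R"] by simp
  have ex: "\<exists>V. open V \<and> A \<subseteq> V \<and> V \<subseteq> ball 0 R \<and> measure M V \<le> measure M A + 1 / real (Suc n)" for n
  proof -
    have NA: "emeasure N A = emeasure M A" using N[OF A(1)] A(2) by (simp add: Int_absorb1)
    have "emeasure N A < emeasure M A + ennreal (1 / real (Suc n))"
      unfolding NA using fin[OF A] by (simp add: ennreal_less_zero_iff)
    then have "(INF U\<in>{U. A \<subseteq> U \<and> open U}. emeasure N U) < emeasure M A + ennreal (1 / real (Suc n))"
      by (simp only: outer_regular[OF sN Nfin A(1)])
    then obtain U where U: "A \<subseteq> U" "open U" "emeasure N U < emeasure M A + ennreal (1 / real (Suc n))"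
      unfolding INF_less_iff by blast
    let ?V = "ball 0 R \<inter> U"
    have V: "?V \<in> sets borel" using U(2) by auto
    have "emeasure M ?V \<le> emeasure M A + ennreal (1 / real (Suc n))"
      using U(3) N[of U] U(2) by (simp add: less_imp_le)
    also have "\<dots> = ennreal (measure M A + 1 / real (Suc n))"
      using fin[OF A] by (simp add: emeasure_eq_ennreal_measure)
    finally have "measure M ?V \<le> measure M A + 1 / real (Suc n)"
      unfolding measure_def[of M ?V] by (intro enn2real_leI) auto
    then show ?thesis using U A(2) by (intro exI[of _ ?V]) auto
  qed
  then obtain V where V: "\<And>n. open (V n)" "\<And>n. A \<subseteq> V n" "\<And>n. V n \<subseteq> ball 0 R"
    "\<And>n. measure M (V n) \<le> measure M A + 1 / real (Suc n)" by metis
  note [measurable] = borel_open[OF V(1)]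
  have int: "integrable M (\<lambda>x. indicator B x :: real)" "integrable M (\<lambda>x. indicator B x * snd \<nu> x)"
    if [measurable]: "B \<in> sets borel" and B: "B \<subseteq> ball 0 R" for B
    using B by (auto intro!: integrable_bounded_support[OF M, where B=1 and R=R]
        simp: norm_mult radon_density_norm[OF \<nu>] indicator_def)
  have Vb: "V n \<in> sets borel" for n by measurable
  have "norm (cm_int \<nu> (indicator (V n)) - cm_int \<nu> (indicator A)) \<le> 1 / real (Suc n)" for n
  proof -
    have "cm_int \<nu> (indicator (V n)) - cm_int \<nu> (indicator A) =
        (LINT x|M. indicator (V n) x * snd \<nu> x - indicator A x * snd \<nu> x)"
      unfolding cm_int_def M_def[symmetric]
      by (rule Bochner_Integration.integral_diff[symmetric, OF int(2)[OF Vb V(3)] int(2)[OF A]])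
    also have "norm \<dots> \<le> (LINT x|M. indicator (V n) x - indicator A x)"
    proof (rule Bochner_Integration.integral_norm_bound_integral)
      show "norm (indicator (V n) x * snd \<nu> x - indicator A x * snd \<nu> x) \<le> indicator (V n) x - indicator A x" for x
        using V(2)[of n] radon_density_norm[OF \<nu>, of x] by (auto simp: indicator_def)
    qed (use int[OF Vb V(3)] int[OF A] in auto)
    also have "\<dots> = measure M (V n) - measure M A"
      using int(1)[OF Vb V(3)] int(1)[OF A] by (simp add: locfin_space[OF M])
    finally show ?thesis using V(4)[of n] by linarith
  qed
  then have "(\<lambda>n. cm_int \<nu> (indicator (V n)) - cm_int \<nu> (indicator A)) \<longlonglongrightarrow> 0"
    by (intro Lim_null_comparison[OF always_eventually LIMSEQ_inverse_real_of_nat]) (simp add: inverse_eq_divide)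
  then have "(\<lambda>n. cm_int \<nu> (indicator (V n))) \<longlonglongrightarrow> cm_int \<nu> (indicator A)" by (simp add: LIM_zero_iff)
  then show ?thesis
    by (rule nonneg_complex_limit) (rule FT_nonneg_open[OF FT pd V(1,3)])
qed

text \<open>Tested on the part of {f < 0} inside a ball, the hypothesis forces the integral of a
  nonpositive function to vanish. Countably many balls exhaust the space.\<close>

lemma AE_nonneg_by_sets:
  fixes f :: "'a::euclidean_space \<Rightarrow> real"
  assumes M: "locfin M" and f: "f \<in> borel_measurable borel" and bd: "\<And>x. \<bar>f x\<bar> \<le> 1"
    and nn: "\<And>A R. A \<in> sets borel \<Longrightarrow> A \<subseteq> ball 0 R \<Longrightarrow> 0 \<le> (LINT x|M. indicator A x * f x)"
  shows "AE x in M. 0 \<le> f x"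
proof -
  note [measurable] = f
  have "AE x in M. x \<in> ball 0 (real n) \<longrightarrow> 0 \<le> f x" for n
  proof -
    define A where "A = {x. f x < 0} \<inter> ball 0 (real n)"
    have A[measurable]: "A \<in> sets borel" unfolding A_def by measurable
    have i: "integrable M (\<lambda>x. - (indicator A x * f x))"
      by (rule integrable_bounded_support[OF M, where B=1 and R="real n"])
        (use bd abs_le_D2 in \<open>fastforce simp: A_def indicator_def\<close>)+
    have p: "AE x in M. 0 \<le> - (indicator A x * f x)" by (auto simp: A_def indicator_def)
    have "0 \<le> (LINT x|M. - (indicator A x * f x))" by (rule integral_nonneg_AE[OF p])
    moreover have "0 \<le> (LINT x|M. indicator A x * f x)" by (rule nn[OF A, of "real n"]) (auto simp: A_def)
    ultimately have "(LINT x|M. - (indicator A x * f x)) = 0" by simp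
    then have "AE x in M. - (indicator A x * f x) = 0"
      using integral_nonneg_eq_0_iff_AE[OF i p] by simp
    then show ?thesis by eventually_elim (auto simp: A_def indicator_def)
  qed
  then have "AE x in M. \<forall>n. x \<in> ball 0 (real n) \<longrightarrow> 0 \<le> f x" by (subst AE_all_countable) blast
  then show ?thesis
  proof eventually_elim
    case (elim x)
    obtain n where "norm x < real n" using reals_Archimedean2 by blast
    then show ?case using elim by auto
  qed
qed

text \<open>Testing with bounded Borel sets gives Re \<ge> 0 and both signs for Im; modulus one
  leaves only the value 1. Integrals against the variation measure thereby become integrals against
  \<nu>, hence expressible through \<mu>.\<close>

theorem FT_positive:
  fixes \<nu> :: "'a::euclidean_space cmeasure"
  assumes FT: "is_FT \<mu> \<nu>" and pd: "pos_def \<mu>"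
  shows "AE x in fst \<nu>. snd \<nu> x = 1"
proof -
  have \<nu>: "radon \<nu>" using FT by (simp add: is_FT_def)
  note M = radon_locfin[OF \<nu>] and n = radon_density_norm[OF \<nu>]
  note [measurable] = radon_density_borel[OF \<nu>]
  have int: "integrable (fst \<nu>) (\<lambda>x. indicator A x * snd \<nu> x)" if [measurable]: "A \<in> sets borel" and "A \<subseteq> ball 0 R" for A R
    using that(2) by (auto intro!: integrable_bounded_support[OF M, where B=1 and R=R]
        simp: norm_mult n indicator_def)
  have re_im: "Re (indicator A x * z) = indicator A x * Re z" "Im (indicator A x * z) = indicator A x * Im z"
    for A :: "'a set" and x z by (simp_all add: indicator_def)
  have part: "(LINT x|fst \<nu>. indicator A x * Re (snd \<nu> x)) = Re (cm_int \<nu> (indicator A))"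
    "(LINT x|fst \<nu>. indicator A x * Im (snd \<nu> x)) = Im (cm_int \<nu> (indicator A))"
    if "A \<in> sets borel" and "A \<subseteq> ball 0 R" for A R
    using integral_Re[OF int[OF that]] integral_Im[OF int[OF that]]
    by (simp_all only: cm_int_def re_im)
  have "AE x in fst \<nu>. 0 \<le> Re (snd \<nu> x)"
  proof (rule AE_nonneg_by_sets[OF M])
    show "\<bar>Re (snd \<nu> x)\<bar> \<le> 1" for x using abs_Re_le_cmod[of "snd \<nu> x"] n[of x] by simp
    show "0 \<le> (LINT x|fst \<nu>. indicator A x * Re (snd \<nu> x))" if "A \<in> sets borel" "A \<subseteq> ball 0 R" for A R
      using FT_nonneg_borel[OF FT pd that] by (simp add: part[OF that])
  qed measurable
  moreover have "AE x in fst \<nu>. 0 \<le> Im (snd \<nu> x)"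
  proof (rule AE_nonneg_by_sets[OF M])
    show "\<bar>Im (snd \<nu> x)\<bar> \<le> 1" for x using abs_Im_le_cmod[of "snd \<nu> x"] n[of x] by simp
    show "0 \<le> (LINT x|fst \<nu>. indicator A x * (Im (snd \<nu> x)))" if "A \<in> sets borel" "A \<subseteq> ball 0 R" for A R
      using FT_nonneg_borel[OF FT pd that] by (simp add: part[OF that])
  qed measurable
  moreover have "AE x in fst \<nu>. 0 \<le> - Im (snd \<nu> x)"
  proof (rule AE_nonneg_by_sets[OF M])
    show "\<bar>- Im (snd \<nu> x)\<bar> \<le> 1" for x using abs_Im_le_cmod[of "snd \<nu> x"] n[of x] by simp
    show "0 \<le> (LINT x|fst \<nu>. indicator A x * (- Im (snd \<nu> x)))" if "A \<in> sets borel" "A \<subseteq> ball 0 R" for A R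
      using FT_nonneg_borel[OF FT pd that] by (simp add: part[OF that])
  qed measurable
  ultimately show ?thesis
  proof eventually_elim
    case (elim x)
    then have "Im (snd \<nu> x) = 0" by simp
    moreover from this have "Re (snd \<nu> x) = 1" using n[of x] elim(1) by (simp add: cmod_eq_Re)
    ultimately show ?case by (simp add: complex_eq_iff)
  qed
qed

subsection \<open>Convergence of the Fourier transforms\<close>

lemma FT_modulated:
  assumes FT: "is_FT \<mu> \<nu>" and \<mu>: "radon \<mu>" and p: "Cc p" and h: "Cc h"
  shows "cm_int \<mu> (\<lambda>x. echar t x * conv p (tilde h) x) =
      cm_int \<nu> (\<lambda>y. icheck p (y - t) * cnj (icheck h (y - t)))"
    and "cm_integrable \<nu> (\<lambda>y. icheck p (y - t) * cnj (icheck h (y - t)))"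
proof -
  have c: "Cc (\<lambda>x. echar t x * p x)" "Cc (\<lambda>x. echar t x * h x)"
    by (intro Cc_mult_left p h continuous_intros)+
  show "cm_int \<mu> (\<lambda>x. echar t x * conv p (tilde h) x) =
      cm_int \<nu> (\<lambda>y. icheck p (y - t) * cnj (icheck h (y - t)))"
    using FT_polarized[OF FT \<mu> c] by (simp only: conv_echar icheck_modulate)
  show "cm_integrable \<nu> (\<lambda>y. icheck p (y - t) * cnj (icheck h (y - t)))"
    using FT_integrable[OF FT \<mu> c] by (simp only: icheck_modulate)
qed

text \<open>The convolution evaluates g at t - y, the modulated transforms at y - t; hence the
  reflected argument in the assumption. The error is integrated against the variation measure, where
  |h^|^2 translated by t is integrable.\<close>

lemma mconv_approx:
  fixes g :: "'a::euclidean_space \<Rightarrow> complex"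
  assumes FT: "is_FT \<mu> \<nu>" and \<mu>: "radon \<mu>" and pd: "pos_def \<mu>" and p: "Cc p" and h: "Cc h" and g: "Cc g"
    and approx: "\<And>y. norm (g (- y) - icheck p y * cnj (icheck h y)) \<le> \<eta> * (cmod (icheck h y))\<^sup>2"
  shows "norm (mconv \<nu> g t - cm_int \<mu> (\<lambda>x. echar t x * conv p (tilde h) x)) \<le>
    \<eta> * norm (cm_int \<mu> (\<lambda>x. echar t x * conv h (tilde h) x))"
proof -
  have \<nu>: "radon \<nu>" using FT by (simp add: is_FT_def)
  let ?F = "\<lambda>y. icheck p (y - t) * cnj (icheck h (y - t))"
  let ?H = "\<lambda>y. (cmod (icheck h (y - t)))\<^sup>2"
  have H: "complex_of_real (?H y) = icheck h (y - t) * cnj (icheck h (y - t))" for y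
    by (rule complex_norm_square)
  have iH: "cm_integrable \<nu> (\<lambda>y. complex_of_real (?H y))"
    unfolding H by (rule FT_modulated(2)[OF FT \<mu> h h])
  have iH': "integrable (fst \<nu>) ?H"
    using integrable_norm[OF iH[unfolded cm_integrable_def]]
    by (simp add: norm_mult norm_power radon_density_norm[OF \<nu>])
  have gi: "cm_integrable \<nu> (\<lambda>y. g (t - y))"
    using cm_integrable_Cc[OF \<nu> Cc_shift[OF Cc_reflect[OF g], of t]] by simp
  note Fi = FT_modulated(2)[OF FT \<mu> p h, of t]
  have "mconv \<nu> g t - cm_int \<mu> (\<lambda>x. echar t x * conv p (tilde h) x) = cm_int \<nu> (\<lambda>y. g (t - y) - ?F y)"
    unfolding mconv_def FT_modulated(1)[OF FT \<mu> p h] by (rule cm_int_diff[OF gi Fi, symmetric])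
  also have "norm \<dots> \<le> (LINT y|fst \<nu>. \<eta> * ?H y)" unfolding cm_int_def
  proof (rule Bochner_Integration.integral_norm_bound_integral)
    show "integrable (fst \<nu>) (\<lambda>y. (g (t - y) - ?F y) * snd \<nu> y)"
      using cm_integrable_diff[OF gi Fi] by (simp add: cm_integrable_def)
    show "norm ((g (t - y) - ?F y) * snd \<nu> y) \<le> \<eta> * ?H y" for y
      using approx[of "y - t"] by (simp add: norm_mult radon_density_norm[OF \<nu>])
  qed (use iH' in simp)
  also have "\<dots> = \<eta> * (LINT y|fst \<nu>. ?H y)" by simp
  \<comment> \<open>By \<open>FT_positive\<close> the density can be inserted freely; this returns
    from the variation measure to \<nu>, whose integral of |h^|^2 is known in terms of
    \<mu>.\<close>
  also have "(LINT y|fst \<nu>. ?H y) = norm (cm_int \<nu> (\<lambda>y. complex_of_real (?H y)))"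
  proof -
    have "cm_int \<nu> (\<lambda>y. complex_of_real (?H y)) = (LINT y|fst \<nu>. complex_of_real (?H y))"
      unfolding cm_int_def
    proof (rule integral_cong_AE)
      show "AE y in fst \<nu>. complex_of_real (?H y) * snd \<nu> y = complex_of_real (?H y)"
        using FT_positive[OF FT pd] by eventually_elim simp
      show "(\<lambda>y. complex_of_real (?H y)) \<in> borel_measurable (fst \<nu>)"
        using borel_measurable_integrable[OF iH'] by measurable
    qed (use borel_measurable_integrable[OF iH[unfolded cm_integrable_def]] in simp)
    also have "\<dots> = of_real (LINT y|fst \<nu>. ?H y)" by (rule integral_complex_of_real)
    finally show ?thesis by (simp only: norm_of_real) simp
  qed
  also have "cm_int \<nu> (\<lambda>y. complex_of_real (?H y)) = cm_int \<mu> (\<lambda>x. echar t x * conv h (tilde h) x)"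
    unfolding H by (rule FT_modulated(1)[OF FT \<mu> h h, symmetric])
  finally show ?thesis .
qed

text \<open>The order of the quantifiers matters: h depends on g alone, so a bound attached to h can
  be fixed first, then \<eta> chosen from it, and only then p.\<close>

lemma exists_approximation:
  fixes g :: "'a::euclidean_space \<Rightarrow> complex"
  assumes g: "Cc g"
  obtains h where "test h"
    "\<And>\<eta>. 0 < \<eta> \<Longrightarrow> \<exists>p. test p \<and> (\<forall>y. norm (g y - icheck p y * cnj (icheck h y)) \<le> \<eta> * (cmod (icheck h y))\<^sup>2)"
proof -
  obtain R where R: "0 < R" "\<And>x. R < norm x \<Longrightarrow> g x = 0" using g by (metis CcE)
  obtain h :: "'a \<Rightarrow> complex" where h: "test h" "\<And>y. norm y \<le> R \<Longrightarrow> icheck h y \<noteq> 0"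
    using exists_test_icheck_nonzero by metis
  then have hc: "Cc h" by blast
  have k: "continuous_on UNIV (\<lambda>y. icheck h y * cnj (icheck h y))"
    by (intro continuous_intros continuous_on_icheck hc)
  have g1: "Cc (\<lambda>y. g y / (icheck h y * cnj (icheck h y)))"
    by (rule Cc_divide[OF g R k]) (use h(2) in auto)
  show ?thesis
  proof (rule that[OF h(1)])
    fix \<eta> :: real assume "0 < \<eta>"
    then obtain q where q: "Cc q" "\<And>y. norm (icheck q y - g y / (icheck h y * cnj (icheck h y))) \<le> \<eta>"
      using icheck_dense[OF g1] by metis
    have "norm (g y - icheck (conv h q) y * cnj (icheck h y)) \<le> \<eta> * (cmod (icheck h y))\<^sup>2" for y
    proof -
      let ?k = "icheck h y * cnj (icheck h y)"
      define G where "G = g y / ?k"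
      \<comment> \<open>Where the denominator vanishes, y lies outside the ball of radius R and g y
        = 0, so the identity survives the division by zero.\<close>
      have "g y = G * ?k" using h(2)[of y] R(2)[of y] by (cases "norm y \<le> R") (auto simp: G_def)
      then have "g y - icheck (conv h q) y * cnj (icheck h y) = - ((icheck q y - G) * ?k)"
        by (simp add: icheck_conv[OF hc q(1)] algebra_simps)
      also have "norm \<dots> = norm (icheck q y - G) * (cmod (icheck h y))\<^sup>2"
        by (simp add: norm_mult power2_eq_square)
      also have "\<dots> \<le> \<eta> * (cmod (icheck h y))\<^sup>2"
        unfolding G_def by (rule mult_right_mono[OF q(2)]) simp
      finally show ?thesis .
    qed
    then show "\<exists>p. test p \<and> (\<forall>y. norm (g y - icheck p y * cnj (icheck h y)) \<le> \<eta> * (cmod (icheck h y))\<^sup>2)"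
      using test_conv[OF h(1) q(1)] by blast
  qed
qed

theorem FT_prod_conv:
  fixes \<mu>s \<nu>s :: "nat \<Rightarrow> 'a::euclidean_space cmeasure"
  assumes \<mu>s: "\<And>n. radon (\<mu>s n)" "\<And>n. pos_def (\<mu>s n)" and \<mu>: "radon \<mu>" "pos_def \<mu>"
    and lim: "\<And>f. test f \<Longrightarrow> uniform_limit UNIV (\<lambda>n t. cm_int (\<mu>s n) (\<lambda>x. echar t x * f x))
      (\<lambda>t. cm_int \<mu> (\<lambda>x. echar t x * f x)) sequentially"
    and FT: "\<And>n. is_FT (\<mu>s n) (\<nu>s n)" "is_FT \<mu> \<nu>"
  shows "prod_conv \<nu>s \<nu>"
  unfolding prod_conv_def
proof (intro allI impI uniform_limitI)
  fix g :: "'a \<Rightarrow> complex" and e :: real assume g: "Cc g" and e: "0 < e"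
  obtain h where h: "test h" and ex: "\<And>\<eta>. 0 < \<eta> \<Longrightarrow>
      \<exists>p. test p \<and> (\<forall>y. norm (g (- y) - icheck p y * cnj (icheck h y)) \<le> \<eta> * (cmod (icheck h y))\<^sup>2)"
    using exists_approximation[OF Cc_reflect[OF g]] by metis
  have hc: "Cc h" using h by blast
  define L where "L \<mu> p t = cm_int \<mu> (\<lambda>x. echar t x * conv p (tilde h) x)" for \<mu> :: "'a cmeasure" and p t
  have Lc: "Cc (conv h (tilde h))" by (rule Cc_conv[OF hc Cc_tilde[OF hc]])
  \<comment> \<open>A character has modulus one, so the total variation integral of h * h~ bounds
    the limit values for all t at once.\<close>
  define D where "D = (LINT x|fst \<mu>. norm (conv h (tilde h) x))"
  have D: "0 \<le> D" unfolding D_def by simp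
  have LD: "norm (L \<mu> h t) \<le> D" for t
  proof -
    have "norm (L \<mu> h t) \<le> (LINT x|fst \<mu>. norm (echar t x * conv h (tilde h) x * snd \<mu> x))"
      unfolding L_def cm_int_def by (rule integral_norm_bound)
    then show ?thesis by (simp add: norm_mult radon_density_norm[OF \<mu>(1)] D_def)
  qed
  \<comment> \<open>The limit values are bounded by D, and uniform convergence with tolerance 1
    bounds those of \<mu>_n by D + 1 for large n. With this \<eta> both approximation errors are at
    most e / 3, leaving e / 3 for the convergence on p * h~.\<close>
  define \<eta> where "\<eta> = e / 3 / (D + 1)"
  have "D + 1 \<noteq> 0" using D by linarith
  then have \<eta>: "0 < \<eta>" "\<eta> * (D + 1) = e / 3"
    using e D nonzero_divide_eq_eq[of "D + 1" "e / 3" \<eta>] by (simp_all add: \<eta>_def)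
  obtain p where p: "test p"
    and approx: "\<And>y. norm (g (- y) - icheck p y * cnj (icheck h y)) \<le> \<eta> * (cmod (icheck h y))\<^sup>2"
    using ex[OF \<eta>(1)] by blast
  have pc: "Cc p" using p by blast
  have "uniform_limit UNIV (\<lambda>n. L (\<mu>s n) u) (L \<mu> u) sequentially" if "test u" for u
    unfolding L_def[abs_def] by (rule lim[OF test_conv[OF that Cc_tilde[OF hc]]])
  note ul = uniform_limitD[OF this]
  have "\<forall>\<^sub>F n in sequentially. \<forall>t\<in>UNIV. dist (L (\<mu>s n) h t) (L \<mu> h t) < 1"
    by (rule ul[OF h]) simp
  moreover have "\<forall>\<^sub>F n in sequentially. \<forall>t\<in>UNIV. dist (L (\<mu>s n) p t) (L \<mu> p t) < e / 3"
    by (rule ul[OF p]) (use e in simp)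
  ultimately show "\<forall>\<^sub>F n in sequentially. \<forall>t\<in>UNIV. dist (mconv (\<nu>s n) g t) (mconv \<nu> g t) < e"
  proof eventually_elim
    case (elim n)
    show ?case
    proof
      fix t :: 'a
      have "norm (L (\<mu>s n) h t) \<le> D + 1"
        using bspec[OF elim(1) UNIV_I, of t] LD[of t] norm_triangle_sub[of "L (\<mu>s n) h t" "L \<mu> h t"]
        unfolding dist_norm by linarith
      then have "\<eta> * norm (L (\<mu>s n) h t) \<le> e / 3"
        unfolding \<eta>(2)[symmetric] by (rule mult_left_mono) (use \<eta>(1) in simp)
      moreover have "norm (mconv (\<nu>s n) g t - L (\<mu>s n) p t) \<le> \<eta> * norm (L (\<mu>s n) h t)"
        unfolding L_def by (rule mconv_approx[OF FT(1) \<mu>s pc hc g approx])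
      moreover have "\<eta> * norm (L \<mu> h t) \<le> e / 3"
        unfolding \<eta>(2)[symmetric] by (rule mult_left_mono) (use \<eta>(1) LD[of t] in simp_all)
      moreover have "norm (mconv \<nu> g t - L \<mu> p t) \<le> \<eta> * norm (L \<mu> h t)"
        unfolding L_def by (rule mconv_approx[OF FT(2) \<mu> pc hc g approx])
      moreover have "norm (L (\<mu>s n) p t - L \<mu> p t) < e / 3"
        using elim(2) by (simp add: dist_norm)
      moreover have "norm (mconv (\<nu>s n) g t - mconv \<nu> g t) \<le> norm (mconv (\<nu>s n) g t - L (\<mu>s n) p t)
          + norm (L (\<mu>s n) p t - L \<mu> p t) + norm (mconv \<nu> g t - L \<mu> p t)"
        using norm_triangle_ineq4[of "(mconv (\<nu>s n) g t - L (\<mu>s n) p t) + (L (\<mu>s n) p t - L \<mu> p t)" "mconv \<nu> g t - L \<mu> p t"]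
          norm_triangle_ineq[of "mconv (\<nu>s n) g t - L (\<mu>s n) p t" "L (\<mu>s n) p t - L \<mu> p t"] by simp
      ultimately show "dist (mconv (\<nu>s n) g t) (mconv \<nu> g t) < e"
        unfolding dist_norm by linarith
    qed
  qed
qed

theorem theorem8p5:
  fixes \<mu>s :: "nat \<Rightarrow> 'a::euclidean_space cmeasure" and \<mu> :: "'a cmeasure"
  assumes "\<And>n. radon (\<mu>s n)" and "\<And>n. pos_def (\<mu>s n)"
    and "radon \<mu>" and "tempered \<mu>"
    and "\<And>f. schwartz f \<Longrightarrow>
      uniform_limit UNIV
        (\<lambda>n t. act (\<mu>s n) (\<lambda>x. exp (- 2 * of_real pi * \<i> * of_real (t \<bullet> x)) * f x))
        (\<lambda>t. act \<mu> (\<lambda>x. exp (- 2 * of_real pi * \<i> * of_real (t \<bullet> x)) * f x))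
        sequentially"
    and "vaguely_bounded \<mu>s"
  shows "pos_def \<mu> \<and>
    (\<forall>\<nu>s \<nu>. (\<forall>n. is_FT (\<mu>s n) (\<nu>s n)) \<and> is_FT \<mu> \<nu> \<longrightarrow> prod_conv \<nu>s \<nu>)"
proof -
  have act_s: "act (\<mu>s n) (\<lambda>x. echar t x * f x) = cm_int (\<mu>s n) (\<lambda>x. echar t x * f x)" if "test f" for n t f
    by (rule act_test[OF assms(1) pos_def_tempered[OF assms(1,2)] test_echar[OF that]])
  have act: "act \<mu> (\<lambda>x. echar t x * f x) = cm_int \<mu> (\<lambda>x. echar t x * f x)" if "test f" for t f
    by (rule act_test[OF assms(3,4) test_echar[OF that]])
  have lim: "uniform_limit UNIV (\<lambda>n t. cm_int (\<mu>s n) (\<lambda>x. echar t x * f x))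
      (\<lambda>t. cm_int \<mu> (\<lambda>x. echar t x * f x)) sequentially" if f: "test f" for f
    using assms(5)[OF conjunct2[OF f]] by (simp only: echar_def[symmetric] act_s[OF f] act[OF f])
  have pd: "pos_def \<mu>"
  proof (rule pos_def_limit[OF assms(3,2)])
    fix f :: "'a \<Rightarrow> complex" assume "test f"
    \<comment> \<open>At t = 0 the character is 1, so the modulated limit becomes plain convergence
      on test functions.\<close>
    from tendsto_uniform_limitI[OF lim[OF this], of 0] show "(\<lambda>n. cm_int (\<mu>s n) f) \<longlonglongrightarrow> cm_int \<mu> f"
      by simp
  qed
  then show ?thesis
    using FT_prod_conv[OF assms(1,2,3) pd lim] by blast
qed

end
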